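(* Let $(\Omega,\Sigma,\mu)$ be a measure space and let $X,Y$ be real Banach spaces. Assume that there is a quotient operator $Q:X\to Y$ such that $\ker Q$ is weakly countably determined and proximinal in $X$. If $\mathrm{NA}_\pi(L_1(\mu)\widehat{\otimes}_\pi X)=L_1(\mu)\widehat{\otimes}_\pi X$, then $\mathrm{NA}_\pi(L_1(\mu)\widehat{\otimes}_\pi Y)=L_1(\mu)\widehat{\otimes}_\pi Y$.
   Context: All spaces are real. A bounded operator $Q:X\to Y$ is a quotient operator if it is onto and $\|y\|=\inf\{\|x\|:Qx=y\}$ for each $y\in Y$. A subspace $Z\subseteq X$ is proximinal if for every $x\in X$ there is $z\in Z$ with $\|x-z\|=\operatorname{dist}(x,Z)$. A Banach space $Z$ is weakly countably determined (WCD) if there is a sequence $(K_n)$ of weak*-compact subsets of $Z^{**}$ such that for every $z\in Z$ and $z^{**}\in Z^{**}\setminus Z$ there is $n$ with $z\in K_n$ and $z^{**}\notin K_n$ (e.g. separable or reflexive spaces). $X\widehat{\otimes}_\pi Y$ denotes the projective tensor product; $L_1(\mu)\widehat{\otimes}_\pi Y$ is isometrically identified with the space $L_1(\mu,Y)$ of Bochner integrable functions. An element $u\in X\widehat{\otimes}_\pi Y$ attains its projective norm if there are $(x_i)\subseteq X$, $(y_i)\subseteq Y$ with $u=\sum_{i=1}^\infty x_i\otimes y_i$ and $\|u\|_\pi=\sum_{i=1}^\infty\|x_i\|\|y_i\|$; $\mathrm{NA}_\pi(X\widehat{\otimes}_\pi Y)$ is the set of such elements. *)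

theory Defs
  imports "HOL-Analysis.Analysis" "HOL-Library.Function_Algebras"
begin

text \<open>
  \<open>L\<^sub>1(\<mu>)\<close> and the kernel of an operator depend on terms, so they cannot be types. A
  (semi)normed space is therefore given here by a linear subspace \<open>V\<close> of a real vector space
  together with a (semi)norm \<open>p\<close> that is only meaningful on \<open>V\<close>. The ambient vector spaces are
  often function spaces with the pointwise operations.
\<close>

instantiation "fun" :: (type, real_vector) real_vector
begin

definition scaleR_fun :: "real \<Rightarrow> ('a \<Rightarrow> 'b) \<Rightarrow> 'a \<Rightarrow> 'b"
  where "scaleR_fun c f = (\<lambda>x. c *\<^sub>R f x)"

instance
  by standard (simp_all add: scaleR_fun_def plus_fun_def fun_eq_iff algebra_simps)

end


section \<open>Duals, biduals and weakly countably determined spaces\<close>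

text \<open>
  Functionals on \<open>V\<close> are extended by \<open>0\<close> outside \<open>V\<close>, so that distinct elements of the dual are
  distinct functions on \<open>V\<close> and the dual is again a linear subspace of a function space.
\<close>

definition dual_space :: "'a::real_vector set \<Rightarrow> ('a \<Rightarrow> real) \<Rightarrow> ('a \<Rightarrow> real) set"
  where "dual_space V p = {\<phi>.
    (\<forall>x\<in>V. \<forall>y\<in>V. \<phi> (x + y) = \<phi> x + \<phi> y) \<and>
    (\<forall>c. \<forall>x\<in>V. \<phi> (c *\<^sub>R x) = c * \<phi> x) \<and>
    (\<exists>C. \<forall>x\<in>V. \<bar>\<phi> x\<bar> \<le> C * p x) \<and>
    (\<forall>x. x \<notin> V \<longrightarrow> \<phi> x = 0)}"

definition dual_norm :: "'a::real_vector set \<Rightarrow> ('a \<Rightarrow> real) \<Rightarrow> ('a \<Rightarrow> real) \<Rightarrow> real"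
  where "dual_norm V p \<phi> = Sup {\<bar>\<phi> x\<bar> | x. x \<in> V \<and> p x \<le> 1}"

definition bidual_space :: "'a::real_vector set \<Rightarrow> ('a \<Rightarrow> real) \<Rightarrow> (('a \<Rightarrow> real) \<Rightarrow> real) set"
  where "bidual_space V p = dual_space (dual_space V p) (dual_norm V p)"

definition canonical_embedding ::
    "'a::real_vector set \<Rightarrow> ('a \<Rightarrow> real) \<Rightarrow> 'a \<Rightarrow> ('a \<Rightarrow> real) \<Rightarrow> real"
  where "canonical_embedding V p z = (\<lambda>\<phi>. if \<phi> \<in> dual_space V p then \<phi> z else 0)"

text \<open>
  The weak* topology of the bidual is the coarsest one making all evaluations
  \<open>\<Phi> \<mapsto> \<Phi> \<phi>\<close> with \<open>\<phi>\<close> in the dual continuous.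
\<close>

definition weak_star_topology ::
    "'a::real_vector set \<Rightarrow> ('a \<Rightarrow> real) \<Rightarrow> (('a \<Rightarrow> real) \<Rightarrow> real) topology"
  where "weak_star_topology V p = topology_generated_by
    {{\<Phi> \<in> bidual_space V p. \<Phi> \<phi> \<in> U} | \<phi> U. \<phi> \<in> dual_space V p \<and> open U}"

definition weakly_countably_determined :: "'a::real_normed_vector set \<Rightarrow> bool"
  where "weakly_countably_determined Z \<longleftrightarrow>
    (\<exists>K :: nat \<Rightarrow> (('a \<Rightarrow> real) \<Rightarrow> real) set.
      (\<forall>n. compactin (weak_star_topology Z norm) (K n)) \<and>
      (\<forall>z\<in>Z. \<forall>\<Phi> \<in> bidual_space Z norm - canonical_embedding Z norm ` Z.
        \<exists>n. canonical_embedding Z norm z \<in> K n \<and> \<Phi> \<notin> K n))"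


section \<open>Quotient operators and proximinality\<close>

definition quotient_operator :: "('a::real_normed_vector \<Rightarrow> 'b::real_normed_vector) \<Rightarrow> bool"
  where "quotient_operator Q \<longleftrightarrow>
    bounded_linear Q \<and> surj Q \<and> (\<forall>y. norm y = Inf {norm x | x. Q x = y})"

definition proximinal :: "'a::real_normed_vector set \<Rightarrow> bool"
  where "proximinal Z \<longleftrightarrow> subspace Z \<and> (\<forall>x. \<exists>z\<in>Z. norm (x - z) = infdist x Z)"


section \<open>Completion of a seminormed space\<close>

text \<open>
  The completion of \<open>(V, p)\<close> consists of the classes of \<open>p\<close>-Cauchy sequences in \<open>V\<close> modulo null
  sequences. If \<open>p\<close> is only a seminorm, this is the completion of the associated normed
  space. A Cauchy sequence in \<open>V\<close> converges, in the completion, to its own class.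
\<close>

definition Cauchy_sequences :: "'a::real_vector set \<Rightarrow> ('a \<Rightarrow> real) \<Rightarrow> (nat \<Rightarrow> 'a) set"
  where "Cauchy_sequences V p = {u. range u \<subseteq> V \<and>
    (\<forall>e>0. \<exists>N. \<forall>m\<ge>N. \<forall>n\<ge>N. p (u m - u n) < e)}"

definition completion :: "'a::real_vector set \<Rightarrow> ('a \<Rightarrow> real) \<Rightarrow> (nat \<Rightarrow> 'a) set set"
  where "completion V p = Cauchy_sequences V p //
    {(u, v). u \<in> Cauchy_sequences V p \<and> v \<in> Cauchy_sequences V p \<and>
      (\<lambda>n. p (u n - v n)) \<longlonglongrightarrow> 0}"

definition completion_norm :: "('a \<Rightarrow> real) \<Rightarrow> (nat \<Rightarrow> 'a) set \<Rightarrow> real"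
  where "completion_norm p U = (THE r. \<forall>u\<in>U. (\<lambda>n. p (u n)) \<longlonglongrightarrow> r)"


section \<open>Projective tensor products\<close>

text \<open>
  The elementary tensor of \<open>x\<close> and \<open>y\<close> is evaluation at \<open>(x, y)\<close> on the bilinear forms. The
  algebraic tensor product of \<open>V\<close> with \<open>'b\<close> is the span of the tensors with \<open>x \<in> V\<close>; using
  bilinear forms on the whole ambient space is harmless, because a bilinear form on
  \<open>V \<times> 'b\<close> extends to the ambient space.
\<close>

type_synonym ('a, 'b) tensor = "('a \<Rightarrow> 'b \<Rightarrow> real) \<Rightarrow> real"

definition tensor :: "'a::real_vector \<Rightarrow> 'b::real_vector \<Rightarrow> ('a, 'b) tensor"
  where "tensor x y = (\<lambda>B. if bilinear B then B x y else 0)"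

definition algebraic_tensor :: "'a::real_vector set \<Rightarrow> ('a, 'b::real_vector) tensor set"
  where "algebraic_tensor V = span {tensor x y | x y. x \<in> V}"

definition projective_norm ::
    "'a::real_vector set \<Rightarrow> ('a \<Rightarrow> real) \<Rightarrow> ('a, 'b::real_normed_vector) tensor \<Rightarrow> real"
  where "projective_norm V p u = Inf {(\<Sum>i<n. p (x i) * norm (y i)) | (n::nat) x y.
    (\<forall>i<n. x i \<in> V) \<and> u = (\<Sum>i<n. tensor (x i) (y i))}"

definition projective_tensor ::
    "'a::real_vector set \<Rightarrow> ('a \<Rightarrow> real) \<Rightarrow> 'b::real_normed_vector itself
      \<Rightarrow> (nat \<Rightarrow> ('a, 'b) tensor) set set"
  where "projective_tensor V p _ = completion (algebraic_tensor V) (projective_norm V p)"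

text \<open>
  That \<open>U\<close> is the sum of the series of the \<open>x\<^sub>i \<otimes> y\<^sub>i\<close> means that the sequence of
  partial sums belongs to the class \<open>U\<close>.
\<close>

definition norm_attaining_tensors ::
    "'a::real_vector set \<Rightarrow> ('a \<Rightarrow> real) \<Rightarrow> 'b::real_normed_vector itself
      \<Rightarrow> (nat \<Rightarrow> ('a, 'b) tensor) set set"
  where "norm_attaining_tensors V p T = {U \<in> projective_tensor V p T.
    \<exists>(x :: nat \<Rightarrow> 'a) (y :: nat \<Rightarrow> 'b). (\<forall>i. x i \<in> V) \<and>
      (\<lambda>n. \<Sum>i<n. tensor (x i) (y i)) \<in> U \<and>
      (\<lambda>i. p (x i) * norm (y i)) sums completion_norm (projective_norm V p) U}"


section \<open>The space of integrable functions\<close>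

text \<open>
  Functions equal almost everywhere are not identified: \<open>L1_norm M\<close> is a seminorm on
  \<open>L1 M\<close> and the identification takes place in the completion that defines
  the projective tensor product.
\<close>

definition L1 :: "'w measure \<Rightarrow> ('w \<Rightarrow> real) set"
  where "L1 M = {f. integrable M f}"

definition L1_norm :: "'w measure \<Rightarrow> ('w \<Rightarrow> real) \<Rightarrow> real"
  where "L1_norm M f = (\<integral>w. \<bar>f w\<bar> \<partial>M)"

end

theory Submission
  imports Defs
begin

text \<open>
  An element of the projective tensor product of \<open>L\<^sub>1(\<mu>)\<close> and \<open>Y\<close> is a Bochner integrable function \<open>g\<close>
  with values in \<open>Y\<close>. If \<open>f\<close> is an integrable lift of \<open>g\<close> through \<open>Q\<close> with
  \<open>\<parallel>f(t)\<parallel> \<le> \<parallel>g(t)\<parallel>\<close> almost everywhere, then applying \<open>Q\<close> to a norm-attaining representation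
  of \<open>f\<close> gives one of \<open>g\<close>, because \<open>Q\<close> is a contraction.

  To find \<open>f\<close>, start with any strongly measurable lift \<open>h\<close> and subtract a measurable choice of
  a best approximation of \<open>h(t)\<close> in \<open>ker Q\<close>. Proximinality gives best approximations pointwise. Since
  \<open>ker Q\<close> is weakly countably determined, a separable subset of it contains best approximations of all points
  in the separable range of \<open>h\<close>, and the choice can be made measurably outside a null set by
  exhausting the measure with sets on which the candidates lie in a fixed compact set.
\<close>

section \<open>Hahn-Banach theorem\<close>

text \<open>Selecting directly from the best approximations runs into a measurability obstacle: the
  points whose section of a closed relation meets a given set form a projection, and projections of
  closed sets need not be Borel. Along a compact factor they are closed, which is why the selection
  passes through compact sets. The best approximations need not lie in a separable set; countable
  determination enters because weak* cluster points of approximate choices must fall back into the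
  kernel, where norms are weakly lower semicontinuous. Since \<open>M\<close> is arbitrary, the
  selection is made for the finite measure with density \<open>norm (g t)\<close>. The isometry of
  the lift closes the chain \<parallel>g\<parallel> \<le> \<Sum> \<parallel>x_i\<parallel>
  \<parallel>Q w_i\<parallel> \<le> \<Sum> \<parallel>x_i\<parallel> \<parallel>w_i\<parallel> =
  \<parallel>f\<parallel> \<le> \<parallel>g\<parallel>. Completions are classes of sequences of
  formal tensors, so the isometric identification of the projective tensor product with the Bochner
  space is itself part of the proof.\<close>

definition sublinear :: "('a::real_vector \<Rightarrow> real) \<Rightarrow> bool"
  where "sublinear p \<longleftrightarrow> (\<forall>x y. p (x + y) \<le> p x + p y) \<and> (\<forall>c x. 0 \<le> c \<longrightarrow> p (c *\<^sub>R x) = c * p x)"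

lemma sublinearD:
  assumes "sublinear p"
  shows "p (x + y) \<le> p x + p y" "0 \<le> c \<Longrightarrow> p (c *\<^sub>R x) = c * p x" "p 0 = 0" "- p (- x) \<le> p x"
proof -
  show 1: "p (x + y) \<le> p x + p y" and 2: "0 \<le> c \<Longrightarrow> p (c *\<^sub>R x) = c * p x"
    for x y c using assms by (auto simp: sublinear_def)
  from 2[of 0 x] show 3: "p 0 = 0" by simp
  from 1[of x "- x"] 3 show "- p (- x) \<le> p x" by simp
qed

text \<open>Oddness turns subadditivity, applied to \<open>x + y\<close> and \<open>- y\<close>,
  into superadditivity and extends homogeneity to negative scalars.\<close>

lemma sublinear_linear:
  assumes "sublinear p" and "\<And>x. p (- x) = - p x"
  shows "linear p"
proof (rule linearI)
  fix x y c
  have "p x \<le> p (x + y) + p (- y)"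
    using sublinearD(1)[OF assms(1), of "x + y" "- y"] by simp
  with assms(2)[of y] sublinearD(1)[OF assms(1), of x y] show "p (x + y) = p x + p y" by simp
  show "p (c *\<^sub>R x) = c *\<^sub>R p x"
  proof (cases "0 \<le> c")
    case True
    then show ?thesis using sublinearD(2)[OF assms(1)] by simp
  next
    case False
    then have "p ((- c) *\<^sub>R x) = (- c) * p x" by (intro sublinearD(2)[OF assms(1)]) simp
    then show ?thesis using assms(2)[of "c *\<^sub>R x"] by simp
  qed
qed

text \<open>The largest sublinear minorant of \<open>p\<close> with value at most \<open>- p a\<close> at \<open>- a\<close>.\<close>

definition sublinear_shift :: "('a::real_vector \<Rightarrow> real) \<Rightarrow> 'a \<Rightarrow> 'a \<Rightarrow> real"
  where "sublinear_shift p a x = (INF t\<in>{0..}. p (x + t *\<^sub>R a) - t * p a)"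

text \<open>The bound is independent of \<open>t\<close>, so the infimum in
  \<open>sublinear_shift\<close> is taken over a set that is bounded below.\<close>

lemma sublinear_shift_lower:
  assumes "sublinear p" "0 \<le> t"
  shows "- p (- x) \<le> p (x + t *\<^sub>R a) - t * p a"
  using sublinearD(1)[OF assms(1), of "x + t *\<^sub>R a" "- x"] sublinearD(2)[OF assms, of a] by simp

lemma sublinear_shift_le:
  assumes "sublinear p" "0 \<le> t"
  shows "sublinear_shift p a x \<le> p (x + t *\<^sub>R a) - t * p a"
  unfolding sublinear_shift_def
  by (rule cINF_lower) (use assms sublinear_shift_lower[OF assms(1)] in \<open>auto intro!: bdd_belowI2\<close>)

lemma le_sublinear_shift:
  assumes "\<And>t. 0 \<le> t \<Longrightarrow> r \<le> p (x + t *\<^sub>R a) - t * p a"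
  shows "r \<le> sublinear_shift p a x"
  unfolding sublinear_shift_def by (rule cINF_greatest) (use assms in auto)

lemma sublinear_sublinear_shift:
  assumes p: "sublinear p"
  shows "sublinear (sublinear_shift p a)"
proof -
  let ?q = "sublinear_shift p a"
  have add: "?q (x + y) \<le> ?q x + ?q y" for x y
  proof -
    have "?q (x + y) - ?q y \<le> ?q x"
    proof (rule le_sublinear_shift)
      fix s :: real assume s: "0 \<le> s"
      have "?q (x + y) - (p (x + s *\<^sub>R a) - s * p a) \<le> ?q y"
      proof (rule le_sublinear_shift)
        fix t :: real assume t: "0 \<le> t"
        \<comment> \<open>Shifts \<open>s\<close> for \<open>x\<close> and \<open>t\<close> for
          \<open>y\<close> combine into the admissible shift \<open>s + t\<close>; the two infima
          are then taken one at a time.\<close>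
        have "?q (x + y) \<le> p (x + y + (s + t) *\<^sub>R a) - (s + t) * p a"
          using s t by (intro sublinear_shift_le[OF p]) simp
        also have "p (x + y + (s + t) *\<^sub>R a) \<le> p (x + s *\<^sub>R a) + p (y + t *\<^sub>R a)"
          using sublinearD(1)[OF p, of "x + s *\<^sub>R a" "y + t *\<^sub>R a"] by (simp add: algebra_simps)
        finally show "?q (x + y) - (p (x + s *\<^sub>R a) - s * p a) \<le> p (y + t *\<^sub>R a) - t * p a"
          by (simp add: algebra_simps)
      qed
      then show "?q (x + y) - ?q y \<le> p (x + s *\<^sub>R a) - s * p a" by simp
    qed
    then show ?thesis by simp
  qed
  have scale_le: "?q (c *\<^sub>R x) \<le> c * ?q x" if c: "0 < c" for c x
  proof -
    have "?q (c *\<^sub>R x) / c \<le> ?q x"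
    proof (rule le_sublinear_shift)
      fix t :: real assume t: "0 \<le> t"
      have "?q (c *\<^sub>R x) \<le> p (c *\<^sub>R x + (c * t) *\<^sub>R a) - (c * t) * p a"
        using c t by (intro sublinear_shift_le[OF p]) simp
      also have "c *\<^sub>R x + (c * t) *\<^sub>R a = c *\<^sub>R (x + t *\<^sub>R a)" by (simp add: algebra_simps)
      also have "p \<dots> = c * p (x + t *\<^sub>R a)" using c by (intro sublinearD(2)[OF p]) simp
      finally show "?q (c *\<^sub>R x) / c \<le> p (x + t *\<^sub>R a) - t * p a"
        using c by (simp add: field_simps)
    qed
    then show ?thesis using c by (simp add: field_simps)
  qed
  have scale: "?q (c *\<^sub>R x) = c * ?q x" if c: "0 \<le> c" for c x
  proof (cases "c = 0")
    case True
    have "?q 0 = 0"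
    proof (rule antisym)
      show "?q 0 \<le> 0" using sublinear_shift_le[OF p, of 0 a 0] sublinearD(3)[OF p] by simp
      show "0 \<le> ?q 0"
        using sublinear_shift_lower[OF p, of _ 0] sublinearD(3)[OF p] by (intro le_sublinear_shift) simp
    qed
    then show ?thesis using True by simp
  next
    case False
    with c have c: "0 < c" by simp
    \<comment> \<open>The reverse inequality is \<open>scale_le\<close> for the scalar
      \<open>1 / c\<close> at the point \<open>c *\<^sub>R x\<close>.\<close>
    have "?q ((1 / c) *\<^sub>R (c *\<^sub>R x)) \<le> (1 / c) * ?q (c *\<^sub>R x)" using c by (intro scale_le) simp
    then have "c * ?q x \<le> ?q (c *\<^sub>R x)" using c by (simp add: field_simps)
    with scale_le[OF c, of x] show ?thesis by simp
  qed
  show ?thesis unfolding sublinear_def using add scale by blast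
qed

text \<open>Subadditivity needs the chain condition: of two members \<open>q\<close> and
  \<open>r\<close> the smaller one serves both points, so the infimum at \<open>x + y\<close> is at
  most \<open>q x + r y\<close>.\<close>

lemma sublinear_INF:
  assumes "C \<noteq> {}" and sub: "\<And>q. q \<in> C \<Longrightarrow> sublinear q"
    and chain: "\<And>q r. q \<in> C \<Longrightarrow> r \<in> C \<Longrightarrow> q \<le> r \<or> r \<le> q"
    and bdd: "\<And>x. bdd_below ((\<lambda>q. q x) ` C)"
  shows "sublinear (\<lambda>x. INF q\<in>C. q x)"
proof -
  have lower: "(INF q\<in>C. q x) \<le> q x" if "q \<in> C" for q x
    using bdd that by (intro cINF_lower)
  have add: "(INF q\<in>C. q (x + y)) \<le> (INF q\<in>C. q x) + (INF q\<in>C. q y)" for x y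
  proof -
    have *: "(INF q\<in>C. q (x + y)) \<le> q x + r y" if "q \<in> C" "r \<in> C" for q r
      using chain[OF that]
    proof
      assume "q \<le> r"
      then have "q (x + y) \<le> q x + r y"
        using sublinearD(1)[OF sub[OF that(1)], of x y] by (auto dest: le_funD[of _ _ y])
      then show ?thesis using lower[OF that(1), of "x + y"] by linarith
    next
      assume "r \<le> q"
      then have "r (x + y) \<le> q x + r y"
        using sublinearD(1)[OF sub[OF that(2)], of x y] by (auto dest: le_funD[of _ _ x])
      then show ?thesis using lower[OF that(2), of "x + y"] by linarith
    qed
    have "(INF q\<in>C. q (x + y)) - (INF q\<in>C. q y) \<le> (INF q\<in>C. q x)"
    proof (rule cINF_greatest[OF assms(1)])
      fix q assume q: "q \<in> C"
      have "(INF q\<in>C. q (x + y)) - q x \<le> (INF q\<in>C. q y)"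
        by (rule cINF_greatest[OF assms(1)]) (use *[OF q] in fastforce)
      then show "(INF q\<in>C. q (x + y)) - (INF q\<in>C. q y) \<le> q x" by simp
    qed
    then show ?thesis by simp
  qed
  have scale: "(INF q\<in>C. q (c *\<^sub>R x)) = c * (INF q\<in>C. q x)" if c: "0 \<le> c" for c x
  proof -
    have "(INF q\<in>C. q (c *\<^sub>R x)) = (INF q\<in>C. c * q x)"
      using sublinearD(2)[OF sub c] by (intro INF_cong) auto
    also have "\<dots> = c * (INF q\<in>C. q x)"
    proof (cases "c = 0")
      case True then show ?thesis using assms(1) by simp
    next
      case False
      with c have c: "0 < c" by simp
      show ?thesis
      proof (rule antisym)
        have bd: "bdd_below ((\<lambda>q. c * q x) ` C)"
          using bdd_below_image_mono[of "(*) c" "(\<lambda>q. q x) ` C"] bdd c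
          by (auto simp: image_image mono_def)
        have "(INF q\<in>C. c * q x) / c \<le> (INF q\<in>C. q x)"
          using c by (intro cINF_greatest[OF assms(1)])
            (auto simp: divide_le_eq mult.commute[of _ c] intro!: cINF_lower[OF bd])
        then show "(INF q\<in>C. c * q x) \<le> c * (INF q\<in>C. q x)" using c by (simp add: field_simps)
        show "c * (INF q\<in>C. q x) \<le> (INF q\<in>C. c * q x)"
          using c lower by (intro cINF_greatest[OF assms(1)]) auto
      qed
    qed
    finally show ?thesis .
  qed
  show ?thesis unfolding sublinear_def using add scale by blast
qed

text \<open>
  A minimal sublinear functional \<open>q\<close> equals \<open>sublinear_shift q a\<close> for every \<open>a\<close>, which makes
  it odd and hence linear.
\<close>

theorem Hahn_Banach_sublinear:
  fixes p :: "'a::real_vector \<Rightarrow> real"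
  assumes p: "sublinear p"
  obtains \<phi> where "linear \<phi>" "\<And>x. \<phi> x \<le> p x" "\<phi> a = p a"
proof -
  \<comment> \<open>Minimising below the shift by \<open>a\<close>, and not just below
    \<open>p\<close>, forces \<open>m (- a) \<le> - p a\<close>, hence \<open>m a = p a\<close> once
    \<open>m\<close> is odd.\<close>
  define q0 where "q0 = sublinear_shift p a"
  have q0: "sublinear q0" unfolding q0_def by (rule sublinear_sublinear_shift[OF p])
  define A where "A = {q. sublinear q \<and> q \<le> q0}"
  \<comment> \<open>Zorn's lemma is used for the reversed pointwise order, so its maximal element is
    a minimal sublinear functional.\<close>
  have "\<exists>m\<in>A. \<forall>q\<in>A. m \<ge> q \<longrightarrow> q = m"
  proof (rule predicate_Zorn)
    show "partial_order_on A (relation_of (\<ge>) A)"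
      by (rule partial_order_on_relation_ofI) auto
    fix C assume "C \<in> Chains (relation_of (\<ge>) A)"
    then have chain: "\<And>q r. q \<in> C \<Longrightarrow> r \<in> C \<Longrightarrow> q \<le> r \<or> r \<le> q" and CA: "C \<subseteq> A"
      by (auto simp: Chains_def relation_of_def)
    show "\<exists>u\<in>A. \<forall>q\<in>C. q \<ge> u"
    proof (cases "C = {}")
      case True
      then show ?thesis using q0 by (auto simp: A_def)
    next
      case False
      have bdd: "bdd_below ((\<lambda>q. q x) ` C)" for x
      proof (rule bdd_belowI2)
        fix q assume "q \<in> C"
        then have "sublinear q" "q (- x) \<le> q0 (- x)" using CA by (auto simp: A_def le_fun_def)
        then show "- q0 (- x) \<le> q x" using sublinearD(4)[of q x] by simp
      qed
      let ?u = "\<lambda>x. INF q\<in>C. q x"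
      have "sublinear ?u"
        using False chain bdd CA by (intro sublinear_INF) (auto simp: A_def)
      moreover have le: "?u \<le> q" if "q \<in> C" for q
        using bdd that by (auto intro!: le_funI cINF_lower)
      moreover have "?u \<le> q0"
      proof -
        obtain q where "q \<in> C" using False by blast
        then show ?thesis using le[of q] CA by (auto simp: A_def intro: order_trans)
      qed
      ultimately show ?thesis by (auto simp: A_def)
    qed
  qed
  then obtain m where mA: "m \<in> A" and min: "\<And>q. q \<in> A \<Longrightarrow> q \<le> m \<Longrightarrow> q = m" by auto
  have m: "sublinear m" and mq0: "m \<le> q0" using mA by (auto simp: A_def)
  have odd: "m (- x) = - m x" for x
  proof -
    let ?r = "sublinear_shift m x"
    have le: "?r \<le> m"
      using sublinear_shift_le[OF m, of 0 x] by (auto intro!: le_funI)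
    moreover have "sublinear ?r" by (rule sublinear_sublinear_shift[OF m])
    ultimately have "?r = m"
      using mq0 by (intro min) (auto simp: A_def)
    moreover have "?r (- x) \<le> - m x"
      using sublinear_shift_le[OF m, of 1 x "- x"] sublinearD(3)[OF m] by simp
    ultimately have "m (- x) \<le> - m x" by simp
    with sublinearD(4)[OF m, of "x"] show ?thesis by simp
  qed
  have mp: "m x \<le> p x" for x
    using le_funD[OF mq0, of x] sublinear_shift_le[OF p, of 0 a x] by (simp add: q0_def)
  have "m (- a) \<le> - p a"
    using le_funD[OF mq0, of "- a"] sublinear_shift_le[OF p, of 1 a "- a"] sublinearD(3)[OF p]
    by (simp add: q0_def)
  then have "m a = p a" using odd[of a] mp[of a] by simp
  then show thesis using that sublinear_linear[OF m odd] mp by blast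
qed

section \<open>Norming and separating functionals\<close>

lemma sublinear_norm: "sublinear (norm :: 'a::real_normed_vector \<Rightarrow> real)"
  by (simp add: sublinear_def norm_triangle_ineq)

lemma linear_le_norm_abs:
  assumes "linear \<phi>" "\<And>x. \<phi> x \<le> norm x"
  shows "\<bar>\<phi> x\<bar> \<le> norm x"
  using assms(2)[of x] assms(2)[of "- x"] linear_neg[OF assms(1), of x] by simp

lemma norming_functional:
  fixes a :: "'a::real_normed_vector"
  obtains \<phi> where "linear \<phi>" "\<And>x. \<bar>\<phi> x\<bar> \<le> norm x" "\<phi> a = norm a"
  using Hahn_Banach_sublinear[OF sublinear_norm, of a] linear_le_norm_abs by metis

lemma infdist_subspace_le:
  assumes "subspace S" "s \<in> S"
  shows "infdist x S \<le> norm (x - s)"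
  using infdist_le[OF assms(2), of x] by (simp add: dist_norm)

text \<open>As a majorant in the Hahn-Banach theorem the distance vanishes on \<open>S\<close>, and
  so it produces functionals that vanish there.\<close>

lemma sublinear_infdist_subspace:
  assumes S: "subspace (S :: 'a::real_normed_vector set)"
  shows "sublinear (\<lambda>x. infdist x S)"
proof -
  have ne: "S \<noteq> {}" using subspace_0[OF S] by blast
  have approx: "\<exists>s\<in>S. norm (x - s) < infdist x S + e" if "0 < e" for x e
    using cInf_lessD[of "dist x ` S" "infdist x S + e"] ne that
    by (auto simp: infdist_def dist_norm)
  have add: "infdist (x + y) S \<le> infdist x S + infdist y S" for x y
  proof (rule field_le_epsilon)
    fix e :: real assume e: "0 < e"
    obtain s t where st: "s \<in> S" "t \<in> S" "norm (x - s) < infdist x S + e / 2"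
      "norm (y - t) < infdist y S + e / 2"
      using approx[of "e/2"] e by (metis half_gt_zero)
    have "infdist (x + y) S \<le> norm (x + y - (s + t))"
      using st by (intro infdist_subspace_le[OF S] subspace_add[OF S])
    also have "\<dots> \<le> norm (x - s) + norm (y - t)"
      using norm_triangle_ineq[of "x - s" "y - t"] by (simp add: algebra_simps)
    finally show "infdist (x + y) S \<le> infdist x S + infdist y S + e" using st by simp
  qed
  have scale_le: "infdist (c *\<^sub>R x) S \<le> c * infdist x S" if c: "0 < c" for c x
  proof (rule field_le_epsilon)
    fix e :: real assume e: "0 < e"
    obtain s where s: "s \<in> S" "norm (x - s) < infdist x S + e / c"
      using approx[of "e/c"] e c by fastforce
    have "infdist (c *\<^sub>R x) S \<le> norm (c *\<^sub>R x - c *\<^sub>R s)"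
      using s by (intro infdist_subspace_le[OF S] subspace_scale[OF S])
    also have "\<dots> = c * norm (x - s)"
      using c by (simp flip: scaleR_diff_right)
    also have "\<dots> \<le> c * (infdist x S + e / c)" using s c by simp
    finally show "infdist (c *\<^sub>R x) S \<le> c * infdist x S + e" using c by (simp add: algebra_simps)
  qed
  have scale: "infdist (c *\<^sub>R x) S = c * infdist x S" if c: "0 \<le> c" for c x
  proof (cases "c = 0")
    case True
    then show ?thesis using subspace_0[OF S] by simp
  next
    case False
    with c have c: "0 < c" by simp
    have "infdist ((1 / c) *\<^sub>R (c *\<^sub>R x)) S \<le> (1 / c) * infdist (c *\<^sub>R x) S"
      using c by (intro scale_le) simp
    then have "c * infdist x S \<le> infdist (c *\<^sub>R x) S" using c by (simp add: field_simps)
    with scale_le[OF c, of x] show ?thesis by simp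
  qed
  show ?thesis unfolding sublinear_def using add scale by blast
qed

text \<open>A functional dominated by the distance to \<open>S\<close> is at most 0 at both
  \<open>s\<close> and \<open>- s\<close>. Its value at \<open>a\<close> is the distance itself,
  positive because \<open>S\<close> is closed.\<close>

lemma separating_functional:
  fixes S :: "'a::real_normed_vector set"
  assumes S: "subspace S" and cl: "closed S" and a: "a \<notin> S"
  obtains \<phi> where "linear \<phi>" "\<And>x. \<bar>\<phi> x\<bar> \<le> norm x" "\<And>s. s \<in> S \<Longrightarrow> \<phi> s = 0" "\<phi> a \<noteq> 0"
proof -
  obtain \<phi> where \<phi>: "linear \<phi>" "\<And>x. \<phi> x \<le> infdist x S" "\<phi> a = infdist a S"
    using Hahn_Banach_sublinear[OF sublinear_infdist_subspace[OF S], of a] by metis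
  have "\<phi> x \<le> norm x" for x
    using \<phi>(2)[of x] infdist_subspace_le[OF S subspace_0[OF S], of x] by simp
  then have "\<bar>\<phi> x\<bar> \<le> norm x" for x using linear_le_norm_abs[OF \<phi>(1)] by blast
  moreover have "\<phi> s = 0" if s: "s \<in> S" for s
    using \<phi>(2)[of s] \<phi>(2)[of "- s"] s subspace_neg[OF S s] linear_neg[OF \<phi>(1), of s] by simp
  moreover have "\<phi> a \<noteq> 0"
    using \<phi>(3) cl a subspace_0[OF S] in_closed_iff_infdist_zero[of S a] by auto
  ultimately show thesis using that \<phi>(1) by blast
qed

section \<open>Separable reduction in weakly countably determined kernels\<close>

lemma dual_spaceI:
  assumes "\<And>x y. x \<in> V \<Longrightarrow> y \<in> V \<Longrightarrow> \<phi> (x + y) = \<phi> x + \<phi> y"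
    and "\<And>c x. x \<in> V \<Longrightarrow> \<phi> (c *\<^sub>R x) = c * \<phi> x"
    and "\<And>x. x \<in> V \<Longrightarrow> \<bar>\<phi> x\<bar> \<le> C * p x"
    and "\<And>x. x \<notin> V \<Longrightarrow> \<phi> x = 0"
  shows "\<phi> \<in> dual_space V p"
  using assms unfolding dual_space_def by blast

lemma dual_spaceD:
  assumes "\<phi> \<in> dual_space V p"
  shows "x \<in> V \<Longrightarrow> y \<in> V \<Longrightarrow> \<phi> (x + y) = \<phi> x + \<phi> y"
    and "x \<in> V \<Longrightarrow> \<phi> (c *\<^sub>R x) = c * \<phi> x"
    and "x \<notin> V \<Longrightarrow> \<phi> x = 0"
  using assms unfolding dual_space_def by blast+

lemma dual_space_bounded:
  "\<phi> \<in> dual_space V p \<Longrightarrow> \<exists>C. \<forall>x\<in>V. \<bar>\<phi> x\<bar> \<le> C * p x"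
  unfolding dual_space_def by blast

lemma bdd_above_dual_norm:
  fixes V :: "'a::real_normed_vector set"
  assumes "\<phi> \<in> dual_space V norm"
  shows "bdd_above {\<bar>\<phi> x\<bar> | x. x \<in> V \<and> norm x \<le> 1}"
proof -
  obtain C where C: "\<And>x. x \<in> V \<Longrightarrow> \<bar>\<phi> x\<bar> \<le> C * norm x" using dual_space_bounded[OF assms] by blast
  show ?thesis
  proof (rule bdd_aboveI)
    fix r assume "r \<in> {\<bar>\<phi> x\<bar> | x. x \<in> V \<and> norm x \<le> 1}"
    then obtain x where x: "r = \<bar>\<phi> x\<bar>" "x \<in> V" "norm x \<le> 1" by blast
    have "r \<le> C * norm x" using C x by simp
    \<comment> \<open>\<open>C\<close> may be negative when \<open>V\<close> contains no nonzero
      vector, hence the absolute value.\<close>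
    also have "\<dots> \<le> \<bar>C\<bar> * 1" using x by (intro mult_mono) auto
    finally show "r \<le> \<bar>C\<bar>" by simp
  qed
qed

lemma dual_norm_bound:
  fixes V :: "'a::real_normed_vector set"
  assumes V: "subspace V" and \<phi>: "\<phi> \<in> dual_space V norm" and x: "x \<in> V"
  shows "\<bar>\<phi> x\<bar> \<le> dual_norm V norm \<phi> * norm x"
proof (cases "x = 0")
  case True
  then show ?thesis using dual_spaceD(2)[OF \<phi> x, of 0] by simp
next
  case False
  have "\<bar>\<phi> ((1 / norm x) *\<^sub>R x)\<bar> \<le> dual_norm V norm \<phi>"
    unfolding dual_norm_def
    by (rule cSup_upper[OF _ bdd_above_dual_norm[OF \<phi>]]) (use False subspace_scale[OF V x, of "1 / norm x"] in auto)
  then show ?thesis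
    using dual_spaceD(2)[OF \<phi> x, of "1 / norm x"] False
    by (simp add: abs_mult field_simps)
qed

text \<open>The embedded point is evaluation only on the dual, so its additivity and homogeneity
  rest on the dual being closed under sums and multiples.\<close>

lemma canonical_embedding_in_bidual:
  fixes V :: "'a::real_normed_vector set"
  assumes "subspace V" and "z \<in> V"
  shows "canonical_embedding V norm z \<in> bidual_space V norm"
  unfolding bidual_space_def
proof (rule dual_spaceI[where C = "norm z"])
  fix \<phi> \<psi> assume mem: "\<phi> \<in> dual_space V norm" "\<psi> \<in> dual_space V norm"
  obtain C where C: "\<And>x. x \<in> V \<Longrightarrow> \<bar>\<phi> x\<bar> \<le> C * norm x" using dual_space_bounded[OF mem(1)] by blast
  obtain D where D: "\<And>x. x \<in> V \<Longrightarrow> \<bar>\<psi> x\<bar> \<le> D * norm x" using dual_space_bounded[OF mem(2)] by blast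
  have "\<bar>\<phi> x + \<psi> x\<bar> \<le> (C + D) * norm x" if "x \<in> V" for x
    using C[OF that] D[OF that] by (simp add: algebra_simps)
  then have "\<phi> + \<psi> \<in> dual_space V norm"
    using dual_spaceD[OF mem(1)] dual_spaceD[OF mem(2)]
    by (intro dual_spaceI[where C = "C + D"]) (auto simp: algebra_simps)
  then show "canonical_embedding V norm z (\<phi> + \<psi>)
      = canonical_embedding V norm z \<phi> + canonical_embedding V norm z \<psi>"
    using mem by (simp add: canonical_embedding_def)
next
  fix c \<phi> assume mem: "\<phi> \<in> dual_space V norm"
  obtain C where C: "\<And>x. x \<in> V \<Longrightarrow> \<bar>\<phi> x\<bar> \<le> C * norm x"
    using dual_space_bounded[OF mem] by blast
  have "\<bar>c * \<phi> x\<bar> \<le> (\<bar>c\<bar> * C) * norm x" if "x \<in> V" for x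
    using mult_left_mono[OF C[OF that], of "\<bar>c\<bar>"] by (simp add: abs_mult mult.assoc)
  then have "c *\<^sub>R \<phi> \<in> dual_space V norm"
    using dual_spaceD[OF mem]
    by (intro dual_spaceI[where C = "\<bar>c\<bar> * C"]) (auto simp: scaleR_fun_def algebra_simps)
  then show "canonical_embedding V norm z (c *\<^sub>R \<phi>) = c * canonical_embedding V norm z \<phi>"
    using mem by (simp add: canonical_embedding_def scaleR_fun_def)
next
  fix \<phi> assume "\<phi> \<in> dual_space V norm"
  then show "\<bar>canonical_embedding V norm z \<phi>\<bar> \<le> norm z * dual_norm V norm \<phi>"
    using dual_norm_bound[OF assms(1) _ assms(2)] by (simp add: canonical_embedding_def mult.commute)
qed (simp add: canonical_embedding_def)

lemma weak_star_basic_open: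
  assumes "\<phi> \<in> dual_space V p" "open U"
  shows "openin (weak_star_topology V p) {\<Phi> \<in> bidual_space V p. \<Phi> \<phi> \<in> U}"
  unfolding weak_star_topology_def by (rule topology_generated_by_Basis) (use assms in blast)

lemma topspace_weak_star: "topspace (weak_star_topology V p) \<subseteq> bidual_space V p"
  unfolding weak_star_topology_def by auto

text \<open>Elements of the bidual vanish outside the dual, so two distinct ones differ at a dual
  functional, whose evaluation separates them. This makes the compact sets of a WCD space
  closed.\<close>

lemma Hausdorff_weak_star: "Hausdorff_space (weak_star_topology V p)"
  unfolding Hausdorff_space_def
proof (intro allI impI)
  fix \<Phi> \<Psi> assume "\<Phi> \<in> topspace (weak_star_topology V p) \<and> \<Psi> \<in> topspace (weak_star_topology V p) \<and> \<Phi> \<noteq> \<Psi>"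
  then have mem: "\<Phi> \<in> bidual_space V p" "\<Psi> \<in> bidual_space V p" and "\<Phi> \<noteq> \<Psi>"
    using topspace_weak_star by auto
  then obtain \<phi> where ne: "\<Phi> \<phi> \<noteq> \<Psi> \<phi>" by auto
  then have \<phi>: "\<phi> \<in> dual_space V p"
    using dual_spaceD(3)[of \<Phi>] dual_spaceD(3)[of \<Psi>] mem unfolding bidual_space_def by metis
  obtain S T where "open S" "open T" "\<Phi> \<phi> \<in> S" "\<Psi> \<phi> \<in> T" "S \<inter> T = {}"
    using hausdorff[OF ne] by blast
  then show "\<exists>S T. openin (weak_star_topology V p) S \<and> openin (weak_star_topology V p) T \<and>
      \<Phi> \<in> S \<and> \<Psi> \<in> T \<and> disjnt S T"
    using mem weak_star_basic_open[OF \<phi>] 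
    by (intro exI[of _ "{\<Phi> \<in> bidual_space V p. \<Phi> \<phi> \<in> S}"] exI[of _ "{\<Phi> \<in> bidual_space V p. \<Phi> \<phi> \<in> T}"])
      (auto simp: disjnt_iff)
qed

text \<open>Pointwise convergence on the dual is weak* convergence. A general filter is allowed
  because a bounded sequence need not have a weak* convergent subsequence in the bidual.\<close>

lemma eventually_in_weak_star_open:
  assumes "openin (weak_star_topology V p) W" "\<Phi> \<in> W"
    and J: "\<And>k. J k \<in> bidual_space V p"
    and lim: "\<And>\<phi>. \<phi> \<in> dual_space V p \<Longrightarrow> ((\<lambda>k. J k \<phi>) \<longlongrightarrow> \<Phi> \<phi>) G"
  shows "\<forall>\<^sub>F k in G. J k \<in> W"
proof -
  have "generate_topology_on {{\<Phi> \<in> bidual_space V p. \<Phi> \<phi> \<in> U} | \<phi> U. \<phi> \<in> dual_space V p \<and> open U} W"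
    using assms(1) unfolding weak_star_topology_def by (simp add: openin_topology_generated_by_iff)
  then have "\<Phi> \<in> W \<longrightarrow> (\<forall>\<^sub>F k in G. J k \<in> W)"
  proof induction
    case (Int a b)
    then show ?case by (auto elim: eventually_elim2)
  next
    case (UN K)
    show ?case
    proof
      assume "\<Phi> \<in> \<Union>K"
      then obtain k where "k \<in> K" "\<forall>\<^sub>F i in G. J i \<in> k" using UN.IH by blast
      then show "\<forall>\<^sub>F k in G. J k \<in> \<Union>K" by (auto elim: eventually_mono)
    qed
  next
    case (Basis s)
    then obtain \<phi> U where "s = {\<Phi> \<in> bidual_space V p. \<Phi> \<phi> \<in> U}" "\<phi> \<in> dual_space V p" "open U"
      by blast
    then show ?case using topological_tendstoD[OF lim, of \<phi> U] J by auto
  qed simp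
  then show ?thesis using assms(2) by simp
qed

text \<open>The Banach-Alaoglu argument: the embedded sequence lies in a product of compact
  intervals, so by Tychonoff's theorem it has a cluster point, and it converges to that point along
  a finer filter.\<close>

lemma weak_star_cluster_point:
  fixes V :: "'a::real_normed_vector set"
  assumes V: "subspace V" and z: "\<And>k. z k \<in> V" "\<And>k::nat. norm (z k) \<le> C"
  shows "\<exists>G \<Phi>. G \<noteq> bot \<and> G \<le> sequentially \<and> \<Phi> \<in> bidual_space V norm \<and>
    (\<forall>\<phi>. ((\<lambda>k. canonical_embedding V norm (z k) \<phi>) \<longlongrightarrow> \<Phi> \<phi>) G)"
proof -
  let ?J = "\<lambda>k. canonical_embedding V norm (z k)"
  define b where "b \<phi> = (if \<phi> \<in> dual_space V norm then C * dual_norm V norm \<phi> else 0)" for \<phi>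
  define S where "S = Pi\<^sub>E UNIV (\<lambda>\<phi>. {- b \<phi>..b \<phi>})"
  have Jb: "\<bar>?J k \<phi>\<bar> \<le> b \<phi>" for k \<phi>
  proof (cases "\<phi> \<in> dual_space V norm")
    case True
    have nn: "0 \<le> dual_norm V norm \<phi>"
      unfolding dual_norm_def
    proof (rule cSup_upper[OF _ bdd_above_dual_norm[OF True]])
      show "0 \<in> {\<bar>\<phi> x\<bar> |x. x \<in> V \<and> norm x \<le> 1}"
        using subspace_0[OF V] dual_spaceD(2)[OF True subspace_0[OF V], of 0] by force
    qed
    have "\<bar>\<phi> (z k)\<bar> \<le> dual_norm V norm \<phi> * norm (z k)" by (rule dual_norm_bound[OF V True z(1)])
    also have "\<dots> \<le> dual_norm V norm \<phi> * C" by (rule mult_left_mono[OF z(2) nn])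
    finally show ?thesis using True by (simp add: b_def canonical_embedding_def mult.commute)
  qed (simp add: b_def canonical_embedding_def)
  have "compactin (product_topology (\<lambda>_. euclidean) UNIV) S"
    unfolding S_def compactin_PiE by simp
  then have "compact S" by (simp add: euclidean_product_topology)
  moreover have "?J k \<in> S" for k using Jb[of k] by (auto simp: S_def abs_le_iff minus_le_iff)
  then have "eventually (\<lambda>\<Psi>. \<Psi> \<in> S) (filtermap ?J sequentially)" by (simp add: eventually_filtermap)
  moreover have "filtermap ?J sequentially \<noteq> bot" by (simp add: filtermap_bot_iff)
  ultimately obtain \<Phi> where \<Phi>: "inf (nhds \<Phi>) (filtermap ?J sequentially) \<noteq> bot"
    unfolding compact_filter by blast
  \<comment> \<open>\<open>G\<close> is generated by the tails of the sequence and the index sets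
    mapped into a given neighbourhood of \<open>\<Phi>\<close>; it is proper because
    \<open>\<Phi>\<close> is a cluster point.\<close>
  define G where "G = inf sequentially (filtercomap ?J (nhds \<Phi>))"
  have "G \<noteq> bot"
  proof
    assume "G = bot"
    then obtain P R where PR: "eventually P sequentially" "eventually R (nhds \<Phi>)"
      "\<And>k. P k \<Longrightarrow> R (?J k) \<Longrightarrow> False"
      unfolding G_def trivial_limit_def eventually_inf eventually_filtercomap by blast
    then have "eventually (\<lambda>\<Psi>. \<not> R \<Psi>) (filtermap ?J sequentially)"
      using eventually_mono[OF PR(1), where Q = "\<lambda>k. \<not> R (?J k)"] PR(3) by (auto simp: eventually_filtermap)
    then have "eventually (\<lambda>_. False) (inf (nhds \<Phi>) (filtermap ?J sequentially))"
      using PR(2) unfolding eventually_inf by blast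
    then show False using \<Phi> by (simp add: trivial_limit_def)
  qed
  have "filterlim ?J (nhds \<Phi>) G"
    unfolding G_def by (rule filterlim_mono[OF filterlim_filtercomap order_refl]) simp
  then have lim: "((\<lambda>k. ?J k \<phi>) \<longlongrightarrow> \<Phi> \<phi>) G" for \<phi>
  proof (rule filterlim_compose[rotated])
    have "((\<lambda>\<Psi>. \<Psi> \<phi>) \<longlongrightarrow> \<Phi> \<phi>) (at \<Phi>)"
      using continuous_on_product_coordinates[of \<phi>] unfolding continuous_on_def by blast
    then show "((\<lambda>\<Psi>. \<Psi> \<phi>) \<longlongrightarrow> \<Phi> \<phi>) (nhds \<Phi>)"
      using tendsto_at_iff_tendsto_nhds[of "\<lambda>\<Psi>. \<Psi> \<phi>" \<Phi>] by blast
  qed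
  have Jbi: "?J k \<in> bidual_space V norm" for k by (rule canonical_embedding_in_bidual[OF V z(1)])
  \<comment> \<open>Linearity, the norm bound and the value 0 outside the dual all pass to the limit
    along \<open>G\<close>.\<close>
  have "\<Phi> \<in> bidual_space V norm"
    unfolding bidual_space_def
  proof (rule dual_spaceI[where C = C])
    fix \<phi> \<psi> assume mem: "\<phi> \<in> dual_space V norm" "\<psi> \<in> dual_space V norm"
    have "((\<lambda>k. ?J k (\<phi> + \<psi>)) \<longlongrightarrow> \<Phi> \<phi> + \<Phi> \<psi>) G"
      using tendsto_add[OF lim lim] dual_spaceD(1)[OF Jbi[unfolded bidual_space_def] mem] by simp
    then show "\<Phi> (\<phi> + \<psi>) = \<Phi> \<phi> + \<Phi> \<psi>" using tendsto_unique[OF \<open>G \<noteq> bot\<close> lim] by simp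
  next
    fix c \<phi> assume mem: "\<phi> \<in> dual_space V norm"
    have "((\<lambda>k. ?J k (c *\<^sub>R \<phi>)) \<longlongrightarrow> c * \<Phi> \<phi>) G"
      using tendsto_mult[OF tendsto_const lim] dual_spaceD(2)[OF Jbi[unfolded bidual_space_def] mem] by simp
    then show "\<Phi> (c *\<^sub>R \<phi>) = c * \<Phi> \<phi>" using tendsto_unique[OF \<open>G \<noteq> bot\<close> lim] by simp
  next
    fix \<phi> assume mem: "\<phi> \<in> dual_space V norm"
    show "\<bar>\<Phi> \<phi>\<bar> \<le> C * dual_norm V norm \<phi>"
      by (rule tendsto_upperbound[OF tendsto_rabs[OF lim[of \<phi>]]])
        (use Jb[of _ \<phi>] mem \<open>G \<noteq> bot\<close> in \<open>simp_all add: b_def\<close>)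
  next
    fix \<phi> :: "'a \<Rightarrow> real" assume "\<phi> \<notin> dual_space V norm"
    then have "((\<lambda>k. ?J k \<phi>) \<longlongrightarrow> 0) G" by (simp add: canonical_embedding_def)
    then show "\<Phi> \<phi> = 0" using tendsto_unique[OF \<open>G \<noteq> bot\<close> lim] by simp
  qed
  moreover have "G \<le> sequentially" by (simp add: G_def)
  ultimately show ?thesis using \<open>G \<noteq> bot\<close> lim by (intro exI[of _ G] exI[of _ \<Phi>]) simp
qed

section \<open>Countable sets whose closure is a subspace\<close>

definition rational_span :: "'a::real_vector set \<Rightarrow> 'a set"
  where "rational_span B = (\<lambda>l. \<Sum>(q, b)\<leftarrow>l. of_rat q *\<^sub>R b) ` lists (UNIV \<times> B)"

lemma countable_rational_span: "countable B \<Longrightarrow> countable (rational_span B)"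
  unfolding rational_span_def by (intro countable_image countable_lists) simp

lemma rational_span_add:
  assumes "x \<in> rational_span B" "y \<in> rational_span B"
  shows "x + y \<in> rational_span B"
proof -
  obtain k l where "k \<in> lists (UNIV \<times> B)" "l \<in> lists (UNIV \<times> B)"
    "x = (\<Sum>(q, b)\<leftarrow>k. of_rat q *\<^sub>R b)" "y = (\<Sum>(q, b)\<leftarrow>l. of_rat q *\<^sub>R b)"
    using assms unfolding rational_span_def by blast
  then show ?thesis unfolding rational_span_def by (intro image_eqI[of _ _ "k @ l"]) simp_all
qed

lemma rational_span_scale:
  assumes "x \<in> rational_span B"
  shows "of_rat r *\<^sub>R x \<in> rational_span B"
proof -
  obtain l where l: "l \<in> lists (UNIV \<times> B)" "x = (\<Sum>(q, b)\<leftarrow>l. of_rat q *\<^sub>R b)"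
    using assms unfolding rational_span_def by blast
  have "of_rat r *\<^sub>R (\<Sum>(q, b)\<leftarrow>l. of_rat q *\<^sub>R b) = (\<Sum>(q, b)\<leftarrow>map (\<lambda>(q, b). (r * q, b)) l. of_rat q *\<^sub>R b)"
    by (induction l) (auto simp: scaleR_add_right of_rat_mult)
  moreover have "map (\<lambda>(q, b). (r * q, b)) l \<in> lists (UNIV \<times> B)" using l(1) by (auto simp: lists_eq_set)
  ultimately show ?thesis unfolding rational_span_def l(2) by (intro image_eqI)
qed

lemma subset_rational_span: "B \<subseteq> rational_span B"
proof
  fix b assume "b \<in> B"
  then show "b \<in> rational_span B"
    unfolding rational_span_def by (intro image_eqI[of _ _ "[(1, b)]"]) simp_all
qed

lemma rational_span_subset:
  assumes "subspace S" "B \<subseteq> S"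
  shows "rational_span B \<subseteq> S"
proof -
  have "(\<Sum>(q, b)\<leftarrow>l. of_rat q *\<^sub>R b) \<in> S" if "l \<in> lists (UNIV \<times> B)" for l
    using that assms
    by (induction l) (auto intro!: subspace_0 subspace_add subspace_scale)
  then show ?thesis unfolding rational_span_def by blast
qed

text \<open>Stability under real scalars comes from the closure, where a real factor is a limit of
  rational ones.\<close>

lemma subspace_closure_rational_span:
  fixes B :: "'a::real_normed_vector set"
  shows "subspace (closure (rational_span B))"
  unfolding subspace_def
proof (intro conjI ballI allI)
  have "(0::'a) \<in> rational_span B"
    unfolding rational_span_def by (intro image_eqI[of _ _ "[]"]) simp_all
  then show "0 \<in> closure (rational_span B)" using closure_subset by blast
next
  fix x y assume "x \<in> closure (rational_span B)" "y \<in> closure (rational_span B)"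
  then obtain f g where "\<And>n. f n \<in> rational_span B" "f \<longlonglongrightarrow> x" "\<And>n. g n \<in> rational_span B" "g \<longlonglongrightarrow> y"
    unfolding closure_sequential by blast
  then show "x + y \<in> closure (rational_span B)"
    unfolding closure_sequential
    by (intro exI[of _ "\<lambda>n. f n + g n"]) (auto intro!: tendsto_add rational_span_add)
next
  fix c x assume "x \<in> closure (rational_span B)"
  then obtain f where f: "\<And>n. f n \<in> rational_span B" "f \<longlonglongrightarrow> x"
    unfolding closure_sequential by blast
  have "\<exists>q::rat. c < of_rat q \<and> of_rat q < c + 1 / real (Suc n)" for n
    by (rule of_rat_dense) simp
  then obtain r where r: "\<And>n. c < of_rat (r n)" "\<And>n. of_rat (r n) < c + 1 / real (Suc n)" by metis
  have "(\<lambda>n. of_rat (r n)) \<longlonglongrightarrow> c"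
  proof (rule tendsto_sandwich[of "\<lambda>_. c" _ _ "\<lambda>n. c + 1 / real (Suc n)"])
    show "(\<lambda>n. c + 1 / real (Suc n)) \<longlonglongrightarrow> c"
      using tendsto_add[OF tendsto_const LIMSEQ_Suc[OF lim_1_over_n], of c] by simp
  qed (use r in \<open>auto simp: less_imp_le\<close>)
  then show "c *\<^sub>R x \<in> closure (rational_span B)"
    unfolding closure_sequential using f
    by (intro exI[of _ "\<lambda>n. of_rat (r n) *\<^sub>R f n"]) (auto intro!: tendsto_scaleR rational_span_scale)
qed

lemma restricted_functional_in_dual:
  fixes V :: "'a::real_normed_vector set"
  assumes "subspace V" "linear \<phi>" "\<And>x. \<bar>\<phi> x\<bar> \<le> norm x"
  shows "(\<lambda>x. if x \<in> V then \<phi> x else 0) \<in> dual_space V norm"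
  using assms
  by (intro dual_spaceI[where C = 1])
    (auto simp: subspace_add subspace_scale linear_add linear_scale)

text \<open>
  Index finite subfamilies of the \<open>K n\<close> by lists \<open>l\<close>. For every \<open>l\<close>, every \<open>d \<in> D\<close> and every
  \<open>n\<close> choose, if possible, a pair \<open>(x, z)\<close> with \<open>x\<close> close to \<open>d\<close> such that \<open>z\<close> is admissible
  for \<open>x\<close> and lies in the \<open>K i\<close> with \<open>i\<close> in \<open>l\<close>. For a given \<open>x\<close> with admissible \<open>z\<close>, the points
  chosen near \<open>x\<close> for initial segments of \<open>{i. z \<in> K i}\<close> have a weak* cluster point; it
  lies in every \<open>K i\<close> containing \<open>z\<close>, hence in the kernel.
\<close>

theorem WCD_separable_reduction:
  fixes Q :: "'x::real_normed_vector \<Rightarrow> 'y::real_normed_vector"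
  assumes Q: "bounded_linear Q" and wcd: "weakly_countably_determined {x. Q x = 0}"
    and prox: "\<And>x. \<exists>z. Q z = 0 \<and> norm (x - z) \<le> norm (Q x)"
    and D: "countable D"
  shows "\<exists>B. countable B \<and> B \<subseteq> {x. Q x = 0} \<and>
    (\<forall>x\<in>closure D. \<exists>z\<in>closure B. norm (x - z) \<le> norm (Q x))"
proof -
  interpret Q: bounded_linear Q by (rule Q)
  define Z where "Z = {x. Q x = 0}"
  let ?J = "canonical_embedding Z norm"
  have Zsub: "subspace Z" unfolding Z_def subspace_def by (simp add: Q.add Q.scaleR)
  obtain K :: "nat \<Rightarrow> _" where K: "\<And>n. compactin (weak_star_topology Z norm) (K n)"
    and KZ: "\<And>z \<Phi>. z \<in> Z \<Longrightarrow> \<Phi> \<in> bidual_space Z norm - ?J ` Z \<Longrightarrow> \<exists>n. ?J z \<in> K n \<and> \<Phi> \<notin> K n"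
    using wcd unfolding weakly_countably_determined_def Z_def by blast
  have Kcl: "closedin (weak_star_topology Z norm) (K n)" for n
    by (rule compactin_imp_closedin[OF Hausdorff_weak_star K])
  define W where "W l d n x z \<longleftrightarrow> z \<in> Z \<and> norm (x - z) \<le> norm (Q x) \<and> (\<forall>i\<in>set l. ?J z \<in> K i) \<and>
    dist x d < 1 / real (Suc n)" for l :: "nat list" and d :: 'x and n :: nat and x z
  \<comment> \<open>The choices depend on \<open>l\<close>, \<open>d\<close> and \<open>n\<close>
    alone, so only countably many points arise from \<open>D\<close>.\<close>
  define \<xi> where "\<xi> l d n = (SOME x. \<exists>z. W l d n x z)" for l d n
  define \<zeta> where "\<zeta> l d n = (SOME z. W l d n (\<xi> l d n) z)" for l d n
  have \<xi>\<zeta>: "W l d n (\<xi> l d n) (\<zeta> l d n)" if "W l d n x z" for l d n x z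
  proof -
    have "\<exists>z. W l d n (\<xi> l d n) z" unfolding \<xi>_def by (rule someI_ex) (use that in blast)
    then show ?thesis unfolding \<zeta>_def by (rule someI_ex)
  qed
  \<comment> \<open>The condition \<open>\<zeta> l d n \<in> Z\<close> discards arbitrary values
    taken where no admissible pair exists.\<close>
  define B0 where "B0 = {\<zeta> l d n | l d n. d \<in> D \<and> \<zeta> l d n \<in> Z}"
  have "B0 \<subseteq> (\<lambda>(l, d, n). \<zeta> l d n) ` (UNIV \<times> D \<times> UNIV)"
    unfolding B0_def by (force simp: image_iff)
  then have "countable B0" by (rule countable_subset) (use D in simp)
  \<comment> \<open>Passing to the rational span makes \<open>closure B\<close> a closed subspace,
    which by separation contains its weak limits.\<close>
  define B where "B = rational_span B0"
  have B: "countable B" "B \<subseteq> Z"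
    unfolding B_def
    by (rule countable_rational_span[OF \<open>countable B0\<close>],
      rule rational_span_subset[OF Zsub]) (auto simp: B0_def)
  have Bsub: "subspace (closure B)" unfolding B_def by (rule subspace_closure_rational_span)
  have "\<exists>z\<in>closure B. norm (x - z) \<le> norm (Q x)" if x: "x \<in> closure D" for x
  proof -
    obtain z where z: "z \<in> Z" "norm (x - z) \<le> norm (Q x)" using prox[of x] by (auto simp: Z_def)
    \<comment> \<open>The set of all \<open>i\<close> with \<open>?J z \<in> K i\<close> may be
      infinite; its finite segments eventually contain each such \<open>i\<close>.\<close>
    define l where "l k = filter (\<lambda>i. ?J z \<in> K i) [0..<k]" for k
    have "\<exists>d\<in>D. dist d x < 1 / real (Suc k)" for k
      using x unfolding closure_approachable by simp
    then obtain d where d: "\<And>k. d k \<in> D" "\<And>k. dist (d k) x < 1 / real (Suc k)" by metis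
    define y where "y k = \<xi> (l k) (d k) k" for k
    define s where "s k = \<zeta> (l k) (d k) k" for k
    \<comment> \<open>The pair of \<open>x\<close> and \<open>z\<close> itself witnesses that an
      admissible choice near \<open>d k\<close> exists.\<close>
    have Wk: "W (l k) (d k) k (y k) (s k)" for k
      unfolding y_def s_def
      by (rule \<xi>\<zeta>[of _ _ _ x z]) (use z d(2)[of k] in \<open>auto simp: W_def l_def dist_commute\<close>)
    have sZ: "s k \<in> Z" for k using Wk[of k] by (simp add: W_def)
    have sB: "s k \<in> closure B" for k
    proof -
      have "s k \<in> B0" using sZ[of k] d(1)[of k] by (auto simp: B0_def s_def)
      then show ?thesis using subset_rational_span closure_subset unfolding B_def by blast
    qed
    have yx: "y \<longlonglongrightarrow> x"
    proof (rule metric_tendsto_imp_tendsto[of "\<lambda>n. 2 * (1 / real (Suc n))" 0])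
      show "(\<lambda>n. 2 * (1 / real (Suc n))) \<longlonglongrightarrow> 0"
        using tendsto_mult[OF tendsto_const LIMSEQ_Suc[OF lim_1_over_n], of "2::real"] by simp
      have "dist (y n) x \<le> dist (2 * (1 / real (Suc n))) 0" for n
        using Wk[of n] d(2)[of n] dist_triangle[of "y n" x "d n"] by (simp add: W_def)
      then show "\<forall>\<^sub>F n in sequentially. dist (y n) x \<le> dist (2 * (1 / real (Suc n))) 0" by simp
    qed
    then obtain C0 where C0: "\<And>k. norm (y k) \<le> C0"
      by (metis BseqE convergent_def convergent_imp_Bseq)
    obtain C1 where C1: "\<And>x. norm (Q x) \<le> norm x * C1" "0 < C1" using Q.pos_bounded by blast
    have s_bound: "norm (s k) \<le> C0 + C0 * C1" for k
    proof -
      have "norm (s k) \<le> norm (y k) + norm (y k - s k)"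
        by (metis norm_minus_commute norm_triangle_sub)
      also have "\<dots> \<le> norm (y k) + norm (Q (y k))" using Wk[of k] by (simp add: W_def)
      also have "\<dots> \<le> C0 + norm (y k) * C1" by (intro add_mono C0 C1)
      also have "\<dots> \<le> C0 + C0 * C1" using C1(2) C0[of k] by simp
      finally show ?thesis .
    qed
    obtain G \<Phi> where G: "G \<noteq> bot" "G \<le> sequentially" and \<Phi>: "\<Phi> \<in> bidual_space Z norm"
      and lim: "\<forall>\<phi>. ((\<lambda>k. ?J (s k) \<phi>) \<longlongrightarrow> \<Phi> \<phi>) G"
      using weak_star_cluster_point[where z = s, OF Zsub sZ s_bound] by (elim exE conjE) (rule that)
    \<comment> \<open>For \<open>k > i\<close> the point \<open>s k\<close> lies in
      \<open>K i\<close>. If \<open>\<Phi>\<close> were outside, the weak* open complement of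
      \<open>K i\<close> would contain these points eventually along \<open>G\<close>.\<close>
    have \<Phi>K: "\<Phi> \<in> K i" if i: "?J z \<in> K i" for i
    proof (rule ccontr)
      assume "\<Phi> \<notin> K i"
      have "topspace (weak_star_topology Z norm) = bidual_space Z norm"
      proof
        have "(\<lambda>_. 0) \<in> dual_space Z norm" by (rule dual_spaceI[where C = 0]) auto
        then show "bidual_space Z norm \<subseteq> topspace (weak_star_topology Z norm)"
          using openin_subset[OF weak_star_basic_open[of _ Z norm UNIV]] by auto
      qed (rule topspace_weak_star)
      then have "openin (weak_star_topology Z norm) (bidual_space Z norm - K i)"
        using Kcl[of i] by (simp add: closedin_def)
      then have "\<forall>\<^sub>F k in G. ?J (s k) \<in> bidual_space Z norm - K i"
        by (rule eventually_in_weak_star_open)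
          (use \<Phi> \<open>\<Phi> \<notin> K i\<close> lim canonical_embedding_in_bidual[OF Zsub sZ] in auto)
      moreover have "\<forall>\<^sub>F k in sequentially. ?J (s k) \<in> K i"
        using eventually_gt_at_top[of i]
        by eventually_elim (use Wk i in \<open>auto simp: W_def l_def\<close>)
      then have "\<forall>\<^sub>F k in G. ?J (s k) \<in> K i" using G(2) by (rule filter_leD[rotated])
      ultimately have "\<forall>\<^sub>F k in G. False" by eventually_elim simp
      then show False using G(1) by (simp add: trivial_limit_def)
    qed
    \<comment> \<open>No \<open>K i\<close> separates \<open>?J z\<close> from
      \<open>\<Phi>\<close>, so countable determination puts \<open>\<Phi>\<close> into the image of
      the kernel.\<close>
    then obtain z' where z': "z' \<in> Z" "\<Phi> = ?J z'" using KZ[OF z(1), of \<Phi>] \<Phi> by blast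
    have weak: "((\<lambda>k. \<phi> (s k)) \<longlongrightarrow> \<phi> z') G" if \<phi>: "linear \<phi>" "\<And>x. \<bar>\<phi> x\<bar> \<le> norm x" for \<phi>
      using lim[rule_format, of "\<lambda>x. if x \<in> Z then \<phi> x else 0"] restricted_functional_in_dual[OF Zsub \<phi>] sZ z'
      by (simp add: canonical_embedding_def)
    have "z' \<in> closure B"
    proof (rule ccontr)
      assume "z' \<notin> closure B"
      then obtain \<phi> where \<phi>: "linear \<phi>" "\<And>x. \<bar>\<phi> x\<bar> \<le> norm x" "\<And>s. s \<in> closure B \<Longrightarrow> \<phi> s = 0" "\<phi> z' \<noteq> 0"
        using separating_functional[OF Bsub closed_closure] by metis
      have "((\<lambda>k. \<phi> (s k)) \<longlongrightarrow> 0) G" using \<phi>(3)[OF sB] by simp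
      then show False using tendsto_unique[OF G(1) weak[OF \<phi>(1,2)]] \<phi>(4) by simp
    qed
    \<comment> \<open>Weak lower semicontinuity, tested on a functional norming
      \<open>x - z'\<close>: \<open>y k\<close> tends to \<open>x\<close> in norm,
      \<open>s k\<close> to \<open>z'\<close> only weakly along \<open>G\<close>.\<close>
    moreover have "norm (x - z') \<le> norm (Q x)"
    proof -
      obtain \<phi> where \<phi>: "linear \<phi>" "\<And>x. \<bar>\<phi> x\<bar> \<le> norm x" "\<phi> (x - z') = norm (x - z')"
        using norming_functional[of "x - z'"] by metis
      interpret \<phi>: bounded_linear \<phi>
        using \<phi>(1,2) by (intro bounded_linear_intro[of _ 1]) (auto simp: linear_add linear_scale)
      have y: "(y \<longlongrightarrow> x) G" using yx G(2) by (rule tendsto_mono[rotated])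
      have "((\<lambda>k. \<phi> (y k) - \<phi> (s k)) \<longlongrightarrow> \<phi> x - \<phi> z') G"
        by (intro tendsto_diff weak[OF \<phi>(1,2)] \<phi>.tendsto y)
      moreover have "((\<lambda>k. norm (Q (y k))) \<longlongrightarrow> norm (Q x)) G"
        by (intro tendsto_norm Q.tendsto y)
      moreover have "\<phi> (y k) - \<phi> (s k) \<le> norm (Q (y k))" for k
      proof -
        have "norm (y k - s k) \<le> norm (Q (y k))" using Wk[of k] by (simp add: W_def)
        then show ?thesis using \<phi>(2)[of "y k - s k"] by (simp add: \<phi>.diff)
      qed
      ultimately have "\<phi> x - \<phi> z' \<le> norm (Q x)" by (intro tendsto_le[OF G(1)]) auto
      then show ?thesis using \<phi>(3) by (simp add: \<phi>.diff)
    qed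
    ultimately show ?thesis by blast
  qed
  then show ?thesis using B unfolding Z_def by blast
qed

section \<open>Strongly measurable functions\<close>

lemma borel_measurable_countably_valued:
  assumes "N \<in> measurable M (count_space (UNIV :: nat set))"
  shows "(\<lambda>t. c (N t)) \<in> borel_measurable M"
  by (rule measurable_compose[OF assms]) simp

text \<open>The target spaces need not be separable, so a separable range is demanded; sums of
  merely Borel measurable functions may fail to be Borel measurable.\<close>

definition strongly_measurable :: "'w measure \<Rightarrow> ('w \<Rightarrow> 'a::metric_space) \<Rightarrow> bool"
  where "strongly_measurable M f \<longleftrightarrow>
    f \<in> borel_measurable M \<and> (\<exists>D. countable D \<and> f ` space M \<subseteq> closure D)"

lemma strongly_measurable_borel: "strongly_measurable M f \<Longrightarrow> f \<in> borel_measurable M"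
  by (simp add: strongly_measurable_def)

lemma strongly_measurable_countably_valued:
  assumes "N \<in> measurable M (count_space (UNIV :: nat set))"
  shows "strongly_measurable M (\<lambda>t. c (N t))"
  unfolding strongly_measurable_def
proof (intro conjI exI[of _ "range c"] borel_measurable_countably_valued[OF assms])
  show "(\<lambda>t. c (N t)) ` space M \<subseteq> closure (range c)" using closure_subset[of "range c"] by blast
qed simp

lemma strongly_measurable_const: "strongly_measurable M (\<lambda>_. c)"
  by (rule strongly_measurable_countably_valued[where N = "\<lambda>_. 0"]) (rule measurable_const, simp)

lemma strongly_measurable_LIMSEQ:
  fixes f :: "nat \<Rightarrow> 'w \<Rightarrow> 'a::metric_space"
  assumes f: "\<And>n. strongly_measurable M (f n)"
    and lim: "\<And>t. t \<in> space M \<Longrightarrow> (\<lambda>n. f n t) \<longlonglongrightarrow> g t"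
  shows "strongly_measurable M g"
proof -
  obtain D where D: "\<And>n. countable (D n)" "\<And>n. f n ` space M \<subseteq> closure (D n)"
    using f unfolding strongly_measurable_def by metis
  have "g t \<in> closure (\<Union>n. D n)" if "t \<in> space M" for t
  proof (rule Lim_in_closed_set[OF closed_closure _ _ lim[OF that]])
    have "f n t \<in> closure (\<Union>n. D n)" for n
      using D(2)[of n] that closure_mono[of "D n" "\<Union>n. D n"] by blast
    then show "\<forall>\<^sub>F n in sequentially. f n t \<in> closure (\<Union>n. D n)" by simp
  qed simp
  moreover have "g \<in> borel_measurable M"
    by (rule borel_measurable_LIMSEQ_metric[OF strongly_measurable_borel[OF f] lim])
  ultimately show ?thesis
    unfolding strongly_measurable_def using D(1) by (intro conjI exI[of _ "\<Union>n. D n"]) auto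
qed

lemma strongly_measurable_approx:
  fixes f :: "'w \<Rightarrow> 'a::metric_space"
  assumes f: "strongly_measurable M f" and e: "0 < e"
  obtains N c where "N \<in> measurable M (count_space (UNIV :: nat set))"
    "\<forall>t\<in>space M. dist (f t) (c (N t)) < e"
proof -
  obtain D where D: "countable D" "f ` space M \<subseteq> closure D" and [measurable]: "f \<in> borel_measurable M"
    using f unfolding strongly_measurable_def by blast
  \<comment> \<open>\<open>D\<close> can be empty when \<open>space M\<close> is; the extra point
    keeps the enumeration meaningful.\<close>
  define c where "c = from_nat_into (insert undefined D)"
  define N where "N t = (LEAST n. dist (f t) (c n) < e)" for t
  have "N \<in> measurable M (count_space UNIV)"
  proof -
    have "(\<lambda>t. dist (f t) x) \<in> borel_measurable M" for x
      by (rule measurable_compose[OF \<open>f \<in> borel_measurable M\<close>])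
        (intro borel_measurable_continuous_onI continuous_intros)
    note [measurable] = this
    show ?thesis unfolding N_def by measurable
  qed
  moreover have "dist (f t) (c (N t)) < e" if "t \<in> space M" for t
  proof -
    have "f t \<in> closure D" using D(2) that by blast
    then obtain d where "d \<in> D" "dist (f t) d < e"
      using e unfolding closure_approachable by (auto simp: dist_commute)
    moreover obtain n where "c n = d"
      using \<open>d \<in> D\<close> D(1) from_nat_into_surj[of "insert undefined D" d] unfolding c_def by auto
    ultimately show ?thesis unfolding N_def by (metis (mono_tags, lifting) LeastI)
  qed
  ultimately show thesis using that by blast
qed

lemma strongly_measurable_approx_seq:
  fixes f :: "'w \<Rightarrow> 'a::metric_space"
  assumes f: "strongly_measurable M f" and e: "\<And>n. 0 < e n"
  shows "\<exists>N c. (\<forall>n. N n \<in> measurable M (count_space (UNIV :: nat set))) \<and>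
    (\<forall>n. \<forall>t\<in>space M. dist (f t) (c n (N n t)) < e n)"
proof -
  let ?P = "\<lambda>n N c. N \<in> measurable M (count_space (UNIV :: nat set)) \<and> (\<forall>t\<in>space M. dist (f t) (c (N t)) < e n)"
  have "\<exists>N c. ?P n N c" for n
    by (rule strongly_measurable_approx[OF f e[of n]], intro exI conjI)
  then have "\<forall>n. \<exists>N c. ?P n N c" ..
  from choice[OF this] obtain N where "\<forall>n. \<exists>c. ?P n (N n) c" ..
  from choice[OF this] obtain c where "\<forall>n. ?P n (N n) (c n)" ..
  then show ?thesis by (intro exI[of _ N] exI[of _ c]) simp
qed

lemma tendsto_dist_bound:
  fixes s :: "nat \<Rightarrow> 'a::metric_space"
  assumes "\<And>n. dist l (s n) < e n" "e \<longlonglongrightarrow> 0"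
  shows "s \<longlonglongrightarrow> l"
proof (rule metric_tendsto_imp_tendsto[OF assms(2)])
  have "dist (s n) l \<le> dist (e n) 0" for n
    using assms(1)[of n] by (simp add: dist_commute)
  then show "\<forall>\<^sub>F n in sequentially. dist (s n) l \<le> dist (e n) 0" by simp
qed

lemma LIMSEQ_dist_power_half:
  fixes a :: "nat \<Rightarrow> 'a::metric_space"
  assumes "\<And>k. dist (a k) v \<le> (1 / 2) ^ k"
  shows "a \<longlonglongrightarrow> v"
proof (rule metric_tendsto_imp_tendsto)
  show "(\<lambda>k. (1 / 2 :: real) ^ k) \<longlonglongrightarrow> 0" by (rule LIMSEQ_power_zero) simp
  have "dist (a k) v \<le> dist ((1 / 2 :: real) ^ k) 0" for k using assms[of k] by simp
  then show "\<forall>\<^sub>F k in sequentially. dist (a k) v \<le> dist ((1 / 2 :: real) ^ k) 0" by simp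
qed

text \<open>A pair of countably valued approximations is again countably valued, with one natural
  number encoding both indices. This replaces any measurability with respect to a product, and
  continuity of \<open>h\<close> gives the limit.\<close>

lemma strongly_measurable_continuous2:
  fixes f :: "'w \<Rightarrow> 'a::metric_space" and g :: "'w \<Rightarrow> 'b::metric_space"
    and h :: "'a \<Rightarrow> 'b \<Rightarrow> 'c::metric_space"
  assumes f: "strongly_measurable M f" and g: "strongly_measurable M g"
    and h: "continuous_on UNIV (\<lambda>(x, y). h x y)"
  shows "strongly_measurable M (\<lambda>t. h (f t) (g t))"
proof -
  have pos: "0 < 1 / real (Suc n)" for n by simp
  obtain N c where N: "\<forall>n. N n \<in> measurable M (count_space (UNIV :: nat set))"
    "\<forall>n. \<forall>t\<in>space M. dist (f t) (c n (N n t)) < 1 / real (Suc n)"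
    using strongly_measurable_approx_seq[where e = "\<lambda>n. 1 / real (Suc n)", OF f pos] by (elim exE conjE) (rule that)
  obtain K d where K: "\<forall>n. K n \<in> measurable M (count_space (UNIV :: nat set))"
    "\<forall>n. \<forall>t\<in>space M. dist (g t) (d n (K n t)) < 1 / real (Suc n)"
    using strongly_measurable_approx_seq[where e = "\<lambda>n. 1 / real (Suc n)", OF g pos] by (elim exE conjE) (rule that)
  show ?thesis
  proof (rule strongly_measurable_LIMSEQ)
    fix n
    have "(\<lambda>t. prod_encode (N n t, K n t)) \<in> measurable M (count_space UNIV)"
      using N(1)[rule_format, of n] K(1)[rule_format, of n] by measurable
    from strongly_measurable_countably_valued[OF this,
        of "\<lambda>j. h (c n (fst (prod_decode j))) (d n (snd (prod_decode j)))"]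
    show "strongly_measurable M (\<lambda>t. h (c n (N n t)) (d n (K n t)))" by simp
  next
    fix t assume t: "t \<in> space M"
    have "(\<lambda>n. (c n (N n t), d n (K n t))) \<longlonglongrightarrow> (f t, g t)"
      by (intro tendsto_Pair tendsto_dist_bound[OF N(2)[rule_format, OF t]]
        tendsto_dist_bound[OF K(2)[rule_format, OF t]]
        LIMSEQ_Suc[OF lim_1_over_n])
    from continuous_on_tendsto_compose[OF h this]
    show "(\<lambda>n. h (c n (N n t)) (d n (K n t))) \<longlonglongrightarrow> h (f t) (g t)" by simp
  qed
qed

lemma strongly_measurable_compose_countable:
  fixes f :: "nat \<Rightarrow> 'w \<Rightarrow> 'a::metric_space"
  assumes f: "\<And>i. strongly_measurable M (f i)" and N: "N \<in> measurable M (count_space UNIV)"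
  shows "strongly_measurable M (\<lambda>t. f (N t) t)"
proof -
  have "\<forall>i. \<exists>D. countable D \<and> f i ` space M \<subseteq> closure D"
    using f unfolding strongly_measurable_def by blast
  from choice[OF this] obtain D where D: "\<forall>i. countable (D i) \<and> f i ` space M \<subseteq> closure (D i)" ..
  have "(\<lambda>t. f (N t) t) \<in> borel_measurable M"
    by (rule measurable_compose_countable[OF strongly_measurable_borel[OF f] N])
  moreover have "(\<lambda>t. f (N t) t) ` space M \<subseteq> closure (\<Union>i. D i)"
  proof (rule image_subsetI)
    fix t assume "t \<in> space M"
    then have "f (N t) t \<in> closure (D (N t))" using D by blast
    then show "f (N t) t \<in> closure (\<Union>i. D i)" using closure_mono[of "D (N t)" "\<Union>i. D i"] by blast
  qed
  moreover have "countable (\<Union>i. D i)" using D by simp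
  ultimately show ?thesis unfolding strongly_measurable_def by blast
qed

lemma strongly_measurable_If:
  fixes f g :: "'w \<Rightarrow> 'a::metric_space"
  assumes "strongly_measurable M f" "strongly_measurable M g" "{t \<in> space M. P t} \<in> sets M"
  shows "strongly_measurable M (\<lambda>t. if P t then f t else g t)"
proof -
  have "strongly_measurable M (\<lambda>t. (\<lambda>n. if n = 0 then f else g) (if P t then 0 else Suc 0) t)"
  proof (rule strongly_measurable_compose_countable[where N = "\<lambda>t. if P t then 0 else Suc 0"])
    show "(\<lambda>t. if P t then 0 else Suc 0) \<in> measurable M (count_space UNIV)"
      by (rule measurable_If[OF _ _ assms(3)]) simp_all
  qed (use assms in simp)
  then show ?thesis by (rule back_subst[of "strongly_measurable M"]) auto
qed

lemma strongly_measurable_real: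
  fixes f :: "'w \<Rightarrow> real"
  assumes "f \<in> borel_measurable M"
  shows "strongly_measurable M f"
proof -
  obtain D :: "real set" where "countable D" "UNIV \<subseteq> closure D"
    by (rule separable[of UNIV])
  then show ?thesis unfolding strongly_measurable_def using assms by blast
qed

lemma strongly_measurable_add:
  fixes f g :: "'w \<Rightarrow> 'a::real_normed_vector"
  assumes "strongly_measurable M f" "strongly_measurable M g"
  shows "strongly_measurable M (\<lambda>t. f t + g t)"
  by (rule strongly_measurable_continuous2[where h = "(+)", OF assms])
    (unfold case_prod_unfold, intro continuous_on_add continuous_on_fst continuous_on_snd continuous_on_id)

lemma strongly_measurable_diff:
  fixes f g :: "'w \<Rightarrow> 'a::real_normed_vector"
  assumes "strongly_measurable M f" "strongly_measurable M g"
  shows "strongly_measurable M (\<lambda>t. f t - g t)"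
  by (rule strongly_measurable_continuous2[where h = "(-)", OF assms])
    (unfold case_prod_unfold, intro continuous_on_diff continuous_on_fst continuous_on_snd continuous_on_id)

lemma strongly_measurable_scaleR:
  fixes f :: "'w \<Rightarrow> 'a::real_normed_vector"
  assumes "r \<in> borel_measurable M" "strongly_measurable M f"
  shows "strongly_measurable M (\<lambda>t. r t *\<^sub>R f t)"
  by (rule strongly_measurable_continuous2[where h = "(*\<^sub>R)", OF strongly_measurable_real[OF assms(1)] assms(2)])
    (unfold case_prod_unfold, intro continuous_on_scaleR continuous_on_fst continuous_on_snd continuous_on_id)

lemma strongly_measurable_sum:
  fixes f :: "'i \<Rightarrow> 'w \<Rightarrow> 'a::real_normed_vector"
  assumes "\<And>i. i \<in> I \<Longrightarrow> strongly_measurable M (f i)"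
  shows "strongly_measurable M (\<lambda>t. \<Sum>i\<in>I. f i t)"
  using assms
proof (induction I rule: infinite_finite_induct)
  case (insert i I)
  then have "strongly_measurable M (\<lambda>t. f i t + (\<Sum>i\<in>I. f i t))"
    by (intro strongly_measurable_add) simp_all
  then show ?case using insert.hyps by simp
qed (simp_all add: strongly_measurable_const)

lemma borel_measurable_norm_strongly:
  fixes f :: "'w \<Rightarrow> 'a::real_normed_vector"
  assumes "strongly_measurable M f"
  shows "(\<lambda>t. norm (f t)) \<in> borel_measurable M"
  by (rule measurable_compose[OF strongly_measurable_borel[OF assms]])
    (rule borel_measurable_continuous_onI[OF continuous_on_norm[OF continuous_on_id]])

text \<open>A telescoping series of countably valued functions is lifted term by term.\<close>

lemma strongly_measurable_lift:
  fixes Q :: "'x::banach \<Rightarrow> 'y::real_normed_vector"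
  assumes Q: "bounded_linear Q" and lift: "\<And>y. \<exists>x. Q x = y \<and> norm x \<le> norm y"
    and g: "strongly_measurable M g"
  shows "\<exists>h. strongly_measurable M h \<and> (\<forall>t\<in>space M. Q (h t) = g t)"
proof -
  interpret Q: bounded_linear Q by (rule Q)
  \<comment> \<open>\<open>L\<close> is an arbitrary right inverse, in general neither linear nor
    continuous; measurability survives because it is applied only to countably valued
    functions.\<close>
  define L where "L y = (SOME x. Q x = y \<and> norm x \<le> norm y)" for y
  have L: "Q (L y) = y" "norm (L y) \<le> norm y" for y
    using someI_ex[OF lift[of y]] by (auto simp: L_def)
  have pos: "0 < (1 / 2 :: real) ^ n" for n by simp
  obtain N c where N': "\<forall>n. N n \<in> measurable M (count_space (UNIV :: nat set))"
    and c': "\<forall>n. \<forall>t\<in>space M. dist (g t) (c n (N n t)) < (1 / 2) ^ n"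
    using strongly_measurable_approx_seq[where e = "\<lambda>n. (1 / 2) ^ n", OF g pos] by (elim exE conjE) (rule that)
  note N = N'[rule_format] and c = c'[rule_format]
  define d where "d n t = (case n of 0 \<Rightarrow> c 0 (N 0 t) | Suc m \<Rightarrow> c (Suc m) (N (Suc m) t) - c m (N m t))" for n t
  have partial: "(\<Sum>i<Suc n. d i t) = c n (N n t)" for n t
    by (induction n) (simp_all add: d_def)
  have Ld: "strongly_measurable M (\<lambda>t. L (d n t))" for n
  proof (cases n)
    case 0
    then show ?thesis using strongly_measurable_countably_valued[OF N, of "\<lambda>j. L (c 0 j)" 0] by (simp add: d_def)
  next
    case (Suc m)
    have "(\<lambda>t. prod_encode (N (Suc m) t, N m t)) \<in> measurable M (count_space UNIV)"
      using N[of m] N[of "Suc m"] by measurable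
    from strongly_measurable_countably_valued[OF this,
        of "\<lambda>j. L (c (Suc m) (fst (prod_decode j)) - c m (snd (prod_decode j)))"]
    show ?thesis by (simp add: d_def Suc)
  qed
  have summ: "summable (\<lambda>n. L (d n t))" if t: "t \<in> space M" for t
  proof (rule summable_comparison_test')
    \<comment> \<open>Two successive errors give
      \<open>(1/2) ^ Suc m + (1/2) ^ m = 3 * (1/2) ^ Suc m\<close>. The term with index 0 is no
      increment, so the comparison starts at 1.\<close>
    show "summable (\<lambda>n. 3 * (1 / 2 :: real) ^ n)" by (intro summable_mult summable_geometric) simp
    fix n :: nat assume n: "n \<ge> 1"
    then obtain m where m: "n = Suc m" by (cases n) auto
    have "norm (L (d n t)) \<le> norm (d n t)" by (rule L)
    also have "\<dots> = dist (c (Suc m) (N (Suc m) t)) (c m (N m t))" by (simp add: d_def m dist_norm)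
    also have "\<dots> \<le> dist (g t) (c (Suc m) (N (Suc m) t)) + dist (g t) (c m (N m t))"
      by (metis dist_commute dist_triangle2 add.commute)
    also have "\<dots> \<le> (1 / 2) ^ Suc m + (1 / 2) ^ m" using c[OF t] by (intro add_mono less_imp_le)
    also have "\<dots> = 3 * (1 / 2) ^ n" by (simp add: m)
    finally show "norm (L (d n t)) \<le> 3 * (1 / 2) ^ n" .
  qed
  define h where "h t = (\<Sum>n. L (d n t))" for t
  have lim: "(\<lambda>n. \<Sum>i<n. L (d i t)) \<longlonglongrightarrow> h t" if "t \<in> space M" for t
    unfolding h_def by (rule summable_LIMSEQ[OF summ[OF that]])
  have "strongly_measurable M h"
    by (rule strongly_measurable_LIMSEQ[OF strongly_measurable_sum[OF Ld] lim])
  moreover have "Q (h t) = g t" if t: "t \<in> space M" for t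
  proof (rule LIMSEQ_unique)
    have "(\<lambda>n. Q (\<Sum>i<Suc n. L (d i t))) \<longlonglongrightarrow> Q (h t)"
      by (intro Q.tendsto LIMSEQ_Suc lim t)
    then show "(\<lambda>n. c n (N n t)) \<longlonglongrightarrow> Q (h t)"
      unfolding Q.sum L partial .
    show "(\<lambda>n. c n (N n t)) \<longlonglongrightarrow> g t"
      by (rule tendsto_dist_bound[OF c[OF t]]) (simp add: LIMSEQ_power_zero)
  qed
  ultimately show ?thesis by blast
qed

section \<open>Measurable selections almost everywhere\<close>

text \<open>Witnesses over a convergent sequence of points have a convergent subsequence in
  \<open>C\<close>, and its limit is a witness for the limit point.\<close>

lemma closed_compact_section:
  fixes R :: "('a::metric_space \<times> 'b::metric_space) set"
  assumes R: "closed R" and C: "compact C"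
  shows "closed {x. \<exists>z\<in>C. (x, z) \<in> R}"
  unfolding closed_sequential_limits
proof (intro allI impI, elim conjE)
  fix x l assume x: "\<forall>n. x n \<in> {x. \<exists>z\<in>C. (x, z) \<in> R}" and lim: "x \<longlonglongrightarrow> l"
  from x have "\<forall>n. \<exists>z. z \<in> C \<and> (x n, z) \<in> R" by blast
  from choice[OF this] obtain z where z: "\<forall>n. z n \<in> C \<and> (x n, z n) \<in> R" ..
  then have "\<forall>n. z n \<in> C" by blast
  from seq_compactE[OF C[unfolded compact_eq_seq_compact_metric] this]
  obtain w r where w: "w \<in> C" "strict_mono r" "(z \<circ> r) \<longlonglongrightarrow> w" .
  have "(l, w) \<in> R"
  proof (rule Lim_in_closed_set[OF R])
    show "((\<lambda>n. (x (r n), z (r n))) \<longlongrightarrow> (l, w)) sequentially"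
      using tendsto_Pair[OF LIMSEQ_subseq_LIMSEQ[OF lim w(2)] w(3)] by (simp add: comp_def)
  qed (use z in simp_all)
  then show "l \<in> {x. \<exists>z\<in>C. (x, z) \<in> R}" using w(1) by blast
qed

lemma sets_compact_section:
  fixes R :: "('a::metric_space \<times> 'b::metric_space) set"
  assumes h: "h \<in> borel_measurable M" and R: "closed R" and C: "compact C"
  shows "{t \<in> space M. \<exists>z\<in>C. (h t, z) \<in> R} \<in> sets M"
proof -
  have "h -` {x. \<exists>z\<in>C. (x, z) \<in> R} \<inter> space M \<in> sets M"
    by (rule measurable_sets[OF h borel_closed[OF closed_compact_section[OF R C]]])
  moreover have "h -` {x. \<exists>z\<in>C. (x, z) \<in> R} \<inter> space M = {t \<in> space M. \<exists>z\<in>C. (h t, z) \<in> R}" by blast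
  ultimately show ?thesis by simp
qed

text \<open>
  The list \<open>J k t\<close> records, greedily, indices of balls of radius \<open>(1/2)^i\<close> whose intersection
  still meets the section of \<open>R\<close> at \<open>h t\<close>; the centres converge to the selected point.
\<close>

lemma compact_selection:
  fixes R :: "('a::metric_space \<times> 'b::metric_space) set"
  assumes h: "h \<in> borel_measurable M" and R: "closed R" and L: "compact L"
    and D: "countable D" "L \<subseteq> closure D"
  shows "\<exists>z. strongly_measurable M z \<and> (\<forall>t\<in>space M. (\<exists>w\<in>L. (h t, w) \<in> R) \<longrightarrow> (h t, z t) \<in> R)"
proof -
  define c where "c = from_nat_into D"
  define F where "F s = (\<Inter>i<length s. cball (c (s ! i)) ((1 / 2) ^ i))" for s :: "nat list"
  define hit where "hit s t \<longleftrightarrow> (\<exists>w\<in>L \<inter> F s. (h t, w) \<in> R)" for s t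
  have hit_meas: "{t \<in> space M. hit s t} \<in> sets M" for s
  proof -
    have "closed (F s)" unfolding F_def by (intro closed_INT) simp
    then show ?thesis unfolding hit_def by (intro sets_compact_section[OF h R] compact_Int_closed L)
  qed
  define J where "J k t = rec_nat [] (\<lambda>_ s. s @ [LEAST j. hit (s @ [j]) t]) k" for k :: nat and t
  have J0: "J 0 t = []" and JS: "J (Suc k) t = J k t @ [LEAST j. hit (J k t @ [j]) t]" for k t
    by (simp_all add: J_def)
  have len: "length (J k t) = k" for k t by (induction k) (simp_all add: J0 JS)
  \<comment> \<open>Entries are only appended, so the centre at position \<open>i\<close> is the
    same in all later lists.\<close>
  have prefix: "J m t ! i = J (Suc i) t ! i" if "i < m" for i m t
    using that
  proof (induction m)
    case (Suc m)
    then show ?case by (cases "i = m") (simp_all add: JS[of m] nth_append len)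
  qed simp
  have J_meas: "J k \<in> measurable M (count_space UNIV)" for k
  proof (induction k)
    case 0
    have "(\<lambda>t. []) \<in> measurable M (count_space UNIV)" by simp
    then show ?case by (rule back_subst[of "\<lambda>f. f \<in> measurable M (count_space UNIV)"]) (simp add: J0 fun_eq_iff)
  next
    case (Suc k)
    \<comment> \<open>Only countably many prefixes exist, so it suffices to prove measurability with
      the prefix held fixed.\<close>
    have "(\<lambda>t. s @ [LEAST j. hit (s @ [j]) t]) \<in> measurable M (count_space UNIV)" for s
    proof (rule measurable_compose[of _ M "count_space UNIV" "\<lambda>j. s @ [j]"])
      show "(\<lambda>t. LEAST j. hit (s @ [j]) t) \<in> measurable M (count_space UNIV)"
        by (rule measurable_Least) (simp add: pred_def hit_meas)
    qed simp
    from measurable_compose_countable[of "\<lambda>s t. s @ [LEAST j. hit (s @ [j]) t]", OF this Suc]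
    show ?case by (simp add: JS[abs_def])
  qed
  let ?G = "{t \<in> space M. \<exists>w\<in>L. (h t, w) \<in> R}"
  have G: "?G \<in> sets M" by (rule sets_compact_section[OF h R L])
  have hit: "hit (J k t) t" if t: "t \<in> ?G" for k t
  proof (induction k)
    case 0
    then show ?case using t by (simp add: hit_def J0 F_def)
  next
    case (Suc k)
    then obtain w where w: "w \<in> L" "w \<in> F (J k t)" "(h t, w) \<in> R" unfolding hit_def by blast
    have "w \<in> closure D" using w(1) D(2) by blast
    then obtain d where d: "d \<in> D" "dist d w < (1 / 2) ^ k"
      unfolding closure_approachable by (metis half_gt_zero_iff zero_less_one zero_less_power)
    obtain j where j: "c j = d" using from_nat_into_surj[OF D(1) d(1)] unfolding c_def by blast
    have "w \<in> F (J k t @ [j])"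
      using w(2) d(2) j unfolding F_def by (auto simp: nth_append len less_Suc_eq)
    then have "hit (J k t @ [j]) t" using w unfolding hit_def by blast
    then show ?case unfolding JS by (rule LeastI)
  qed
  \<comment> \<open>Off \<open>?G\<close> a fixed index makes the sequence constant, so that the
    limit exists at every point.\<close>
  define a where "a k t = c (if t \<in> ?G then J (Suc k) t ! k else 0)" for k t
  have a_meas: "strongly_measurable M (a k)" for k
    unfolding a_def
  proof (rule strongly_measurable_countably_valued, rule measurable_If)
    show "(\<lambda>t. J (Suc k) t ! k) \<in> measurable M (count_space UNIV)"
      by (rule measurable_compose[OF J_meas]) simp
    show "{t \<in> space M. t \<in> ?G} \<in> sets M" using G by simp
  qed simp
  have lim: "\<exists>w. (\<lambda>k. a k t) \<longlonglongrightarrow> w \<and> (t \<in> ?G \<longrightarrow> (h t, w) \<in> R)" for t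
  proof (cases "t \<in> ?G")
    case True
    have "\<forall>k. \<exists>w. w \<in> L \<inter> F (J k t) \<and> (h t, w) \<in> R" using hit[OF True] unfolding hit_def by blast
    from choice[OF this] obtain w where w: "\<forall>k. w k \<in> L \<inter> F (J k t) \<and> (h t, w k) \<in> R" ..
    then have "\<forall>k. w k \<in> L" by blast
    from seq_compactE[OF L[unfolded compact_eq_seq_compact_metric] this]
    obtain v r where v: "v \<in> L" "strict_mono r" "(w \<circ> r) \<longlonglongrightarrow> v" .
    have "(h t, v) \<in> R"
    proof (rule Lim_in_closed_set[OF R])
      show "((\<lambda>n. (h t, w (r n))) \<longlongrightarrow> (h t, v)) sequentially"
        using tendsto_Pair[OF tendsto_const v(3)] by (simp add: comp_def)
    qed (use w in simp_all)
    \<comment> \<open>\<open>w (r n)\<close> lies in the ball chosen at every position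
      \<open>k < r n\<close>, so the centre \<open>a k t\<close> stays within
      \<open>(1/2) ^ k\<close> of the limit \<open>v\<close>.\<close>
    moreover have "dist (a k t) v \<le> (1 / 2) ^ k" for k
    proof (rule tendsto_upperbound)
      show "((\<lambda>n. dist (a k t) (w (r n))) \<longlongrightarrow> dist (a k t) v) sequentially"
        using v(3) by (intro tendsto_intros) (simp add: comp_def)
      have "dist (a k t) (w (r n)) \<le> (1 / 2) ^ k" if "Suc k \<le> n" for n
      proof -
        have k: "k < r n" using seq_suble[OF v(2), of n] that by simp
        have "w (r n) \<in> F (J (r n) t)" using w by blast
        then have "w (r n) \<in> cball (c (J (r n) t ! k)) ((1 / 2) ^ k)" using k unfolding F_def by (simp add: len)
        then show ?thesis using True prefix[OF k, of t] by (simp add: a_def)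
      qed
      then show "\<forall>\<^sub>F n in sequentially. dist (a k t) (w (r n)) \<le> (1 / 2) ^ k"
        by (rule eventually_sequentiallyI)
    qed simp
    then have "(\<lambda>k. a k t) \<longlonglongrightarrow> v"
      by (rule LIMSEQ_dist_power_half)
    ultimately show ?thesis by blast
  next
    case False
    then have "a k t = c 0" for k by (simp only: a_def if_False)
    then have "(\<lambda>k. a k t) \<longlonglongrightarrow> c 0" by simp
    then show ?thesis using False by blast
  qed
  then have "\<forall>t. \<exists>w. (\<lambda>k. a k t) \<longlonglongrightarrow> w \<and> (t \<in> ?G \<longrightarrow> (h t, w) \<in> R)" ..
  from choice[OF this] obtain z where z: "\<forall>t. (\<lambda>k. a k t) \<longlonglongrightarrow> z t \<and> (t \<in> ?G \<longrightarrow> (h t, z t) \<in> R)" ..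
  have "strongly_measurable M z"
    by (rule strongly_measurable_LIMSEQ[of M a, OF a_meas]) (use z in blast)
  then show ?thesis using z by blast
qed

text \<open>Finite unions of closed balls are closed, so they cover the closure as well; halving the
  radius makes room for open balls.\<close>

lemma compact_closure_finite_nets:
  fixes S :: "'b::complete_space set"
  assumes "\<And>e. 0 < e \<Longrightarrow> \<exists>F. finite F \<and> S \<subseteq> (\<Union>x\<in>F. cball x e)"
  shows "compact (closure S)"
  unfolding compact_eq_totally_bounded
proof (intro conjI allI impI)
  show "complete (closure S)" by (simp add: complete_eq_closed)
  fix e :: real assume e: "0 < e"
  then obtain F where F: "finite F" "S \<subseteq> (\<Union>x\<in>F. cball x (e / 2))" using assms[of "e / 2"] by auto
  have "closure S \<subseteq> (\<Union>x\<in>F. cball x (e / 2))"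
    using F by (intro closure_minimal closed_UN) auto
  also have "\<dots> \<subseteq> (\<Union>x\<in>F. ball x e)" using e by fastforce
  finally show "\<exists>F. finite F \<and> closure S \<subseteq> (\<Union>x\<in>F. ball x e)" using F(1) by blast
qed

text \<open>
  The sets \<open>E L\<close> need not be measurable, but outer measure is continuous along increasing
  sequences of arbitrary sets, so balls can be discarded without losing more than allowed.
\<close>

lemma compact_section_inner_regular:
  fixes R :: "('a::metric_space \<times> 'b::complete_space) set"
  assumes M: "finite_measure M" and h: "h \<in> borel_measurable M" and R: "closed R"
    and D: "countable D" and sec: "\<And>t. t \<in> space M \<Longrightarrow> \<exists>w\<in>closure D. (h t, w) \<in> R"
    and r: "r < emeasure M (space M)"
  shows "\<exists>L. compact L \<and> L \<subseteq> closure D \<and> r \<le> emeasure M {t \<in> space M. \<exists>w\<in>L. (h t, w) \<in> R}"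
proof -
  interpret finite_measure M by (rule M)
  define E where "E L = {t \<in> space M. \<exists>w\<in>L. (h t, w) \<in> R}" for L
  define c where "c = from_nat_into D"
  define U where "U k n = (\<Union>j\<le>n. cball (c j) ((1 / 2) ^ k))" for k n :: nat
  have U_closed: "closed (U k n)" for k n unfolding U_def by (intro closed_UN) auto
  \<comment> \<open>The inequality is strict so that a finite stage of an increasing supremum
    already exceeds \<open>r\<close>.\<close>
  define P where "P L \<longleftrightarrow> closed L \<and> L \<subseteq> closure D \<and> r < outer_measure_of M (E L)" for L
  have step: "\<exists>n. P (L \<inter> U k n)" if L: "P L" for L k
  proof -
    have "E L = (\<Union>n. E (L \<inter> U k n))"
    proof
      show "E L \<subseteq> (\<Union>n. E (L \<inter> U k n))"
      proof
        fix t assume "t \<in> E L"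
        then obtain w where w: "t \<in> space M" "w \<in> L" "(h t, w) \<in> R" unfolding E_def by blast
        then have "w \<in> closure D" using L unfolding P_def by blast
        then obtain d where d: "d \<in> D" "dist d w < (1 / 2) ^ k"
          unfolding closure_approachable by (metis half_gt_zero_iff zero_less_one zero_less_power)
        obtain j where "c j = d" using from_nat_into_surj[OF D d(1)] unfolding c_def by blast
        then have "w \<in> U k j" using d(2) unfolding U_def by (intro UN_I[of j]) simp_all
        then show "t \<in> (\<Union>n. E (L \<inter> U k n))" using w unfolding E_def by blast
      qed
    qed (auto simp: E_def)
    moreover have "incseq (\<lambda>n. E (L \<inter> U k n))"
    proof (rule incseq_SucI)
      fix n
      have "U k n \<subseteq> U k (Suc n)" unfolding U_def by (intro UN_mono) auto
      then show "E (L \<inter> U k n) \<subseteq> E (L \<inter> U k (Suc n))" unfolding E_def by blast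
    qed
    then have "(SUP n. outer_measure_of M (E (L \<inter> U k n))) = outer_measure_of M (\<Union>n. E (L \<inter> U k n))"
      by (intro SUP_outer_measure_of_incseq) (auto simp: E_def)
    ultimately have "r < (SUP n. outer_measure_of M (E (L \<inter> U k n)))" using L by (simp add: P_def)
    then obtain n where "r < outer_measure_of M (E (L \<inter> U k n))" by (auto simp: less_SUP_iff)
    then show ?thesis using L U_closed[of k n] unfolding P_def by (intro exI[of _ n]) auto
  qed
  \<comment> \<open>Each \<open>Ls (Suc k)\<close> has a finite net of radius
    \<open>(1/2) ^ k\<close>, which makes the intersection totally bounded.\<close>
  have "\<exists>Ls. \<forall>k. P (Ls k) \<and> (\<exists>n. Ls (Suc k) = Ls k \<inter> U k n)"
  proof (rule dependent_nat_choice)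
    have "E (closure D) = space M" using sec unfolding E_def by blast
    then show "\<exists>L. P L" using r unfolding P_def by (intro exI[of _ "closure D"]) simp
  qed (use step in blast)
  then obtain Ls where Ls: "\<forall>k. P (Ls k) \<and> (\<exists>n. Ls (Suc k) = Ls k \<inter> U k n)" ..
  have Ls_mono: "Ls m \<subseteq> Ls k" if "k \<le> m" for k m
    using that by (induction rule: dec_induct) (use Ls in blast)+
  have net: "\<exists>F. finite F \<and> Ls (Suc k) \<subseteq> (\<Union>x\<in>F. cball x ((1 / 2) ^ k))" for k
  proof -
    obtain n where "Ls (Suc k) = Ls k \<inter> U k n" using Ls by blast
    then show ?thesis unfolding U_def by (intro exI[of _ "c ` {..n}"]) auto
  qed
  define L where "L = (\<Inter>k. Ls k)"
  have L_closed: "closed L" unfolding L_def using Ls by (intro closed_INT) (auto simp: P_def)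
  have "compact (closure L)"
  proof (rule compact_closure_finite_nets)
    fix e :: real assume "0 < e"
    then obtain k where k: "(1 / 2) ^ k < e" using real_arch_pow_inv[of e "1 / 2"] by auto
    obtain F where F: "finite F" "Ls (Suc k) \<subseteq> (\<Union>x\<in>F. cball x ((1 / 2) ^ k))" using net by blast
    have "L \<subseteq> Ls (Suc k)" by (auto simp: L_def)
    also have "\<dots> \<subseteq> (\<Union>x\<in>F. cball x ((1 / 2) ^ k))" by (rule F)
    also have "\<dots> \<subseteq> (\<Union>x\<in>F. cball x e)" using k by (intro UN_mono subset_cball) auto
    finally show "\<exists>F. finite F \<and> L \<subseteq> (\<Union>x\<in>F. cball x e)" using F(1) by blast
  qed
  then have L_compact: "compact L" using L_closed by simp
  \<comment> \<open>Outer measure need not be continuous along decreasing sequences, so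
    \<open>E (Ls k)\<close> is enclosed in a measurable set: the preimage of the closure of its
    image under \<open>h\<close>.\<close>
  define H where "H k = h -` closure (h ` E (Ls k)) \<inter> space M" for k
  have H_sets: "H k \<in> sets M" for k
    unfolding H_def by (intro measurable_sets[OF h] borel_closed) simp
  have EH: "E (Ls k) \<subseteq> H k" for k
    unfolding H_def using closure_subset[of "h ` E (Ls k)"] by (auto simp: E_def)
  have rH: "r \<le> emeasure M (H k)" for k
  proof -
    have "r < outer_measure_of M (E (Ls k))" using Ls by (simp add: P_def)
    also have "\<dots> \<le> outer_measure_of M (H k)" by (rule outer_measure_of_mono[OF EH])
    finally show ?thesis using H_sets[of k] by simp
  qed
  have "decseq H"
  proof (rule decseq_SucI)
    fix k
    have "E (Ls (Suc k)) \<subseteq> E (Ls k)" using Ls_mono[of k "Suc k"] by (auto simp: E_def)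
    then show "H (Suc k) \<subseteq> H k" unfolding H_def using closure_mono[OF image_mono] by blast
  qed
  then have "(INF k. emeasure M (H k)) = emeasure M (\<Inter>k. H k)"
    using H_sets by (intro INF_emeasure_decseq) auto
  then have "r \<le> emeasure M (\<Inter>k. H k)" using rH by (metis le_INF_iff)
  also have "\<dots> \<le> emeasure M (E L)"
  proof (rule emeasure_mono)
    show "E L \<in> sets M" unfolding E_def by (rule sets_compact_section[OF h R L_compact])
    show "(\<Inter>k. H k) \<subseteq> E L"
    proof
      fix t assume t: "t \<in> (\<Inter>k. H k)"
      then have tM: "t \<in> space M" by (auto simp: H_def)
      \<comment> \<open>Lying in every \<open>H k\<close> yields points of \<open>R\<close> whose
        first coordinates tend to \<open>h t\<close> and whose second coordinates are in
        \<open>Ls k\<close>; a subsequence of the latter converges into \<open>L\<close>.\<close>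
      have "\<forall>k. \<exists>p. dist (fst p) (h t) < 1 / real (Suc k) \<and> snd p \<in> Ls k \<and> p \<in> R"
      proof
        fix k
        have "h t \<in> closure (h ` E (Ls k))" using t by (auto simp: H_def)
        then obtain s where "s \<in> E (Ls k)" "dist (h s) (h t) < 1 / real (Suc k)"
          unfolding closure_approachable by (metis (no_types, lifting) imageE of_nat_0_less_iff zero_less_Suc zero_less_divide_1_iff)
        then obtain w where "w \<in> Ls k" "(h s, w) \<in> R" "dist (h s) (h t) < 1 / real (Suc k)" unfolding E_def by blast
        then show "\<exists>p. dist (fst p) (h t) < 1 / real (Suc k) \<and> snd p \<in> Ls k \<and> p \<in> R"
          by (intro exI[of _ "(h s, w)"]) simp
      qed
      from choice[OF this] obtain p where
        p: "\<forall>k. dist (fst (p k)) (h t) < 1 / real (Suc k) \<and> snd (p k) \<in> Ls k \<and> p k \<in> R" ..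
      let ?w = "\<lambda>k. snd (p k)"
      have "compact (closure (range ?w))"
      proof (rule compact_closure_finite_nets)
        fix e :: real assume e: "0 < e"
        then obtain k where k: "(1 / 2) ^ k < e" using real_arch_pow_inv[of e "1 / 2"] by auto
        obtain F where F: "finite F" "Ls (Suc k) \<subseteq> (\<Union>x\<in>F. cball x ((1 / 2) ^ k))" using net by blast
        \<comment> \<open>All terms past index \<open>k\<close> lie in \<open>Ls (Suc k)\<close>;
          the finitely many others are added to the net.\<close>
        have "range ?w \<subseteq> (\<Union>x\<in>F \<union> ?w ` {..k}. cball x e)"
        proof (rule image_subsetI)
          fix m
          show "?w m \<in> (\<Union>x\<in>F \<union> ?w ` {..k}. cball x e)"
          proof (cases "m \<le> k")
            case True
            then show ?thesis using e by (intro UN_I[of "?w m"]) auto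
          next
            case False
            then have "?w m \<in> Ls (Suc k)" using p Ls_mono[of "Suc k" m] by auto
            then obtain x where "x \<in> F" "?w m \<in> cball x ((1 / 2) ^ k)" using F(2) by blast
            then show ?thesis using k by (intro UN_I[of x]) auto
          qed
        qed
        then show "\<exists>F. finite F \<and> range ?w \<subseteq> (\<Union>x\<in>F. cball x e)"
          using F(1) by (intro exI[of _ "F \<union> ?w ` {..k}"]) simp
      qed
      moreover have "\<forall>k. ?w k \<in> closure (range ?w)" using closure_subset[of "range ?w"] by blast
      ultimately obtain v s where v: "strict_mono s" "(?w \<circ> s) \<longlonglongrightarrow> v"
        unfolding compact_eq_seq_compact_metric by (elim seq_compactE)
      have "v \<in> Ls k" for k
      proof (rule Lim_in_closed_set[OF _ _ _ v(2)])
        show "closed (Ls k)" using Ls by (simp add: P_def)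
        have "(?w \<circ> s) n \<in> Ls k" if "k \<le> n" for n
          using p Ls_mono[of k "s n"] seq_suble[OF v(1), of n] that by fastforce
        then show "\<forall>\<^sub>F n in sequentially. (?w \<circ> s) n \<in> Ls k" by (rule eventually_sequentiallyI)
      qed simp
      then have "v \<in> L" by (simp add: L_def)
      moreover have "(h t, v) \<in> R"
      proof (rule Lim_in_closed_set[OF R])
        have "(\<lambda>k. fst (p k)) \<longlonglongrightarrow> h t"
          by (rule tendsto_dist_bound[of _ _ "\<lambda>k. 1 / real (Suc k)"])
            (use p in \<open>simp_all add: dist_commute LIMSEQ_Suc[OF lim_1_over_n, simplified]\<close>)
        from tendsto_Pair[OF LIMSEQ_subseq_LIMSEQ[OF this v(1)] v(2)]
        show "((\<lambda>n. p (s n)) \<longlongrightarrow> (h t, v)) sequentially" by (simp add: comp_def)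
      qed (use p in simp_all)
      ultimately show "t \<in> E L" using tM unfolding E_def by blast
    qed
  qed
  finally have "r \<le> emeasure M (E L)" .
  moreover have "Ls 0 \<subseteq> closure D" using Ls by (simp add: P_def)
  then have "L \<subseteq> closure D" by (auto simp: L_def)
  ultimately show ?thesis using L_compact unfolding E_def by blast
qed

text \<open>Compact sets capture all but \<open>1 / real (Suc n)\<close> of the mass. The selections
  are glued along the first piece containing a point, and what no piece contains is null.\<close>

theorem ae_measurable_selection:
  fixes R :: "('a::metric_space \<times> 'b::complete_space) set"
  assumes M: "finite_measure M" and h: "h \<in> borel_measurable M" and R: "closed R"
    and D: "countable D" and sec: "\<And>t. t \<in> space M \<Longrightarrow> \<exists>w\<in>closure D. (h t, w) \<in> R"
  shows "\<exists>z. strongly_measurable M z \<and> (AE t in M. (h t, z t) \<in> R)"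
proof -
  interpret finite_measure M by (rule M)
  let ?m = "measure M (space M)"
  show ?thesis
  proof (cases "?m = 0")
    \<comment> \<open>With total mass 0 there is no extended nonnegative real strictly below it, so
      inner regularity cannot be invoked.\<close>
    case True
    then have "space M \<in> null_sets M" by (simp add: emeasure_eq_measure null_setsI)
    then have "AE t in M. (h t, undefined) \<in> R" by (rule AE_I') auto
    then show ?thesis using strongly_measurable_const by blast
  next
    case False
    then have m: "0 < ?m" by (simp add: zero_less_measure_iff)
    have "\<exists>G z. G \<in> sets M \<and> ?m - 1 / real (Suc n) \<le> measure M G \<and> strongly_measurable M z \<and>
        (\<forall>t\<in>G. (h t, z t) \<in> R)" for n
    proof -
      have "ennreal (?m - 1 / real (Suc n)) < emeasure M (space M)"
        unfolding emeasure_eq_measure using m by (intro ennreal_lessI) simp_all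
      from compact_section_inner_regular[OF M h R D sec this]
      obtain L where L: "compact L" "L \<subseteq> closure D"
        "ennreal (?m - 1 / real (Suc n)) \<le> emeasure M {t \<in> space M. \<exists>w\<in>L. (h t, w) \<in> R}"
        by blast
      from compact_selection[OF h R L(1) D L(2)]
      obtain z where z: "strongly_measurable M z"
        "\<forall>t\<in>space M. (\<exists>w\<in>L. (h t, w) \<in> R) \<longrightarrow> (h t, z t) \<in> R" by blast
      have "?m - 1 / real (Suc n) \<le> measure M {t \<in> space M. \<exists>w\<in>L. (h t, w) \<in> R}"
        using L(3) unfolding emeasure_eq_measure by (subst (asm) ennreal_le_iff) simp_all
      then show ?thesis
        using z sets_compact_section[OF h R L(1)]
        by (intro exI[of _ "{t \<in> space M. \<exists>w\<in>L. (h t, w) \<in> R}"] exI[of _ z]) simp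
    qed
    then have "\<forall>n. \<exists>G z. G \<in> sets M \<and> ?m - 1 / real (Suc n) \<le> measure M G \<and> strongly_measurable M z \<and>
        (\<forall>t\<in>G. (h t, z t) \<in> R)" ..
    from choice[OF this] obtain G where "\<forall>n. \<exists>z. G n \<in> sets M \<and> ?m - 1 / real (Suc n) \<le> measure M (G n) \<and>
        strongly_measurable M z \<and> (\<forall>t\<in>G n. (h t, z t) \<in> R)" ..
    from choice[OF this] obtain z where Gz: "\<forall>n. G n \<in> sets M \<and> ?m - 1 / real (Suc n) \<le> measure M (G n) \<and>
        strongly_measurable M (z n) \<and> (\<forall>t\<in>G n. (h t, z n t) \<in> R)" ..
    define N where "N t = (LEAST n. t \<in> G n)" for t
    have "N \<in> measurable M (count_space UNIV)"
      unfolding N_def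
    proof (rule measurable_Least)
      fix n
      have "{t \<in> space M. t \<in> G n} = G n" using Gz sets.sets_into_space by blast
      then show "Measurable.pred M (\<lambda>t. t \<in> G n)" using Gz by (simp add: pred_def)
    qed
    from strongly_measurable_compose_countable[of M z, OF _ this]
    have "strongly_measurable M (\<lambda>t. z (N t) t)" using Gz by blast
    moreover have "AE t in M. (h t, z (N t) t) \<in> R"
    proof (rule AE_I')
      let ?B = "space M - (\<Union>n. G n)"
      have B: "?B \<in> sets M" using Gz by (intro sets.Diff sets.countable_UN) auto
      have "measure M ?B \<le> 1 / real (Suc n)" for n
      proof -
        have "measure M ?B \<le> measure M (space M - G n)"
          using Gz B by (intro finite_measure_mono) auto
        also have "\<dots> = ?m - measure M (G n)" using Gz by (intro finite_measure_compl) simp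
        also have "\<dots> \<le> 1 / real (Suc n)" using Gz by (simp add: algebra_simps)
        finally show ?thesis .
      qed
      then have "measure M ?B \<le> 0"
        by (intro LIMSEQ_le_const[OF LIMSEQ_Suc[OF lim_1_over_n]]) blast
      then have "measure M ?B = 0" by (simp add: measure_le_0_iff)
      then show "?B \<in> null_sets M" using B by (simp add: emeasure_eq_measure null_setsI)
      show "{t \<in> space M. (h t, z (N t) t) \<notin> R} \<subseteq> ?B"
      proof
        fix t assume t: "t \<in> {t \<in> space M. (h t, z (N t) t) \<notin> R}"
        have False if "t \<in> G n" for n
        proof -
          from that have "t \<in> G (N t)" unfolding N_def by (rule LeastI)
          then show False using Gz t by blast
        qed
        then show "t \<in> ?B" using t by blast
      qed
    qed
    ultimately show ?thesis by blast
  qed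
qed

section \<open>Isometric lifting of Bochner integrable functions\<close>

text \<open>Subtraction from \<open>x\<close> maps the fibre over \<open>Q x\<close> into the
  kernel. Hence the distance from \<open>x\<close> to the kernel is at most the infimum of the norms
  on that fibre, which is \<open>norm (Q x)\<close>.\<close>

lemma quotient_proximinal_shift:
  fixes Q :: "'x::real_normed_vector \<Rightarrow> 'y::real_normed_vector"
  assumes q: "quotient_operator Q" and prox: "proximinal {x. Q x = 0}"
  shows "\<exists>z. Q z = 0 \<and> norm (x - z) \<le> norm (Q x)"
proof -
  interpret Q: bounded_linear Q using q by (simp add: quotient_operator_def)
  obtain z where z: "Q z = 0" "norm (x - z) = infdist x {x. Q x = 0}"
    using prox unfolding proximinal_def by blast
  have "infdist x {x. Q x = 0} \<le> Inf {norm x' | x'. Q x' = Q x}"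
  proof (rule cInf_greatest)
    fix r assume "r \<in> {norm x' | x'. Q x' = Q x}"
    then obtain x' where x': "r = norm x'" "Q x' = Q x" by blast
    then have "infdist x {x. Q x = 0} \<le> dist x (x - x')" by (intro infdist_le) (simp add: Q.diff)
    then show "infdist x {x. Q x = 0} \<le> r" using x' by (simp add: dist_norm)
  qed blast
  also have "\<dots> = norm (Q x)" using q unfolding quotient_operator_def by metis
  finally show ?thesis using z by auto
qed

theorem ae_isometric_lift:
  fixes Q :: "'x::banach \<Rightarrow> 'y::real_normed_vector"
  assumes q: "quotient_operator Q" and wcd: "weakly_countably_determined {x. Q x = 0}"
    and prox: "proximinal {x. Q x = 0}"
    and g: "strongly_measurable M g" and int: "integrable M (\<lambda>t. norm (g t))"
  shows "\<exists>f. strongly_measurable M f \<and> (AE t in M. Q (f t) = g t \<and> norm (f t) \<le> norm (g t))"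
proof -
  have bl: "bounded_linear Q" using q by (simp add: quotient_operator_def)
  interpret Q: bounded_linear Q by (rule bl)
  note shift = quotient_proximinal_shift[OF q prox]
  have lift: "\<exists>x. Q x = y \<and> norm x \<le> norm y" for y
  proof -
    obtain x where x: "Q x = y" using q unfolding quotient_operator_def by (metis surjD)
    obtain z where "Q z = 0" "norm (x - z) \<le> norm (Q x)" using shift[of x] by blast
    then show ?thesis using x by (intro exI[of _ "x - z"]) (simp add: Q.diff)
  qed
  obtain h where h: "strongly_measurable M h" and Qh: "\<forall>t\<in>space M. Q (h t) = g t"
    using strongly_measurable_lift[OF bl lift g] by blast
  obtain D where D: "countable D" "h ` space M \<subseteq> closure D"
    using h unfolding strongly_measurable_def by blast
  obtain B where B: "countable B" "B \<subseteq> {x. Q x = 0}"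
    "\<forall>x\<in>closure D. \<exists>z\<in>closure B. norm (x - z) \<le> norm (Q x)"
    using WCD_separable_reduction[OF bl wcd shift D(1)] by (elim exE conjE) (rule that)
  have Zclosed: "closed {z. Q z = 0}"
    by (intro closed_Collect_eq Q.continuous_on continuous_on_id continuous_on_const)
  have ZB: "closure B \<subseteq> {x. Q x = 0}" using B(2) Zclosed by (rule closure_minimal)
  define R where "R = {p. Q (snd p) = 0 \<and> norm (fst p - snd p) \<le> norm (Q (fst p))}"
  have R: "closed R"
    unfolding R_def
    by (intro closed_Collect_conj closed_Collect_eq closed_Collect_le Q.continuous_on
      continuous_on_norm continuous_on_diff continuous_on_fst continuous_on_snd
      continuous_on_id continuous_on_const)
  \<comment> \<open>Integrability of \<open>g\<close> makes this measure finite even when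
    \<open>M\<close> is not sigma-finite.\<close>
  define N where "N = density M (\<lambda>t. ennreal (norm (g t)))"
  have [simp]: "space N = space M" "sets N = sets M" by (simp_all add: N_def)
  have g_norm: "(\<lambda>t. norm (g t)) \<in> borel_measurable M" by (rule borel_measurable_norm_strongly[OF g])
  have "emeasure N (space N) = (\<integral>\<^sup>+ t. ennreal (norm (g t)) \<partial>M)"
    unfolding N_def using g_norm by (subst emeasure_density) (auto intro!: nn_integral_cong)
  also have "\<dots> < \<infinity>" using int unfolding integrable_iff_bounded by simp
  finally have N: "finite_measure N" by (intro finite_measureI) simp
  have hN: "h \<in> borel_measurable N"
    using strongly_measurable_borel[OF h] by (simp add: N_def)
  have sec: "\<exists>w\<in>closure B. (h t, w) \<in> R" if "t \<in> space N" for t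
  proof -
    have "h t \<in> closure D" using D(2) that by auto
    then obtain z where "z \<in> closure B" "norm (h t - z) \<le> norm (Q (h t))" using B(3) by blast
    then show ?thesis using ZB by (intro bexI[of _ z]) (auto simp: R_def)
  qed
  obtain z where z: "strongly_measurable N z" and zR: "AE t in N. (h t, z t) \<in> R"
    using ae_measurable_selection[OF N hN R B(1) sec] by blast
  have zM: "strongly_measurable M z"
    using z unfolding strongly_measurable_def by (simp add: N_def)
  \<comment> \<open>The set where \<open>g\<close> vanishes is \<open>N\<close>-null, so the
    selection says nothing there; the value 0 is an exact lift.\<close>
  define f where "f t = (if g t = 0 then 0 else h t - z t)" for t
  have "strongly_measurable M f"
    unfolding f_def
  proof (rule strongly_measurable_If[OF strongly_measurable_const strongly_measurable_diff[OF h zM]])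
    have "{t \<in> space M. norm (g t) = 0} \<in> sets M" using g_norm by measurable
    then show "{t \<in> space M. g t = 0} \<in> sets M" by simp
  qed
  moreover have "AE t in M. 0 < ennreal (norm (g t)) \<longrightarrow> (h t, z t) \<in> R"
    using zR g_norm unfolding N_def by (subst (asm) AE_density) auto
  then have "AE t in M. Q (f t) = g t \<and> norm (f t) \<le> norm (g t)"
    using AE_space
  proof eventually_elim
    case (elim t)
    then show ?case using Qh by (auto simp: f_def R_def Q.diff)
  qed
  ultimately show ?thesis by blast
qed

section \<open>Bochner integrable functions and completeness of their seminorm\<close>

definition bochner_integrable :: "'w measure \<Rightarrow> ('w \<Rightarrow> 'a::real_normed_vector) \<Rightarrow> bool"
  where "bochner_integrable M f \<longleftrightarrow> strongly_measurable M f \<and> integrable M (\<lambda>t. norm (f t))"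

lemma bochner_integrable_bound:
  assumes "strongly_measurable M f" "integrable M r" "AE t in M. norm (f t) \<le> r t"
  shows "bochner_integrable M f"
  unfolding bochner_integrable_def
proof
  show "integrable M (\<lambda>t. norm (f t))"
    by (rule Bochner_Integration.integrable_bound[OF assms(2) borel_measurable_norm_strongly[OF assms(1)]])
      (use assms(3) in eventually_elim, auto)
qed (rule assms(1))

lemma bochner_integrable_add:
  assumes "bochner_integrable M f" "bochner_integrable M g"
  shows "bochner_integrable M (\<lambda>t. f t + g t)"
proof (rule bochner_integrable_bound)
  show "integrable M (\<lambda>t. norm (f t) + norm (g t))"
    using assms by (simp add: bochner_integrable_def)
qed (use assms in \<open>simp_all add: bochner_integrable_def strongly_measurable_add norm_triangle_ineq\<close>)

lemma bochner_integrable_diff: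
  assumes "bochner_integrable M f" "bochner_integrable M g"
  shows "bochner_integrable M (\<lambda>t. f t - g t)"
proof (rule bochner_integrable_bound)
  show "integrable M (\<lambda>t. norm (f t) + norm (g t))"
    using assms by (simp add: bochner_integrable_def)
qed (use assms in \<open>simp_all add: bochner_integrable_def strongly_measurable_diff norm_triangle_ineq4\<close>)

lemma bochner_integrable_scaleR:
  assumes "integrable M r"
  shows "bochner_integrable M (\<lambda>t. r t *\<^sub>R y)"
proof (rule bochner_integrable_bound)
  show "strongly_measurable M (\<lambda>t. r t *\<^sub>R y)"
    using assms by (intro strongly_measurable_scaleR strongly_measurable_const) simp
  show "integrable M (\<lambda>t. \<bar>r t\<bar> * norm y)" using assms by simp
qed simp

lemma bochner_integrable_sum:
  assumes "\<And>i. i \<in> I \<Longrightarrow> bochner_integrable M (f i)"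
  shows "bochner_integrable M (\<lambda>t. \<Sum>i\<in>I. f i t)"
  using assms
proof (induction I rule: infinite_finite_induct)
  case (insert i I)
  then have "bochner_integrable M (\<lambda>t. f i t + (\<Sum>i\<in>I. f i t))"
    by (intro bochner_integrable_add) simp_all
  then show ?case using insert.hyps by simp
qed (simp_all add: bochner_integrable_def strongly_measurable_const)

definition bochner_norm :: "'w measure \<Rightarrow> ('w \<Rightarrow> 'a::real_normed_vector) \<Rightarrow> real"
  where "bochner_norm M f = (\<integral>t. norm (f t) \<partial>M)"

lemma bochner_norm_nonneg: "0 \<le> bochner_norm M f"
  by (simp add: bochner_norm_def)

lemma bochner_norm_mono_AE:
  assumes "bochner_integrable M f" "bochner_integrable M g" "AE t in M. norm (f t) \<le> norm (g t)"
  shows "bochner_norm M f \<le> bochner_norm M g"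
  using assms unfolding bochner_norm_def bochner_integrable_def by (intro integral_mono_AE) auto

lemma bochner_norm_triangle:
  assumes "bochner_integrable M f" "bochner_integrable M g" "bochner_integrable M h"
  shows "bochner_norm M (\<lambda>t. f t - h t) \<le> bochner_norm M (\<lambda>t. f t - g t) + bochner_norm M (\<lambda>t. g t - h t)"
proof -
  have int: "integrable M (\<lambda>t. norm (f t - g t))" "integrable M (\<lambda>t. norm (g t - h t))"
    "integrable M (\<lambda>t. norm (f t - h t))"
    using assms[THEN bochner_integrable_diff] assms unfolding bochner_integrable_def by auto
  have "bochner_norm M (\<lambda>t. f t - h t) \<le> (\<integral>t. norm (f t - g t) + norm (g t - h t) \<partial>M)"
    unfolding bochner_norm_def
  proof (rule integral_mono)
    show "norm (f t - h t) \<le> norm (f t - g t) + norm (g t - h t)" for t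
      using norm_triangle_ineq[of "f t - g t" "g t - h t"] by simp
  qed (use int in simp_all)
  also have "\<dots> = bochner_norm M (\<lambda>t. f t - g t) + bochner_norm M (\<lambda>t. g t - h t)"
    unfolding bochner_norm_def using int by (intro Bochner_Integration.integral_add)
  finally show ?thesis .
qed

lemma bochner_norm_diff_commute: "bochner_norm M (\<lambda>t. f t - g t) = bochner_norm M (\<lambda>t. g t - f t)"
  by (simp add: bochner_norm_def norm_minus_commute)

lemma bochner_norm_abs_diff:
  assumes "bochner_integrable M f" "bochner_integrable M g"
  shows "\<bar>bochner_norm M f - bochner_norm M g\<bar> \<le> bochner_norm M (\<lambda>t. f t - g t)"
proof -
  have 0: "bochner_integrable M (\<lambda>t. 0)"
    by (simp add: bochner_integrable_def strongly_measurable_const)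
  show ?thesis
    using bochner_norm_triangle[OF assms 0] bochner_norm_triangle[OF assms(2,1) 0]
      bochner_norm_diff_commute[of M f g] by simp
qed

lemma tendsto_bochner_norm:
  assumes "\<And>n. bochner_integrable M (F n)" "bochner_integrable M f"
    and lim: "(\<lambda>n. bochner_norm M (\<lambda>t. F n t - f t)) \<longlonglongrightarrow> 0"
  shows "(\<lambda>n. bochner_norm M (F n)) \<longlonglongrightarrow> bochner_norm M f"
proof (rule metric_tendsto_imp_tendsto[OF lim])
  have "dist (bochner_norm M (F n)) (bochner_norm M f) \<le> dist (bochner_norm M (\<lambda>t. F n t - f t)) 0" for n
    using bochner_norm_abs_diff[OF assms(1)[of n] assms(2)] bochner_norm_nonneg[of M "\<lambda>t. F n t - f t"]
    by (simp add: dist_real_def)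
  then show "\<forall>\<^sub>F n in sequentially. dist (bochner_norm M (F n)) (bochner_norm M f)
      \<le> dist (bochner_norm M (\<lambda>t. F n t - f t)) 0" by simp
qed

lemma nn_integral_norm_bochner:
  assumes "bochner_integrable M f"
  shows "(\<integral>\<^sup>+ t. ennreal (norm (f t)) \<partial>M) = ennreal (bochner_norm M f)"
  unfolding bochner_norm_def using assms
  by (intro nn_integral_eq_integral) (auto simp: bochner_integrable_def)

text \<open>The pointwise sum of the norms of the increments has a finite integral, hence is finite
  almost everywhere, and there the telescoping series converges absolutely.\<close>

lemma bochner_Cauchy_ae_limit:
  fixes F :: "nat \<Rightarrow> 'w \<Rightarrow> 'a::banach"
  assumes F: "\<And>n. bochner_integrable M (F n)"
    and small: "\<And>k. bochner_norm M (\<lambda>t. F (Suc k) t - F k t) \<le> (1 / 2) ^ k"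
  shows "\<exists>G. strongly_measurable M G \<and> (AE t in M. (\<lambda>k. F k t) \<longlonglongrightarrow> G t)"
proof -
  have d: "bochner_integrable M (\<lambda>t. F (Suc k) t - F k t)" for k
    by (rule bochner_integrable_diff[OF F F])
  have meas: "(\<lambda>t. norm (F (Suc k) t - F k t)) \<in> borel_measurable M" for k
    using d[of k] by (intro borel_measurable_norm_strongly) (simp add: bochner_integrable_def)
  define T where "T = {t \<in> space M. (\<Sum>k. ennreal (norm (F (Suc k) t - F k t))) \<noteq> \<infinity>}"
  have T: "T \<in> sets M" unfolding T_def using meas by measurable
  have "(\<integral>\<^sup>+ t. (\<Sum>k. ennreal (norm (F (Suc k) t - F k t))) \<partial>M)
      = (\<Sum>k. \<integral>\<^sup>+ t. ennreal (norm (F (Suc k) t - F k t)) \<partial>M)"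
    using meas by (intro nn_integral_suminf) simp
  also have "\<dots> \<le> (\<Sum>k. ennreal ((1 / 2) ^ k))"
    using small by (intro suminf_le) (auto simp: nn_integral_norm_bochner[OF d] ennreal_leI)
  also have "\<dots> = ennreal (\<Sum>k. (1 / 2) ^ k)"
    by (rule suminf_ennreal2) (auto intro: summable_geometric)
  also have "\<dots> < \<infinity>" by simp
  finally have "(\<integral>\<^sup>+ t. (\<Sum>k. ennreal (norm (F (Suc k) t - F k t))) \<partial>M) \<noteq> \<infinity>" by simp
  then have "AE t in M. (\<Sum>k. ennreal (norm (F (Suc k) t - F k t))) \<noteq> \<infinity>"
    by (intro nn_integral_PInf_AE) (use meas in measurable)
  then have AET: "AE t in M. t \<in> T" using AE_space by eventually_elim (simp add: T_def)
  have conv: "convergent (\<lambda>k. F k t)" if "t \<in> T" for t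
  proof -
    have "summable (\<lambda>k. norm (F (Suc k) t - F k t))"
      using that unfolding T_def by (intro summable_suminf_not_top) auto
    then have "summable (\<lambda>k. F (Suc k) t - F k t)" by (rule summable_norm_cancel)
    then have "convergent (\<lambda>n. (\<Sum>k<n. F (Suc k) t - F k t))" by (simp add: summable_iff_convergent)
    then have "convergent (\<lambda>n. (F n t - F 0 t) + F 0 t)"
      unfolding sum_lessThan_telescope[of "\<lambda>k. F k t"] by (intro convergent_add convergent_const)
    then show ?thesis by simp
  qed
  \<comment> \<open>Replacing all terms by 0 off \<open>T\<close> turns convergence almost
    everywhere into convergence everywhere.\<close>
  define G where "G t = (if t \<in> T then lim (\<lambda>k. F k t) else 0)" for t
  have "strongly_measurable M G"
  proof (rule strongly_measurable_LIMSEQ[of M "\<lambda>k t. if t \<in> T then F k t else 0"])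
    fix k
    have "{t \<in> space M. t \<in> T} = T" by (auto simp: T_def)
    then show "strongly_measurable M (\<lambda>t. if t \<in> T then F k t else 0)"
      using F[of k] T by (intro strongly_measurable_If strongly_measurable_const) (auto simp: bochner_integrable_def)
  next
    fix t
    show "(\<lambda>k. if t \<in> T then F k t else 0) \<longlonglongrightarrow> G t"
      using conv[of t] by (simp add: G_def convergent_LIMSEQ_iff)
  qed
  moreover have "AE t in M. (\<lambda>k. F k t) \<longlonglongrightarrow> G t"
    using AET by eventually_elim (use conv in \<open>simp add: G_def convergent_LIMSEQ_iff\<close>)
  ultimately show ?thesis by blast
qed

theorem bochner_complete:
  fixes F :: "nat \<Rightarrow> 'w \<Rightarrow> 'a::banach"
  assumes F: "\<And>n. bochner_integrable M (F n)"
    and Cauchy: "\<And>e. 0 < e \<Longrightarrow> \<exists>N. \<forall>m\<ge>N. \<forall>n\<ge>N. bochner_norm M (\<lambda>t. F m t - F n t) < e"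
  shows "\<exists>G. bochner_integrable M G \<and> (\<lambda>n. bochner_norm M (\<lambda>t. F n t - G t)) \<longlonglongrightarrow> 0"
proof -
  have "\<forall>k. \<exists>N. \<forall>m\<ge>N. \<forall>n\<ge>N. bochner_norm M (\<lambda>t. F m t - F n t) < (1 / 2) ^ k"
    using Cauchy by simp
  from choice[OF this] obtain N where
    N: "\<forall>k. \<forall>m\<ge>N k. \<forall>n\<ge>N k. bochner_norm M (\<lambda>t. F m t - F n t) < (1 / 2) ^ k" ..
  \<comment> \<open>Summing all earlier thresholds makes \<open>s\<close> increasing and at least
    \<open>N k\<close>; the summand \<open>k\<close> makes it unbounded.\<close>
  define s where "s k = (\<Sum>i\<le>k. N i) + k" for k
  have sN: "N k \<le> s k" for k unfolding s_def by (simp add: trans_le_add1 member_le_sum)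
  have s_Suc: "s k \<le> s (Suc k)" for k by (simp add: s_def)
  have s_ge: "k \<le> s k" for k by (simp add: s_def)
  have "bochner_norm M (\<lambda>t. F (s (Suc k)) t - F (s k) t) \<le> (1 / 2) ^ k" for k
    using N sN[of k] s_Suc[of k] by (meson less_imp_le order_trans)
  then obtain G where G: "strongly_measurable M G" and lim: "AE t in M. (\<lambda>k. F (s k) t) \<longlonglongrightarrow> G t"
    using bochner_Cauchy_ae_limit[of M "\<lambda>k. F (s k)"] F by blast
  \<comment> \<open>Fatou's lemma transfers a Cauchy estimate to \<open>G\<close>; it gives both
    integrability of \<open>G\<close> and convergence of the whole sequence.\<close>
  have Fatou: "(\<integral>\<^sup>+ t. ennreal (norm (F n t - G t)) \<partial>M) \<le> ennreal e"
    if le: "\<And>m. n \<le> m \<Longrightarrow> bochner_norm M (\<lambda>t. F n t - F m t) \<le> e" for n e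
  proof -
    have "(\<integral>\<^sup>+ t. ennreal (norm (F n t - G t)) \<partial>M)
        = (\<integral>\<^sup>+ t. liminf (\<lambda>k. ennreal (norm (F n t - F (s k) t))) \<partial>M)"
    proof (rule nn_integral_cong_AE, use lim in eventually_elim)
      case (elim t)
      then have "(\<lambda>k. ennreal (norm (F n t - F (s k) t))) \<longlonglongrightarrow> ennreal (norm (F n t - G t))"
        by (intro tendsto_ennrealI tendsto_norm tendsto_diff tendsto_const)
      then show ?case using lim_imp_Liminf[OF sequentially_bot] by metis
    qed
    also have "\<dots> \<le> liminf (\<lambda>k. \<integral>\<^sup>+ t. ennreal (norm (F n t - F (s k) t)) \<partial>M)"
      using bochner_integrable_diff[OF F F]
      by (intro nn_integral_liminf measurable_compose[OF _ measurable_ennreal] borel_measurable_norm_strongly)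
        (simp add: bochner_integrable_def)
    also have "\<dots> \<le> liminf (\<lambda>k. ennreal e)"
    proof (rule Liminf_mono)
      have "(\<integral>\<^sup>+ t. ennreal (norm (F n t - F (s k) t)) \<partial>M) \<le> ennreal e" if "n \<le> k" for k
        unfolding nn_integral_norm_bochner[OF bochner_integrable_diff[OF F F]]
        using le[of "s k"] s_ge[of k] that by (intro ennreal_leI) simp
      then show "\<forall>\<^sub>F k in sequentially. (\<integral>\<^sup>+ t. ennreal (norm (F n t - F (s k) t)) \<partial>M) \<le> ennreal e"
        by (rule eventually_sequentiallyI)
    qed
    also have "\<dots> = ennreal e" by (simp add: Liminf_const)
    finally show ?thesis .
  qed
  have diff_meas: "strongly_measurable M (\<lambda>t. F n t - G t)" for n
    using F[of n] G by (intro strongly_measurable_diff) (simp_all add: bochner_integrable_def)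
  have Gint: "bochner_integrable M G"
  proof -
    obtain n where n: "\<forall>m\<ge>n. bochner_norm M (\<lambda>t. F n t - F m t) < 1" using Cauchy[of 1] by (auto intro: order_refl)
    have "(\<integral>\<^sup>+ t. ennreal (norm (F n t - G t)) \<partial>M) \<le> ennreal 1"
      by (rule Fatou) (use n less_imp_le in blast)
    then have "integrable M (\<lambda>t. norm (F n t - G t))"
      unfolding integrable_iff_bounded using borel_measurable_norm_strongly[OF diff_meas[of n]]
      by (auto simp: le_less_trans)
    then have "bochner_integrable M (\<lambda>t. F n t - G t)"
      using diff_meas by (simp add: bochner_integrable_def)
    from bochner_integrable_diff[OF F[of n] this] show ?thesis by simp
  qed
  moreover have "(\<lambda>n. bochner_norm M (\<lambda>t. F n t - G t)) \<longlonglongrightarrow> 0"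
  proof (rule LIMSEQ_I)
    fix e :: real assume e: "0 < e"
    then obtain K where K: "\<forall>m\<ge>K. \<forall>n\<ge>K. bochner_norm M (\<lambda>t. F m t - F n t) < e / 2"
      using Cauchy[of "e / 2"] by auto
    have "bochner_norm M (\<lambda>t. F n t - G t) < e" if "K \<le> n" for n
    proof -
      have "ennreal (bochner_norm M (\<lambda>t. F n t - G t)) \<le> ennreal (e / 2)"
        unfolding nn_integral_norm_bochner[OF bochner_integrable_diff[OF F Gint], symmetric]
        by (rule Fatou) (use K that in \<open>simp add: less_imp_le\<close>)
      then show ?thesis using e by simp
    qed
    then show "\<exists>K. \<forall>n\<ge>K. norm (bochner_norm M (\<lambda>t. F n t - G t) - 0) < e"
      by (intro exI[of _ K]) (simp add: abs_of_nonneg bochner_norm_nonneg)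
  qed
  ultimately show ?thesis by blast
qed

section \<open>The projective norm on L1\<close>

lemma tensor_add_left: "tensor (f + g) y = tensor f y + tensor g y"
  by (auto simp: tensor_def bilinear_ladd fun_eq_iff)

lemma tensor_scaleR_left: "tensor (c *\<^sub>R f) y = c *\<^sub>R tensor f y"
  by (auto simp: tensor_def bilinear_lmul fun_eq_iff scaleR_fun_def)

lemma tensor_add_right: "tensor f (x + y) = tensor f x + tensor f y"
  by (auto simp: tensor_def bilinear_radd fun_eq_iff)

lemma tensor_scaleR_right: "tensor f (c *\<^sub>R y) = c *\<^sub>R tensor f y"
  by (auto simp: tensor_def bilinear_rmul fun_eq_iff scaleR_fun_def)

lemma tensor_diff_left: "tensor (f - g) y = tensor f y - tensor g y"
  using tensor_add_left[of "f - g" g y] by simp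

lemma tensor_zero_left: "tensor 0 y = 0"
  using tensor_scaleR_left[of 0 0 y] by (simp only: scaleR_zero_left)

lemma tensor_zero_right: "tensor f 0 = 0"
  using tensor_scaleR_right[of f 0 0] by (simp only: scaleR_zero_left)

lemma tensor_sum_left: "tensor (\<Sum>i\<in>I. f i) y = (\<Sum>i\<in>I. tensor (f i) y)"
  by (induction I rule: infinite_finite_induct)
    (simp_all only: sum.infinite sum.empty sum.insert tensor_zero_left tensor_add_left not_False_eq_True)

lemma tensor_sum_right: "tensor f (\<Sum>i\<in>I. y i) = (\<Sum>i\<in>I. tensor f (y i))"
  by (induction I rule: infinite_finite_induct)
    (simp_all only: sum.infinite sum.empty sum.insert tensor_zero_right tensor_add_right not_False_eq_True)

lemma sum_fun_apply: "(\<Sum>i\<in>I. f i) t = (\<Sum>i\<in>I. f i t)"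
  by (induction I rule: infinite_finite_induct) simp_all

lemma subspace_algebraic_tensor: "subspace (algebraic_tensor V)"
  unfolding algebraic_tensor_def by (rule subspace_span)

lemma tensor_in_algebraic_tensor: "x \<in> V \<Longrightarrow> tensor x y \<in> algebraic_tensor V"
  unfolding algebraic_tensor_def by (rule span_base) blast

text \<open>Scalars are absorbed into the first factor, so linear combinations become plain
  sums.\<close>

lemma algebraic_tensor_representation:
  assumes V: "subspace V" and u: "u \<in> algebraic_tensor V"
  shows "\<exists>(n::nat) x y. (\<forall>i<n. x i \<in> V) \<and> u = (\<Sum>i<n. tensor (x i) (y i))"
  using u unfolding algebraic_tensor_def
proof (induction rule: span_induct_alt)
  case base
  show ?case by (intro exI[of _ "0 :: nat"]) simp
next
  case (step c a u)
  from step obtain f z where a: "f \<in> V" "a = tensor f z" by blast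
  from step obtain n :: nat and x y where IH: "\<forall>i<n. x i \<in> V" "u = (\<Sum>i<n. tensor (x i) (y i))" by blast
  have "c *\<^sub>R a + u = (\<Sum>i<Suc n. tensor ((x(n := c *\<^sub>R f)) i) ((y(n := z)) i))"
    by (simp add: IH(2) a(2) tensor_scaleR_left)
  moreover have "\<forall>i<Suc n. (x(n := c *\<^sub>R f)) i \<in> V"
    using IH(1) a(1) subspace_scale[OF V] by (simp add: less_Suc_eq)
  ultimately show ?case by blast
qed

text \<open>The function \<open>t \<mapsto> \<Sum>i. f\<^sub>i(t) y\<^sub>i\<close> represented by a tensor \<open>\<Sum>i. f\<^sub>i \<otimes> y\<^sub>i\<close>.\<close>

definition tensor_fun :: "('w \<Rightarrow> real, 'y::real_normed_vector) tensor \<Rightarrow> 'w \<Rightarrow> 'y"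
  where "tensor_fun u t = (THE y. \<forall>\<phi>. linear \<phi> \<longrightarrow> \<phi> y = u (\<lambda>f x. f t * \<phi> x))"

text \<open>A tensor is tested at the point \<open>t\<close> through these forms, with
  \<open>\<phi>\<close> ranging over all linear functionals; hence its function does not depend on a
  representation.\<close>

lemma bilinear_eval:
  fixes \<phi> :: "'y::real_vector \<Rightarrow> real"
  assumes "linear \<phi>"
  shows "bilinear (\<lambda>(f::'w \<Rightarrow> real) y. f t * \<phi> y)"
  unfolding bilinear_def
proof (intro conjI allI)
  show "linear (\<lambda>y. f t * \<phi> y)" for f :: "'w \<Rightarrow> real"
    by (rule linearI) (simp_all add: linear_add[OF assms] linear_scale[OF assms] algebra_simps)
  show "linear (\<lambda>f::'w \<Rightarrow> real. f t * \<phi> y)" for y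
    by (rule linearI) (simp_all add: scaleR_fun_def algebra_simps)
qed

text \<open>Uniqueness is a Hahn-Banach argument: a functional norming the difference separates two
  candidates.\<close>

lemma tensor_fun_eqI:
  fixes y :: "'y::real_normed_vector"
  assumes "\<And>\<phi>. linear \<phi> \<Longrightarrow> \<phi> y = u (\<lambda>f x. f t * \<phi> x)"
  shows "tensor_fun u t = y"
  unfolding tensor_fun_def
proof (rule the_equality)
  fix x assume x: "\<forall>\<phi>. linear \<phi> \<longrightarrow> \<phi> x = u (\<lambda>f x. f t * \<phi> x)"
  obtain \<phi> where \<phi>: "linear \<phi>" "\<phi> (x - y) = norm (x - y)" using norming_functional[of "x - y"] by metis
  have "\<phi> x = \<phi> y" using assms[OF \<phi>(1)] x \<phi>(1) by simp
  then show "x = y" using \<phi> linear_diff[OF \<phi>(1), of x y] by simp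
qed (use assms in blast)

lemma sum_tensor_apply:
  "bilinear B \<Longrightarrow> (\<Sum>i\<in>I. tensor (f i) (y i)) B = (\<Sum>i\<in>I. B (f i) (y i))"
  by (induction I rule: infinite_finite_induct) (simp_all add: tensor_def)

lemma tensor_fun_sum:
  fixes y :: "'i \<Rightarrow> 'y::real_normed_vector"
  shows "tensor_fun (\<Sum>i\<in>I. tensor (f i) (y i)) t = (\<Sum>i\<in>I. f i t *\<^sub>R y i)"
proof (rule tensor_fun_eqI)
  fix \<phi> :: "'y \<Rightarrow> real" assume \<phi>: "linear \<phi>"
  show "\<phi> (\<Sum>i\<in>I. f i t *\<^sub>R y i) = (\<Sum>i\<in>I. tensor (f i) (y i)) (\<lambda>f x. f t * \<phi> x)"
    unfolding sum_tensor_apply[OF bilinear_eval[OF \<phi>]]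
    by (simp add: linear_sum[OF \<phi>] linear_scale[OF \<phi>])
qed

lemma subspace_L1: "subspace (L1 M)"
  unfolding subspace_def L1_def by (auto simp: scaleR_fun_def plus_fun_def zero_fun_def)

lemma tensor_fun_diff:
  assumes "u \<in> algebraic_tensor (L1 M)" "v \<in> algebraic_tensor (L1 M)"
  shows "tensor_fun (u - v) t = tensor_fun u t - tensor_fun v t"
proof -
  obtain m :: nat and x y where u: "u = (\<Sum>i<m. tensor (x i) (y i))"
    using algebraic_tensor_representation[OF subspace_L1 assms(1)] by blast
  obtain n :: nat and z w where v: "v = (\<Sum>i<n. tensor (z i) (w i))"
    using algebraic_tensor_representation[OF subspace_L1 assms(2)] by blast
  show ?thesis
  proof (rule tensor_fun_eqI)
    fix \<phi> :: "'b \<Rightarrow> real" assume \<phi>: "linear \<phi>"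
    show "\<phi> (tensor_fun u t - tensor_fun v t) = (u - v) (\<lambda>f x. f t * \<phi> x)"
      unfolding u v tensor_fun_sum
      by (simp add: sum_tensor_apply[OF bilinear_eval[OF \<phi>]] linear_diff[OF \<phi>] linear_sum[OF \<phi>] linear_scale[OF \<phi>])
  qed
qed

lemma bochner_integrable_tensor_fun:
  assumes "u \<in> algebraic_tensor (L1 M)"
  shows "bochner_integrable M (tensor_fun u)"
proof -
  obtain n :: nat and x y where u: "\<forall>i<n. x i \<in> L1 M" "u = (\<Sum>i<n. tensor (x i) (y i))"
    using algebraic_tensor_representation[OF subspace_L1 assms] by blast
  have "bochner_integrable M (\<lambda>t. \<Sum>i<n. x i t *\<^sub>R y i)"
    using u(1) by (intro bochner_integrable_sum bochner_integrable_scaleR) (simp add: L1_def)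
  then show ?thesis by (simp add: u(2) tensor_fun_sum[abs_def])
qed

lemma L1_norm_nonneg: "0 \<le> L1_norm M f"
  by (simp add: L1_norm_def)

text \<open>The norm is defined with index sets \<open>{..<n}\<close>; a bijection admits any finite
  index set, such as sets of lists and disjoint sums.\<close>

lemma projective_norm_le_sum:
  fixes y :: "'i \<Rightarrow> 'y::real_normed_vector"
  assumes I: "finite I" and x: "\<And>i. i \<in> I \<Longrightarrow> x i \<in> L1 M"
  shows "projective_norm (L1 M) (L1_norm M) (\<Sum>i\<in>I. tensor (x i) (y i)) \<le> (\<Sum>i\<in>I. L1_norm M (x i) * norm (y i))"
proof -
  obtain b where b: "bij_betw b {..<card I} I"
    using ex_bij_betw_nat_finite[OF I] by (auto simp: lessThan_atLeast0)
  have re: "(\<Sum>i\<in>I. g i) = (\<Sum>j<card I. g (b j))" for g :: "'i \<Rightarrow> 'c::comm_monoid_add"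
    by (rule sum.reindex_bij_betw[OF b, symmetric])
  show ?thesis
    unfolding projective_norm_def
  proof (rule cInf_lower)
    show "bdd_below {(\<Sum>i<n. L1_norm M (x' i) * norm (y' i)) | (n::nat) x' y'.
      (\<forall>i<n. x' i \<in> L1 M) \<and> (\<Sum>i\<in>I. tensor (x i) (y i)) = (\<Sum>i<n. tensor (x' i) (y' i))}"
      by (intro bdd_belowI[of _ 0]) (auto intro!: sum_nonneg mult_nonneg_nonneg L1_norm_nonneg)
    have "b j \<in> I" if "j < card I" for j using b that by (auto simp: bij_betw_def)
    then show "(\<Sum>i\<in>I. L1_norm M (x i) * norm (y i)) \<in> {(\<Sum>i<n. L1_norm M (x' i) * norm (y' i)) | (n::nat) x' y'.
      (\<forall>i<n. x' i \<in> L1 M) \<and> (\<Sum>i\<in>I. tensor (x i) (y i)) = (\<Sum>i<n. tensor (x' i) (y' i))}"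
      using x unfolding re
      by (intro CollectI exI[of _ "card I"] exI[of _ "\<lambda>j. x (b j)"] exI[of _ "\<lambda>j. y (b j)"]) simp
  qed
qed

text \<open>For every representation the pointwise triangle inequality integrates to its
  cost.\<close>

lemma bochner_norm_le_projective_norm:
  fixes u :: "('w \<Rightarrow> real, 'y::real_normed_vector) tensor"
  assumes u: "u \<in> algebraic_tensor (L1 M)"
  shows "bochner_norm M (tensor_fun u) \<le> projective_norm (L1 M) (L1_norm M) u"
  unfolding projective_norm_def
proof (rule cInf_greatest)
  show "{(\<Sum>i<n. L1_norm M (x i) * norm (y i)) | (n::nat) x y.
      (\<forall>i<n. x i \<in> L1 M) \<and> u = (\<Sum>i<n. tensor (x i) (y i))} \<noteq> {}"
    using algebraic_tensor_representation[OF subspace_L1 u] by blast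
  fix r assume "r \<in> {(\<Sum>i<n. L1_norm M (x i) * norm (y i)) | (n::nat) x y.
      (\<forall>i<n. x i \<in> L1 M) \<and> u = (\<Sum>i<n. tensor (x i) (y i))}"
  then obtain n :: nat and x y where r: "r = (\<Sum>i<n. L1_norm M (x i) * norm (y i))"
    "\<And>i. i < n \<Longrightarrow> x i \<in> L1 M" "u = (\<Sum>i<n. tensor (x i) (y i))" by blast
  have "bochner_norm M (tensor_fun u) = (\<integral>t. norm (\<Sum>i<n. x i t *\<^sub>R y i) \<partial>M)"
    by (simp add: bochner_norm_def r(3) tensor_fun_sum)
  also have "\<dots> \<le> (\<integral>t. (\<Sum>i<n. \<bar>x i t\<bar> * norm (y i)) \<partial>M)"
  proof (rule integral_mono)
    show "integrable M (\<lambda>t. norm (\<Sum>i<n. x i t *\<^sub>R y i))"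
      using bochner_integrable_tensor_fun[OF u] unfolding bochner_integrable_def r(3) tensor_fun_sum by simp
    show "integrable M (\<lambda>t. \<Sum>i<n. \<bar>x i t\<bar> * norm (y i))"
      using r(2) by (intro Bochner_Integration.integrable_sum integrable_mult_left integrable_abs) (simp add: L1_def)
    show "norm (\<Sum>i<n. x i t *\<^sub>R y i) \<le> (\<Sum>i<n. \<bar>x i t\<bar> * norm (y i))" for t
      by (rule order_trans[OF norm_sum]) simp
  qed
  also have "\<dots> = (\<Sum>i<n. (\<integral>t. \<bar>x i t\<bar> * norm (y i) \<partial>M))"
    using r(2) by (intro Bochner_Integration.integral_sum integrable_mult_left integrable_abs) (simp add: L1_def)
  also have "\<dots> = r" unfolding r(1) L1_norm_def by simp
  finally show "bochner_norm M (tensor_fun u) \<le> r" .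
qed

section \<open>Simple functions and equality of the two norms\<close>

lemma integrable_simple_approx:
  fixes f :: "'w \<Rightarrow> real"
  assumes f: "integrable M f" and e: "0 < e"
  shows "\<exists>s. simple_function M s \<and> integrable M s \<and> (\<integral>t. \<bar>f t - s t\<bar> \<partial>M) < e"
proof -
  have fm: "f \<in> borel_measurable M" using f by simp
  obtain s where s': "(\<forall>i. simple_function M (s i)) \<and> (\<forall>t\<in>space M. (\<lambda>i. s i t) \<longlonglongrightarrow> f t) \<and>
      (\<forall>i. \<forall>t\<in>space M. dist (s i t) 0 \<le> 2 * dist (f t) 0)"
    using borel_measurable_implies_sequence_metric[OF fm, of 0] ..
  have s: "simple_function M (s i)" "t \<in> space M \<Longrightarrow> (\<lambda>i. s i t) \<longlonglongrightarrow> f t"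
    "t \<in> space M \<Longrightarrow> \<bar>s i t\<bar> \<le> 2 * \<bar>f t\<bar>" for i t
    using s' by simp_all
  have sm: "s i \<in> borel_measurable M" for i by (rule borel_measurable_simple_function[OF s(1)])
  have int: "integrable M (s i)" for i
  proof (rule Bochner_Integration.integrable_bound[of M "\<lambda>t. 2 * f t"])
    show "AE t in M. norm (s i t) \<le> norm (2 * f t)"
    proof (rule AE_I2)
      fix t assume "t \<in> space M"
      then show "norm (s i t) \<le> norm (2 * f t)" using s(3)[of t i] by simp
    qed
  qed (use f sm in simp_all)
  have "(\<lambda>i. \<integral>t. \<bar>f t - s i t\<bar> \<partial>M) \<longlonglongrightarrow> (\<integral>t. 0 \<partial>M)"
  \<comment> \<open>The factor 3 is 1 for \<open>f\<close> plus 2 from the bound on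
    \<open>s i\<close>.\<close>
  proof (rule integral_dominated_convergence[where w = "\<lambda>t. 3 * \<bar>f t\<bar>"])
    show "AE t in M. (\<lambda>i. \<bar>f t - s i t\<bar>) \<longlonglongrightarrow> 0"
    proof (rule AE_I2)
      fix t assume "t \<in> space M"
      then show "(\<lambda>i. \<bar>f t - s i t\<bar>) \<longlonglongrightarrow> 0"
        using tendsto_rabs[OF tendsto_diff[OF tendsto_const s(2)], of t "f t"] by simp
    qed
    show "AE t in M. norm \<bar>f t - s i t\<bar> \<le> 3 * \<bar>f t\<bar>" for i
    proof (rule AE_I2)
      fix t assume "t \<in> space M"
      then show "norm \<bar>f t - s i t\<bar> \<le> 3 * \<bar>f t\<bar>" using s(3)[of t i] by simp
    qed
  qed (use f sm in \<open>auto intro: borel_measurable_abs\<close>)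
  then have "\<forall>\<^sub>F i in sequentially. (\<integral>t. \<bar>f t - s i t\<bar> \<partial>M) < e"
    using e by (intro order_tendstoD(2)) simp_all
  then obtain i where "(\<integral>t. \<bar>f t - s i t\<bar> \<partial>M) < e" by (auto simp: eventually_sequentially)
  then show ?thesis using s(1) int by blast
qed

text \<open>At each point at most one summand is nonzero, so nothing cancels and the cost of the
  representation is exactly the integral of the norm.\<close>

lemma bochner_norm_disjoint:
  fixes y :: "'i \<Rightarrow> 'y::real_normed_vector" and A :: "'i \<Rightarrow> 'w set"
  assumes I: "finite I" and A: "\<And>i. i \<in> I \<Longrightarrow> integrable M (indicat_real (A i))"
    and disj: "disjoint_family_on A I"
  shows "bochner_norm M (\<lambda>t. \<Sum>i\<in>I. indicat_real (A i) t *\<^sub>R y i)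
    = (\<Sum>i\<in>I. L1_norm M (indicat_real (A i)) * norm (y i))"
proof -
  have "norm (\<Sum>i\<in>I. indicat_real (A i) t *\<^sub>R y i) = (\<Sum>i\<in>I. indicat_real (A i) t * norm (y i))" for t
  proof (cases "\<exists>i\<in>I. t \<in> A i")
    case True
    then obtain i where i: "i \<in> I" "t \<in> A i" by blast
    have ind: "indicat_real (A j) t = (if j = i then 1 else 0)" if "j \<in> I" for j
      using disjoint_family_onD[OF disj that i(1)] i(2) by (auto simp: indicator_def)
    have "(\<Sum>j\<in>I. indicat_real (A j) t *\<^sub>R y j) = (\<Sum>j\<in>I. if j = i then y j else 0)"
      by (intro sum.cong) (simp_all add: ind)
    moreover have "(\<Sum>j\<in>I. indicat_real (A j) t * norm (y j)) = (\<Sum>j\<in>I. if j = i then norm (y j) else 0)"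
      by (intro sum.cong) (simp_all add: ind)
    ultimately show ?thesis using I i(1) by simp
  next
    case False
    then show ?thesis by simp
  qed
  then have "bochner_norm M (\<lambda>t. \<Sum>i\<in>I. indicat_real (A i) t *\<^sub>R y i)
      = (\<integral>t. (\<Sum>i\<in>I. indicat_real (A i) t * norm (y i)) \<partial>M)" by (simp add: bochner_norm_def)
  also have "\<dots> = (\<Sum>i\<in>I. (\<integral>t. indicat_real (A i) t * norm (y i) \<partial>M))"
    using A by (intro Bochner_Integration.integral_sum integrable_mult_left) simp
  also have "\<dots> = (\<Sum>i\<in>I. L1_norm M (indicat_real (A i)) * norm (y i))"
    by (simp add: L1_norm_def)
  finally show ?thesis .
qed

text \<open>Two representations are joined over the disjoint sum of their index sets, which is the
  triangle inequality expressed in costs.\<close>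

lemma projective_norm_add_le:
  fixes y :: "'i \<Rightarrow> 'y::real_normed_vector" and z :: "'j \<Rightarrow> 'y"
  assumes I: "finite I" "\<And>i. i \<in> I \<Longrightarrow> x i \<in> L1 M" and J: "finite J" "\<And>j. j \<in> J \<Longrightarrow> w j \<in> L1 M"
  shows "projective_norm (L1 M) (L1_norm M) ((\<Sum>i\<in>I. tensor (x i) (y i)) + (\<Sum>j\<in>J. tensor (w j) (z j)))
    \<le> (\<Sum>i\<in>I. L1_norm M (x i) * norm (y i)) + (\<Sum>j\<in>J. L1_norm M (w j) * norm (z j))"
proof -
  have "case_sum x w i \<in> L1 M" if "i \<in> I <+> J" for i using that I J by auto
  from projective_norm_le_sum[of "I <+> J" "case_sum x w" M "case_sum y z", OF _ this]
  show ?thesis using I J by (simp add: sum.Plus comp_def)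
qed

text \<open>
  Simple functions \<open>s 0, \<dots>, s (n - 1)\<close> are constant on the level sets of the list-valued
  function \<open>t \<mapsto> [s 0 t, \<dots>, s (n - 1) t]\<close>.
\<close>

lemma simple_functions_common_partition:
  fixes s :: "nat \<Rightarrow> 'w \<Rightarrow> real"
  assumes s: "\<And>i. i < n \<Longrightarrow> simple_function M (s i)" "\<And>i. i < n \<Longrightarrow> integrable M (s i)"
  shows "\<exists>(W :: real list set) A. finite W \<and> disjoint_family_on A W \<and>
    (\<forall>a\<in>W. integrable M (indicat_real (A a))) \<and>
    (\<forall>i<n. \<forall>t\<in>space M. s i t = (\<Sum>a\<in>W. indicat_real (A a) t * a ! i))"
proof -
  define l where "l t = map (\<lambda>i. s i t) [0..<n]" for t
  \<comment> \<open>The list of zeros is left out because its level set may have infinite measure.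
    On every other level set some integrable \<open>s i\<close> is a nonzero constant.\<close>
  define W where "W = {a \<in> l ` space M. \<exists>i<n. a ! i \<noteq> 0}"
  define A where "A a = {t \<in> space M. l t = a}" for a
  have "l ` space M \<subseteq> {a. set a \<subseteq> (\<Union>i<n. s i ` space M) \<and> length a = n}"
    by (force simp: l_def)
  moreover have "finite (\<Union>i<n. s i ` space M)" using s(1) by (auto dest: simple_functionD)
  ultimately have "finite (l ` space M)" by (rule finite_subset[OF _ finite_lists_length_eq])
  then have "finite W" by (simp add: W_def)
  moreover have "disjoint_family_on A W" by (auto simp: disjoint_family_on_def A_def)
  moreover have "integrable M (indicat_real (A a))" if "a \<in> W" for a
  proof -
    obtain i where i: "i < n" "a ! i \<noteq> 0" and len: "length a = n"
      using \<open>a \<in> W\<close> unfolding W_def l_def by auto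
    have A_eq: "A a = (\<Inter>j\<in>{..<n}. s j -` {a ! j} \<inter> space M)"
      using len i(1) by (auto simp: A_def l_def list_eq_iff_nth_eq)
    have A_sets: "A a \<in> sets M"
      unfolding A_eq by (rule sets.finite_INT) (use i(1) simple_functionD(2)[OF s(1)] in auto)
    show ?thesis
    proof (rule Bochner_Integration.integrable_bound[of M "\<lambda>t. s i t / a ! i"])
      show "integrable M (\<lambda>t. s i t / a ! i)" using s(2)[OF i(1)] by simp
      show "indicat_real (A a) \<in> borel_measurable M" using A_sets by simp
      have "norm (indicat_real (A a) t) \<le> norm (s i t / a ! i)" for t
        using i by (auto simp: A_def l_def indicator_def)
      then show "AE t in M. norm (indicat_real (A a) t) \<le> norm (s i t / a ! i)" by simp
    qed
  qed
  moreover have "s i t = (\<Sum>a\<in>W. indicat_real (A a) t * a ! i)" if i: "i < n" and t: "t \<in> space M" for i t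
  proof -
    have "indicat_real (A a) t * a ! i = (if a = l t then s i t else 0)" for a
      using i t by (auto simp: A_def indicator_def l_def)
    then have "(\<Sum>a\<in>W. indicat_real (A a) t * a ! i) = (\<Sum>a\<in>W. if a = l t then s i t else 0)"
      by (intro sum.cong refl)
    then have "(\<Sum>a\<in>W. indicat_real (A a) t * a ! i) = (if l t \<in> W then s i t else 0)"
      unfolding sum.delta[OF \<open>finite W\<close>] .
    moreover have "s i t = 0" if "l t \<notin> W"
    proof -
      have "l t ! i = 0" using that i t unfolding W_def by blast
      then show ?thesis using i by (simp add: l_def)
    qed
    ultimately show ?thesis by (cases "l t \<in> W") simp_all
  qed
  ultimately show ?thesis by blast
qed

text \<open>Simple coefficients approximate the given ones at small cost. The resulting tensor is
  regrouped over disjoint sets, where cost and integral agree.\<close>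

theorem projective_norm_eq_bochner_norm:
  fixes u :: "('w \<Rightarrow> real, 'y::real_normed_vector) tensor"
  assumes u: "u \<in> algebraic_tensor (L1 M)"
  shows "projective_norm (L1 M) (L1_norm M) u = bochner_norm M (tensor_fun u)"
proof (rule antisym[OF _ bochner_norm_le_projective_norm[OF u]], rule field_le_epsilon)
  fix e :: real assume e: "0 < e"
  obtain n :: nat and x y where x: "\<forall>i<n. x i \<in> L1 M" and u_eq: "u = (\<Sum>i<n. tensor (x i) (y i))"
    using algebraic_tensor_representation[OF subspace_L1 u] by blast
  \<comment> \<open>The error counts twice, once in the projective norm and once in comparing the
    integrals of the norms; the \<open>+ 1\<close> prevents division by 0.\<close>
  define d where "d = e / (2 * (\<Sum>i<n. norm (y i)) + 1)"
  have d: "0 < d" "2 * (\<Sum>i<n. d * norm (y i)) \<le> e"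
  proof -
    have nn: "0 \<le> (\<Sum>i<n. norm (y i))" by (intro sum_nonneg) simp
    then show "0 < d" using e by (simp add: d_def)
    have "2 * (\<Sum>i<n. d * norm (y i)) = d * (2 * (\<Sum>i<n. norm (y i)))" by (simp add: sum_distrib_left algebra_simps)
    also have "\<dots> \<le> d * (2 * (\<Sum>i<n. norm (y i)) + 1)" using \<open>0 < d\<close> by (intro mult_left_mono) auto
    also have "\<dots> = e" unfolding d_def using nn by simp
    finally show "2 * (\<Sum>i<n. d * norm (y i)) \<le> e" .
  qed
  have "\<forall>i. \<exists>s. i < n \<longrightarrow> simple_function M s \<and> integrable M s \<and> (\<integral>t. \<bar>x i t - s t\<bar> \<partial>M) < d"
    using integrable_simple_approx[OF _ d(1)] x unfolding L1_def by blast
  from choice[OF this] obtain s where s: "\<forall>i. i < n \<longrightarrow> simple_function M (s i) \<and> integrable M (s i) \<and>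
    (\<integral>t. \<bar>x i t - s i t\<bar> \<partial>M) < d" ..
  have "\<exists>(W :: real list set) A. finite W \<and> disjoint_family_on A W \<and>
    (\<forall>a\<in>W. integrable M (indicat_real (A a))) \<and>
    (\<forall>i<n. \<forall>t\<in>space M. s i t = (\<Sum>a\<in>W. indicat_real (A a) t * a ! i))"
    by (rule simple_functions_common_partition) (use s in auto)
  then obtain W :: "real list set" and A where W: "finite W" "disjoint_family_on A W"
    and A: "\<forall>a\<in>W. integrable M (indicat_real (A a))"
    and sW: "\<forall>i<n. \<forall>t\<in>space M. s i t = (\<Sum>a\<in>W. indicat_real (A a) t * a ! i)"
    by (elim exE conjE) (rule that)
  \<comment> \<open>\<open>r i\<close> agrees with \<open>s i\<close> on \<open>space M\<close> and
    is a combination of indicators on the whole type, so the tensor identity \<open>v_eq\<close> is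
    exact.\<close>
  define r where "r i = (\<Sum>a\<in>W. (a ! i) *\<^sub>R indicat_real (A a))" for i
  have r_apply: "r i t = (\<Sum>a\<in>W. indicat_real (A a) t * a ! i)" for i t
    unfolding r_def sum_fun_apply by (intro sum.cong) (simp_all only: scaleR_fun_def real_scaleR_def mult.commute)
  have r_L1: "r i \<in> L1 M" for i
    unfolding r_def using A by (intro subspace_sum[OF subspace_L1] subspace_scale[OF subspace_L1]) (simp add: L1_def)
  define z where "z a = (\<Sum>i<n. (a ! i) *\<^sub>R y i)" for a
  define v where "v = (\<Sum>i<n. tensor (r i) (y i))"
  have v_eq: "v = (\<Sum>a\<in>W. tensor (indicat_real (A a)) (z a))"
  proof -
    have "v = (\<Sum>i<n. \<Sum>a\<in>W. tensor (indicat_real (A a)) ((a ! i) *\<^sub>R y i))"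
      unfolding v_def r_def tensor_sum_left tensor_scaleR_left tensor_scaleR_right ..
    also have "\<dots> = (\<Sum>a\<in>W. \<Sum>i<n. tensor (indicat_real (A a)) ((a ! i) *\<^sub>R y i))" by (rule sum.swap)
    finally show ?thesis unfolding z_def tensor_sum_right .
  qed
  have v_mem: "v \<in> algebraic_tensor (L1 M)"
    unfolding v_def
    by (intro subspace_sum[OF subspace_algebraic_tensor] tensor_in_algebraic_tensor r_L1)
  have diff_L1: "x i - r i \<in> L1 M" if "i < n" for i
    using subspace_diff[OF subspace_L1 _ r_L1] x that by blast
  have uv: "u - v = (\<Sum>i<n. tensor (x i - r i) (y i))"
    unfolding u_eq v_def by (simp add: tensor_diff_left sum_subtractf)
  have small: "(\<Sum>i<n. L1_norm M (x i - r i) * norm (y i)) \<le> (\<Sum>i<n. d * norm (y i))"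
  proof (intro sum_mono mult_right_mono norm_ge_zero)
    fix i assume "i \<in> {..<n}"
    then have i: "i < n" by simp
    have "L1_norm M (x i - r i) = (\<integral>t. \<bar>x i t - s i t\<bar> \<partial>M)"
      unfolding L1_norm_def using sW i by (intro Bochner_Integration.integral_cong) (simp_all add: r_apply)
    then show "L1_norm M (x i - r i) \<le> d" using s i by (simp add: less_imp_le)
  qed
  have "projective_norm (L1 M) (L1_norm M) u
      \<le> (\<Sum>i<n. L1_norm M (x i - r i) * norm (y i)) + (\<Sum>a\<in>W. L1_norm M (indicat_real (A a)) * norm (z a))"
    using projective_norm_add_le[of "{..<n}" "\<lambda>i. x i - r i" M W "\<lambda>a. indicat_real (A a)" y z] diff_L1 W(1) A
    unfolding uv[symmetric] v_eq[symmetric] by (simp add: L1_def)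
  also have "(\<Sum>a\<in>W. L1_norm M (indicat_real (A a)) * norm (z a)) = bochner_norm M (tensor_fun v)"
    unfolding v_eq tensor_fun_sum[abs_def] by (rule bochner_norm_disjoint[symmetric]) (use W A in auto)
  also have "bochner_norm M (tensor_fun v) \<le> bochner_norm M (tensor_fun u) + bochner_norm M (tensor_fun (u - v))"
    using bochner_norm_abs_diff[OF bochner_integrable_tensor_fun[OF u] bochner_integrable_tensor_fun[OF v_mem]]
    by (simp add: tensor_fun_diff[OF u v_mem, abs_def])
  also have "bochner_norm M (tensor_fun (u - v)) \<le> projective_norm (L1 M) (L1_norm M) (u - v)"
    by (intro bochner_norm_le_projective_norm subspace_diff[OF subspace_algebraic_tensor] u v_mem)
  also have "\<dots> \<le> (\<Sum>i<n. L1_norm M (x i - r i) * norm (y i))"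
    unfolding uv using diff_L1 by (intro projective_norm_le_sum) auto
  finally show "projective_norm (L1 M) (L1_norm M) u \<le> bochner_norm M (tensor_fun u) + e"
    using small d(2) by linarith
qed

text \<open>Each value is replaced by the nearest among finitely many points of a sequence dense in
  the range and containing 0; the error tends to 0 and is dominated by
  \<open>norm (f t)\<close>.\<close>

theorem bochner_dense:
  fixes f :: "'w \<Rightarrow> 'y::real_normed_vector"
  assumes f: "bochner_integrable M f" and e: "0 < e"
  shows "\<exists>v\<in>algebraic_tensor (L1 M). bochner_norm M (\<lambda>t. tensor_fun v t - f t) < e"
proof -
  have fs: "strongly_measurable M f" and fint: "integrable M (\<lambda>t. norm (f t))"
    using f by (simp_all add: bochner_integrable_def)
  obtain D where D: "countable D" "f ` space M \<subseteq> closure D"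
    using fs unfolding strongly_measurable_def by blast
  define c where "c = from_nat_into (insert 0 D)"
  have c_surj: "\<exists>j. c j = d" if "d \<in> insert 0 D" for d
    using from_nat_into_surj[of "insert 0 D" d] D(1) that unfolding c_def by auto
  obtain j0 where j0: "c j0 = 0" using c_surj by blast
  \<comment> \<open>The offset \<open>j0\<close> keeps 0 among the candidates at every stage, which
    gives the domination.\<close>
  define K where "K k t = (LEAST j. j \<le> j0 + k \<and> (\<forall>i\<le>j0 + k. norm (f t - c j) \<le> norm (f t - c i)))" for k t
  have K: "K k t \<le> j0 + k \<and> (\<forall>i\<le>j0 + k. norm (f t - c (K k t)) \<le> norm (f t - c i))" for k t
    unfolding K_def
  proof (rule LeastI_ex)
    have "finite ((\<lambda>i. norm (f t - c i)) ` {..j0 + k})" "(\<lambda>i. norm (f t - c i)) ` {..j0 + k} \<noteq> {}" by auto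
    from Min_in[OF this] Min_le[OF this(1)]
    show "\<exists>j. j \<le> j0 + k \<and> (\<forall>i\<le>j0 + k. norm (f t - c j) \<le> norm (f t - c i))" by fastforce
  qed
  have fc: "(\<lambda>t. norm (f t - c i)) \<in> borel_measurable M" for i
    by (intro borel_measurable_norm_strongly strongly_measurable_diff fs strongly_measurable_const)
  have K_meas: "K k \<in> measurable M (count_space UNIV)" for k
  proof -
    note [measurable] = fc
    show ?thesis unfolding K_def by measurable
  qed
  define A where "A k j = {t \<in> space M. K k t = j}" for k j
  have A: "A k j \<in> sets M" for k j
  proof -
    have "K k -` {j} \<inter> space M \<in> sets M" by (rule measurable_sets[OF K_meas]) simp
    moreover have "K k -` {j} \<inter> space M = A k j" by (auto simp: A_def)
    ultimately show ?thesis by simp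
  qed
  \<comment> \<open>The value 0 is dropped because its level set may have infinite measure. Where
    \<open>c j\<close> is selected, \<open>norm (c j) \<le> 2 * norm (f t)\<close>, so for
    \<open>c j \<noteq> 0\<close> the indicator is integrable.\<close>
  define I where "I k = {j. j \<le> j0 + k \<and> c j \<noteq> 0}" for k
  have I: "finite (I k)" for k unfolding I_def by (rule finite_subset[of _ "{..j0 + k}"]) auto
  have ff: "norm (f t - c (K k t)) \<le> norm (f t)" for k t using K[of k t, THEN conjunct2, rule_format, of j0] j0 by simp
  have A_int: "integrable M (indicat_real (A k j))" if "j \<in> I k" for k j
  proof (rule Bochner_Integration.integrable_bound[of M "\<lambda>t. 2 * norm (f t) / norm (c j)"])
    have "norm (indicat_real (A k j) t) \<le> norm (2 * norm (f t) / norm (c j))" for t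
    proof (cases "t \<in> A k j")
      case True
      then have "norm (c j) \<le> norm (f t) + norm (f t - c j)" by (metis norm_minus_commute norm_triangle_sub)
      then show ?thesis using True ff[of t k] that by (simp add: A_def I_def)
    qed simp
    then show "AE t in M. norm (indicat_real (A k j) t) \<le> norm (2 * norm (f t) / norm (c j))" by simp
  qed (use fint A in auto)
  define v where "v k = (\<Sum>j\<in>I k. tensor (indicat_real (A k j)) (c j))" for k
  have v_mem: "v k \<in> algebraic_tensor (L1 M)" for k
    unfolding v_def
    by (intro subspace_sum[OF subspace_algebraic_tensor] tensor_in_algebraic_tensor) (simp add: L1_def A_int)
  have v_fun: "tensor_fun (v k) t = c (K k t)" if t: "t \<in> space M" for k t
  proof -
    have "tensor_fun (v k) t = (\<Sum>j\<in>I k. if j = K k t then c j else 0)"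
      unfolding v_def tensor_fun_sum using t by (intro sum.cong) (auto simp: A_def indicator_def)
    also have "\<dots> = c (K k t)" using I K[of k t] by (auto simp: I_def)
    finally show ?thesis .
  qed
  have "(\<lambda>k. \<integral>t. norm (tensor_fun (v k) t - f t) \<partial>M) \<longlonglongrightarrow> (\<integral>t. 0 \<partial>M)"
  proof (rule integral_dominated_convergence[where w = "\<lambda>t. norm (f t)"])
    show "(\<lambda>t. norm (tensor_fun (v k) t - f t)) \<in> borel_measurable M" for k
      using bochner_integrable_diff[OF bochner_integrable_tensor_fun[OF v_mem] f]
      by (intro borel_measurable_norm_strongly) (simp add: bochner_integrable_def)
    show "AE t in M. norm (norm (tensor_fun (v k) t - f t)) \<le> norm (f t)" for k
      using ff[of _ k] by (intro AE_I2) (simp add: v_fun norm_minus_commute)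
    show "AE t in M. (\<lambda>k. norm (tensor_fun (v k) t - f t)) \<longlonglongrightarrow> 0"
    proof (rule AE_I2, rule LIMSEQ_I)
      fix t and r :: real assume t: "t \<in> space M" and r: "0 < r"
      have "f t \<in> closure D" using t D(2) by blast
      then obtain d where d: "d \<in> D" "dist d (f t) < r" using r unfolding closure_approachable by blast
      then obtain j where j: "c j = d" using c_surj[of d] by auto
      have "norm (norm (tensor_fun (v k) t - f t) - 0) < r" if "j \<le> k" for k
      proof -
        have "norm (f t - c (K k t)) \<le> norm (f t - c j)" using K[of k t] that by simp
        then show ?thesis using d(2) j t by (simp add: v_fun dist_norm norm_minus_commute)
      qed
      then show "\<exists>k0. \<forall>k\<ge>k0. norm (norm (tensor_fun (v k) t - f t) - 0) < r" by blast
    qed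
  qed (use fint in simp_all)
  then have "\<forall>\<^sub>F k in sequentially. (\<integral>t. norm (tensor_fun (v k) t - f t) \<partial>M) < e"
    using e by (intro order_tendstoD(2)) simp_all
  then obtain k where "(\<integral>t. norm (tensor_fun (v k) t - f t) \<partial>M) < e" by (auto simp: eventually_sequentially)
  then show ?thesis using v_mem unfolding bochner_norm_def by blast
qed

section \<open>Norm-attaining tensors\<close>

abbreviation (input) pnorm :: "'w measure \<Rightarrow> ('w \<Rightarrow> real, 'y::real_normed_vector) tensor \<Rightarrow> real"
  where "pnorm M \<equiv> projective_norm (L1 M) (L1_norm M)"

lemma projective_norm_diff:
  assumes "u \<in> algebraic_tensor (L1 M)" "v \<in> algebraic_tensor (L1 M)"
  shows "pnorm M (u - v) = bochner_norm M (\<lambda>t. tensor_fun u t - tensor_fun v t)"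
  using assms
  by (simp add: projective_norm_eq_bochner_norm subspace_diff[OF subspace_algebraic_tensor]
      tensor_fun_diff[OF assms, abs_def])

text \<open>
  The class of a Cauchy sequence of tensors consists of the sequences whose functions have the
  same limit \<open>g\<close> in \<open>L\<^sub>1(\<mu>, Y)\<close>.
\<close>

definition tensor_class :: "'w measure \<Rightarrow> ('w \<Rightarrow> 'y::real_normed_vector) \<Rightarrow> (nat \<Rightarrow> ('w \<Rightarrow> real, 'y) tensor) set"
  where "tensor_class M g = {v. range v \<subseteq> algebraic_tensor (L1 M) \<and>
    (\<lambda>n. bochner_norm M (\<lambda>t. tensor_fun (v n) t - g t)) \<longlonglongrightarrow> 0}"

lemma tensor_class_Cauchy:
  assumes g: "bochner_integrable M g" and v: "v \<in> tensor_class M g"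
  shows "v \<in> Cauchy_sequences (algebraic_tensor (L1 M)) (pnorm M)"
proof -
  have vA: "v n \<in> algebraic_tensor (L1 M)" for n using v by (auto simp: tensor_class_def)
  have "\<exists>N. \<forall>m\<ge>N. \<forall>n\<ge>N. pnorm M (v m - v n) < e" if e: "0 < e" for e
  proof -
    have "\<forall>\<^sub>F n in sequentially. bochner_norm M (\<lambda>t. tensor_fun (v n) t - g t) < e / 2"
      using v e by (intro order_tendstoD(2)[of _ 0]) (auto simp: tensor_class_def)
    then obtain N where N: "\<forall>n\<ge>N. bochner_norm M (\<lambda>t. tensor_fun (v n) t - g t) < e / 2"
      by (auto simp: eventually_sequentially)
    have "pnorm M (v m - v n) < e" if "N \<le> m" "N \<le> n" for m n
      using bochner_norm_triangle[OF bochner_integrable_tensor_fun[OF vA[of m]] g bochner_integrable_tensor_fun[OF vA[of n]]]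
        bochner_norm_diff_commute[of M g "tensor_fun (v n)"]
        N[rule_format, OF that(1)] N[rule_format, OF that(2)]
      by (simp add: projective_norm_diff[OF vA vA])
    then show ?thesis by blast
  qed
  then show ?thesis using vA by (auto simp: Cauchy_sequences_def)
qed

text \<open>The left side is the class of \<open>u\<close> in the completion. By the triangle
  inequality, vanishing projective distance from \<open>u\<close> means convergence of the functions
  to the same \<open>g\<close>.\<close>

lemma tensor_class_eq:
  assumes g: "bochner_integrable M g" and u: "u \<in> tensor_class M g"
  shows "{v \<in> Cauchy_sequences (algebraic_tensor (L1 M)) (pnorm M). (\<lambda>n. pnorm M (u n - v n)) \<longlonglongrightarrow> 0}
    = tensor_class M g"
proof (intro set_eqI iffI)
  have uA: "u n \<in> algebraic_tensor (L1 M)" for n using u by (auto simp: tensor_class_def)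
  have ub: "bochner_integrable M (tensor_fun (u n))" for n by (rule bochner_integrable_tensor_fun[OF uA])
  have ug: "(\<lambda>n. bochner_norm M (\<lambda>t. tensor_fun (u n) t - g t)) \<longlonglongrightarrow> 0"
    using u by (simp add: tensor_class_def)
  fix v
  {
    assume "v \<in> {v \<in> Cauchy_sequences (algebraic_tensor (L1 M)) (pnorm M). (\<lambda>n. pnorm M (u n - v n)) \<longlonglongrightarrow> 0}"
    then have v: "v \<in> Cauchy_sequences (algebraic_tensor (L1 M)) (pnorm M)"
      and lim: "(\<lambda>n. pnorm M (u n - v n)) \<longlonglongrightarrow> 0" by simp_all
    from v have vA: "v n \<in> algebraic_tensor (L1 M)" for n by (auto simp: Cauchy_sequences_def)
    have "(\<lambda>n. bochner_norm M (\<lambda>t. tensor_fun (v n) t - g t)) \<longlonglongrightarrow> 0"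
    proof (rule tendsto_sandwich[OF _ _ tendsto_const])
      show "(\<lambda>n. pnorm M (u n - v n) + bochner_norm M (\<lambda>t. tensor_fun (u n) t - g t)) \<longlonglongrightarrow> 0"
        using tendsto_add[OF lim ug] by simp
      have "bochner_norm M (\<lambda>t. tensor_fun (v n) t - g t)
          \<le> pnorm M (u n - v n) + bochner_norm M (\<lambda>t. tensor_fun (u n) t - g t)" for n
        using bochner_norm_triangle[OF bochner_integrable_tensor_fun[OF vA[of n]] ub[of n] g]
          bochner_norm_diff_commute[of M "tensor_fun (v n)" "tensor_fun (u n)"]
        by (simp add: projective_norm_diff[OF uA vA])
      then show "\<forall>\<^sub>F n in sequentially. bochner_norm M (\<lambda>t. tensor_fun (v n) t - g t)
          \<le> pnorm M (u n - v n) + bochner_norm M (\<lambda>t. tensor_fun (u n) t - g t)" by simp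
    qed (simp add: bochner_norm_nonneg)
    then show "v \<in> tensor_class M g" using vA by (auto simp: tensor_class_def)
  next
    assume v: "v \<in> tensor_class M g"
    then have vA: "v n \<in> algebraic_tensor (L1 M)"
      and vg: "(\<lambda>n. bochner_norm M (\<lambda>t. tensor_fun (v n) t - g t)) \<longlonglongrightarrow> 0" for n
      by (auto simp: tensor_class_def)
    have "(\<lambda>n. pnorm M (u n - v n)) \<longlonglongrightarrow> 0"
    proof (rule tendsto_sandwich[OF _ _ tendsto_const])
      show "(\<lambda>n. bochner_norm M (\<lambda>t. tensor_fun (u n) t - g t)
          + bochner_norm M (\<lambda>t. tensor_fun (v n) t - g t)) \<longlonglongrightarrow> 0"
        using tendsto_add[OF ug vg] by simp
      have "pnorm M (u n - v n) \<le> bochner_norm M (\<lambda>t. tensor_fun (u n) t - g t)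
          + bochner_norm M (\<lambda>t. tensor_fun (v n) t - g t)" for n
        using bochner_norm_triangle[OF ub[of n] g bochner_integrable_tensor_fun[OF vA[of n]]]
          bochner_norm_diff_commute[of M g "tensor_fun (v n)"]
        by (simp add: projective_norm_diff[OF uA vA])
      then show "\<forall>\<^sub>F n in sequentially. pnorm M (u n - v n) \<le> bochner_norm M (\<lambda>t. tensor_fun (u n) t - g t)
          + bochner_norm M (\<lambda>t. tensor_fun (v n) t - g t)" by simp
    qed (simp add: projective_norm_diff[OF uA vA] bochner_norm_nonneg)
    then show "v \<in> {v \<in> Cauchy_sequences (algebraic_tensor (L1 M)) (pnorm M). (\<lambda>n. pnorm M (u n - v n)) \<longlonglongrightarrow> 0}"
      using tensor_class_Cauchy[OF g v] by simp
  }
qed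

lemma tensor_class_nonempty:
  assumes g: "bochner_integrable M g"
  shows "\<exists>v. v \<in> tensor_class M g"
proof -
  have "\<forall>n. \<exists>v. v \<in> algebraic_tensor (L1 M) \<and> bochner_norm M (\<lambda>t. tensor_fun v t - g t) < 1 / real (Suc n)"
    using bochner_dense[OF g] by (simp add: Bex_def)
  from choice[OF this] obtain v where v: "\<forall>n. v n \<in> algebraic_tensor (L1 M) \<and>
    bochner_norm M (\<lambda>t. tensor_fun (v n) t - g t) < 1 / real (Suc n)" ..
  have "(\<lambda>n. bochner_norm M (\<lambda>t. tensor_fun (v n) t - g t)) \<longlonglongrightarrow> 0"
  proof (rule tendsto_sandwich[OF _ _ tendsto_const LIMSEQ_Suc[OF lim_1_over_n]])
    show "\<forall>\<^sub>F n in sequentially. bochner_norm M (\<lambda>t. tensor_fun (v n) t - g t) \<le> 1 / real (Suc n)"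
      using v by (simp add: less_imp_le)
  qed (simp add: bochner_norm_nonneg)
  then show ?thesis using v by (auto simp: tensor_class_def)
qed

lemma tensor_class_in_projective_tensor:
  fixes g :: "'w \<Rightarrow> 'y::real_normed_vector"
  assumes g: "bochner_integrable M g"
  shows "tensor_class M g \<in> projective_tensor (L1 M) (L1_norm M) TYPE('y)"
proof -
  obtain u where u: "u \<in> tensor_class M g" using tensor_class_nonempty[OF g] ..
  let ?C = "Cauchy_sequences (algebraic_tensor (L1 M)) (pnorm M) :: (nat \<Rightarrow> ('w \<Rightarrow> real, 'y) tensor) set"
  have "{(u, v). u \<in> ?C \<and> v \<in> ?C \<and> (\<lambda>n. pnorm M (u n - v n)) \<longlonglongrightarrow> 0} `` {u}
      \<in> projective_tensor (L1 M) (L1_norm M) TYPE('y)"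
    unfolding projective_tensor_def completion_def
    by (rule quotientI[OF tensor_class_Cauchy[OF g u]])
  moreover have "{(u, v). u \<in> ?C \<and> v \<in> ?C \<and> (\<lambda>n. pnorm M (u n - v n)) \<longlonglongrightarrow> 0} `` {u}
      = {v \<in> ?C. (\<lambda>n. pnorm M (u n - v n)) \<longlonglongrightarrow> 0}"
    using tensor_class_Cauchy[OF g u] by auto
  ultimately show ?thesis by (simp only: tensor_class_eq[OF g u])
qed

text \<open>All representatives have norms tending to that of \<open>g\<close>; since the class is
  nonempty, the limit is determined.\<close>

lemma completion_norm_tensor_class:
  assumes g: "bochner_integrable M g"
  shows "completion_norm (pnorm M) (tensor_class M g) = bochner_norm M g"
  unfolding completion_norm_def
proof (rule the_equality)
  have lim: "(\<lambda>n. pnorm M (v n)) \<longlonglongrightarrow> bochner_norm M g" if "v \<in> tensor_class M g" for v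
  proof -
    have v: "v n \<in> algebraic_tensor (L1 M)" "(\<lambda>n. bochner_norm M (\<lambda>t. tensor_fun (v n) t - g t)) \<longlonglongrightarrow> 0" for n
      using that by (auto simp: tensor_class_def)
    show ?thesis
      unfolding projective_norm_eq_bochner_norm[OF v(1)]
      by (rule tendsto_bochner_norm[OF bochner_integrable_tensor_fun[OF v(1)] g v(2)])
  qed
  then show "\<forall>v\<in>tensor_class M g. (\<lambda>n. pnorm M (v n)) \<longlonglongrightarrow> bochner_norm M g" by blast
  fix r assume r: "\<forall>v\<in>tensor_class M g. (\<lambda>n. pnorm M (v n)) \<longlonglongrightarrow> r"
  obtain u where "u \<in> tensor_class M g" using tensor_class_nonempty[OF g] ..
  then show "r = bochner_norm M g" using r lim LIMSEQ_unique by blast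
qed

text \<open>Equality of the norms turns a Cauchy sequence of tensors into one of functions, and
  completeness supplies its limit \<open>g\<close>.\<close>

lemma projective_tensor_eq_tensor_class:
  fixes U :: "(nat \<Rightarrow> ('w \<Rightarrow> real, 'y::banach) tensor) set"
  assumes U: "U \<in> projective_tensor (L1 M) (L1_norm M) TYPE('y)"
  shows "\<exists>g. bochner_integrable M g \<and> U = tensor_class M g"
proof -
  let ?C = "Cauchy_sequences (algebraic_tensor (L1 M)) (pnorm M) :: (nat \<Rightarrow> ('w \<Rightarrow> real, 'y) tensor) set"
  obtain u where u: "u \<in> ?C" and U_eq: "U = {v \<in> ?C. (\<lambda>n. pnorm M (u n - v n)) \<longlonglongrightarrow> 0}"
    using U unfolding projective_tensor_def completion_def by (auto elim!: quotientE)
  have uA: "u n \<in> algebraic_tensor (L1 M)" for n using u by (auto simp: Cauchy_sequences_def)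
  have "\<exists>N. \<forall>m\<ge>N. \<forall>n\<ge>N. bochner_norm M (\<lambda>t. tensor_fun (u m) t - tensor_fun (u n) t) < e" if "0 < e" for e
    using u that unfolding Cauchy_sequences_def by (simp add: projective_norm_diff[OF uA uA])
  from bochner_complete[OF bochner_integrable_tensor_fun[OF uA] this]
  obtain g where g: "bochner_integrable M g"
    and ug: "(\<lambda>n. bochner_norm M (\<lambda>t. tensor_fun (u n) t - g t)) \<longlonglongrightarrow> 0" by blast
  have "u \<in> tensor_class M g" using uA ug by (auto simp: tensor_class_def)
  then show ?thesis using g tensor_class_eq[OF g] U_eq by blast
qed

text \<open>Applying \<open>Q\<close> to the vectors of a tensor composes its function with
  \<open>Q\<close>, and a contraction does not increase pointwise distances.\<close>

lemma bochner_norm_sum_tensor_le: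
  fixes Q :: "'x::real_normed_vector \<Rightarrow> 'y::real_normed_vector"
  assumes Q: "bounded_linear Q" "\<And>x. norm (Q x) \<le> norm x"
    and x: "\<And>i. x i \<in> L1 M" and f: "bochner_integrable M f" and g: "bochner_integrable M g"
    and fg: "AE t in M. Q (f t) = g t"
  shows "bochner_norm M (\<lambda>t. tensor_fun (\<Sum>i<n. tensor (x i) (Q (w i))) t - g t)
    \<le> bochner_norm M (\<lambda>t. tensor_fun (\<Sum>i<n. tensor (x i) (w i)) t - f t)"
proof (rule bochner_norm_mono_AE)
  interpret Q: bounded_linear Q by (rule Q(1))
  show "AE t in M. norm (tensor_fun (\<Sum>i<n. tensor (x i) (Q (w i))) t - g t)
      \<le> norm (tensor_fun (\<Sum>i<n. tensor (x i) (w i)) t - f t)"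
    using fg
  proof eventually_elim
    case (elim t)
    have "tensor_fun (\<Sum>i<n. tensor (x i) (Q (w i))) t - g t
        = Q (tensor_fun (\<Sum>i<n. tensor (x i) (w i)) t - f t)"
      using elim by (simp add: tensor_fun_sum Q.sum Q.scaleR Q.diff)
    then show ?case using Q(2) by simp
  qed
qed (intro bochner_integrable_diff bochner_integrable_tensor_fun
    subspace_sum[OF subspace_algebraic_tensor] tensor_in_algebraic_tensor x f g)+

theorem theorem5p7:
  fixes M :: "'w measure"
    and Q :: "'x::banach \<Rightarrow> 'y::banach"
  assumes "quotient_operator Q"
    and "weakly_countably_determined {x. Q x = 0}"
    and "proximinal {x. Q x = 0}"
    and "norm_attaining_tensors (L1 M) (L1_norm M) TYPE('x)
      = projective_tensor (L1 M) (L1_norm M) TYPE('x)"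
  shows "norm_attaining_tensors (L1 M) (L1_norm M) TYPE('y)
      = projective_tensor (L1 M) (L1_norm M) TYPE('y)"
proof
  show "norm_attaining_tensors (L1 M) (L1_norm M) TYPE('y) \<subseteq> projective_tensor (L1 M) (L1_norm M) TYPE('y)"
    by (auto simp: norm_attaining_tensors_def)
  show "projective_tensor (L1 M) (L1_norm M) TYPE('y) \<subseteq> norm_attaining_tensors (L1 M) (L1_norm M) TYPE('y)"
  proof
    fix U :: "(nat \<Rightarrow> ('w \<Rightarrow> real, 'y) tensor) set"
    assume U: "U \<in> projective_tensor (L1 M) (L1_norm M) TYPE('y)"
    have bl: "bounded_linear Q" using assms(1) by (simp add: quotient_operator_def)
    have contr: "norm (Q x) \<le> norm x" for x
    proof -
      have "norm (Q x) = Inf {norm x' | x'. Q x' = Q x}" using assms(1) unfolding quotient_operator_def by blast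
      also have "\<dots> \<le> norm x" by (rule cInf_lower) (auto intro: bdd_belowI[of _ 0])
      finally show ?thesis .
    qed
    obtain g where g: "bochner_integrable M g" and U_eq: "U = tensor_class M g"
      using projective_tensor_eq_tensor_class[OF U] by blast
    obtain f where f: "strongly_measurable M f" and fg: "AE t in M. Q (f t) = g t \<and> norm (f t) \<le> norm (g t)"
      using ae_isometric_lift[OF assms(1-3), of M g] g unfolding bochner_integrable_def by blast
    have fb: "bochner_integrable M f"
      using g fg by (intro bochner_integrable_bound[OF f]) (auto simp: bochner_integrable_def)
    have norm_fg: "bochner_norm M f \<le> bochner_norm M g"
      using fg by (intro bochner_norm_mono_AE fb g) auto
    \<comment> \<open>The hypothesis on norm attainment is applied to the class of the lift.\<close>
    have "tensor_class M f \<in> norm_attaining_tensors (L1 M) (L1_norm M) TYPE('x)"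
      unfolding assms(4) by (rule tensor_class_in_projective_tensor[OF fb])
    then obtain x :: "nat \<Rightarrow> 'w \<Rightarrow> real" and w :: "nat \<Rightarrow> 'x" where x: "\<forall>i. x i \<in> L1 M"
      and partial: "(\<lambda>n. \<Sum>i<n. tensor (x i) (w i)) \<in> tensor_class M f"
      and sums: "(\<lambda>i. L1_norm M (x i) * norm (w i)) sums bochner_norm M f"
      unfolding norm_attaining_tensors_def completion_norm_tensor_class[OF fb, symmetric] by blast
    define v where "v n = (\<Sum>i<n. tensor (x i) (Q (w i)))" for n
    have vA: "v n \<in> algebraic_tensor (L1 M)" for n
      unfolding v_def using x
      by (intro subspace_sum[OF subspace_algebraic_tensor] tensor_in_algebraic_tensor) simp
    have "(\<lambda>n. bochner_norm M (\<lambda>t. tensor_fun (v n) t - g t)) \<longlonglongrightarrow> 0"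
    proof (rule tendsto_sandwich[OF _ _ tendsto_const])
      show "(\<lambda>n. bochner_norm M (\<lambda>t. tensor_fun (\<Sum>i<n. tensor (x i) (w i)) t - f t)) \<longlonglongrightarrow> 0"
        using partial by (simp add: tensor_class_def)
      have Qf: "AE t in M. Q (f t) = g t" using fg by eventually_elim simp
      show "\<forall>\<^sub>F n in sequentially. bochner_norm M (\<lambda>t. tensor_fun (v n) t - g t)
          \<le> bochner_norm M (\<lambda>t. tensor_fun (\<Sum>i<n. tensor (x i) (w i)) t - f t)"
        unfolding v_def
        by (intro always_eventually allI bochner_norm_sum_tensor_le[OF bl contr _ fb g Qf]) (use x in simp)
    qed (simp add: bochner_norm_nonneg)
    then have vU: "v \<in> U" using vA by (auto simp: U_eq tensor_class_def)
    have le: "L1_norm M (x i) * norm (Q (w i)) \<le> L1_norm M (x i) * norm (w i)" for i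
      by (intro mult_left_mono contr L1_norm_nonneg)
    have summ: "summable (\<lambda>i. L1_norm M (x i) * norm (Q (w i)))"
      by (rule summable_comparison_test'[OF sums_summable[OF sums]])
        (use le in \<open>simp add: L1_norm_nonneg\<close>)
    \<comment> \<open>The upper bound combines the contraction with the isometric lift; the lower
      bound is the triangle inequality for the partial sums, passed to the limit.\<close>
    have "(\<Sum>i. L1_norm M (x i) * norm (Q (w i))) = bochner_norm M g"
    proof (rule antisym)
      have "(\<Sum>i. L1_norm M (x i) * norm (Q (w i))) \<le> (\<Sum>i. L1_norm M (x i) * norm (w i))"
        by (rule suminf_le[OF le summ sums_summable[OF sums]])
      then show "(\<Sum>i. L1_norm M (x i) * norm (Q (w i))) \<le> bochner_norm M g"
        using norm_fg sums_unique[OF sums] by simp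
      have "(\<lambda>n. bochner_norm M (tensor_fun (v n))) \<longlonglongrightarrow> bochner_norm M g"
        using vU vA g unfolding U_eq tensor_class_def
        by (intro tendsto_bochner_norm bochner_integrable_tensor_fun) auto
      then show "bochner_norm M g \<le> (\<Sum>i. L1_norm M (x i) * norm (Q (w i)))"
      proof (rule LIMSEQ_le_const2, intro exI allI impI)
        fix n
        have "bochner_norm M (tensor_fun (v n)) \<le> pnorm M (v n)" by (rule bochner_norm_le_projective_norm[OF vA])
        also have "\<dots> \<le> (\<Sum>i<n. L1_norm M (x i) * norm (Q (w i)))"
          unfolding v_def using x by (intro projective_norm_le_sum) auto
        also have "\<dots> \<le> (\<Sum>i. L1_norm M (x i) * norm (Q (w i)))"
          by (rule sum_le_suminf[OF summ]) (auto simp: L1_norm_nonneg)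
        finally show "bochner_norm M (tensor_fun (v n)) \<le> (\<Sum>i. L1_norm M (x i) * norm (Q (w i)))" .
      qed
    qed
    then have "(\<lambda>i. L1_norm M (x i) * norm (Q (w i))) sums completion_norm (pnorm M) U"
      using summable_sums[OF summ] by (simp add: U_eq completion_norm_tensor_class[OF g])
    then show "U \<in> norm_attaining_tensors (L1 M) (L1_norm M) TYPE('y)"
      using U x vU unfolding norm_attaining_tensors_def v_def
      by (intro CollectI conjI exI[of _ x] exI[of _ "\<lambda>i. Q (w i)"]) simp_all
  qed
qed

end
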